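(* Let $F$ be a tract, $\Gamma$ an ordered abelian group, $M$ a (weak or strong) $F[\Gamma]$-matroid on a finite totally ordered set $E$, and $\mathbf u\in(\Gamma\cup\{\infty\})^E$. The circuits and cocircuits of $M^{\mathbf u}$ are precisely $$\mathcal C(M^{\mathbf u})=\operatorname{MinSupp}\left(\{C^{\mathbf u}: C\in\mathcal C(M)\}\right),$$ $$\mathcal C^*(M^{\mathbf u})=\operatorname{MinSupp}\left(\{(D\setminus Z_{\mathbf u})^{-\mathbf u^\circ}\times\{0_{Z_{\mathbf u}}\}: D\in\mathcal C^*(M),\ \underline D\cap Z_{\mathbf u}=\emptyset\}\right)\cup\{\alpha\cdot\chi_i:\alpha\in F^\times,\ i\in Z_{\mathbf u}\}.$$ If $\mathbf u\in\Gamma^E$, then the cocircuits are $\mathcal C^*(M^{\mathbf u})=\operatorname{MinSupp}(\{D^{-\mathbf u}: D\in\mathcal C^*(M)\})$ and the circuits are as in the first formula.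
   Context: Tracts. A tract $F=(F^\times,N_F)$ is a multiplicative abelian group $F^\times$ (identity $1$) together with a subset $N_F$ (the null set) of the group semiring $\mathbb N[F^\times]$ of finite formal sums such that: $0\in N_F$; $1\notin N_F$; there is a unique element $-1\in F^\times$ with $1+(-1)\in N_F$; and if $\sum a_i\in N_F$ then $\sum c a_i\in N_F$ for all $c\in F^\times$. We also write $F=F^\times\cup\{0\}$ with $0\cdot g=0$; zero terms of formal sums are dropped. A homomorphism of tracts is a group homomorphism $F_1^\times\to F_2^\times$ whose induced map on formal sums sends $N_{F_1}$ into $N_{F_2}$. Every tract carries a fixed involution $a\mapsto\overline a$ (a tract homomorphism $F\to F$ squaring to the identity); on $F[\Gamma]$ (below) it is $\overline{(a,\gamma)}=(\overline a,\gamma)$. Tropical extension. $\Gamma$ is a (totally) ordered abelian group, written additively; $\infty$ is larger than every element of $\Gamma$ and absorbing. $F[\Gamma]$ is the tract with group $F^\times\times\Gamma$, zero element $\infty$, and null set consisting of the zero sum and all finite sums $\sum_{i\in I}(a_i,\gamma_i)$ with $\sum_{i\in I_{\min}}a_i\in N_F$, where $I_{\min}=\{i\in I:\gamma_i\le\gamma_j\ \forall j\in I\}$. Put $\theta(a,\gamma)=a$, $\theta(\infty)=0$, $|(a,\gamma)|=\gamma$, $|\infty|=\infty$. Matroids. Let $0\le r\le|E|$. A strong Plücker vector of rank $r$ on $E$ is a nonzero function $P\colon\binom Er\to F$ with $\sum_{j\in J\setminus I}\operatorname{sign}(j;I,J)P(I+j)P(J-j)\in N_F$ for all $I\in\binom{E}{r-1}$,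 $J\in\binom{E}{r+1}$, where $\operatorname{sign}(j;I,J)=(-1)^\ell$, $\ell=\#\{j'\in J:j<j'\}+\#\{i\in I:j<i\}$. A weak Plücker vector is a nonzero function whose support is the set of bases of a matroid and which satisfies these relations whenever $|J\setminus I|=3$. A weak (resp. strong) $F$-matroid is an equivalence class of weak (resp. strong) Plücker vectors under scaling by $F^\times$. The support of $X\in F^E$ is $\underline X=\{i:X_i\ne0\}$. For $\tau=\{i_0<\dots<i_r\}$ let $(C_\tau)_{i_s}=(-1)^sP(\tau-i_s)$, $0$ elsewhere; the circuits $\mathcal C(M)\subseteq F^E$ are the $F^\times$-multiples of the nonzero $C_\tau$. An $F$-matroid is determined by its set of circuits. The dual $M^*$ has Plücker vector $P^*(I)=\operatorname{sign}(I,I^c)\overline{P(I^c)}$, $I^c=E\setminus I$, where $\operatorname{sign}(I,I^c)$ is the sign of the permutation listing $I$ then $I^c$, each increasingly. Cocircuits: $\mathcal C^*(M)=\mathcal C(M^* )$. Contraction and coloops. For $X\in F^E$, $A\subseteq E$, $X\setminus A\in F^{E\setminus A}$ is the restriction. $\operatorname{MinSupp}(\mathcal X)$ is the set of nonzero elements of $\mathcal X$ of inclusion-minimal support. $M/A$ is the $F$-matroid on $E\setminus A$ with circuits $\operatorname{MinSupp}\{C\setminus A:C\in\mathcal C(M)\}$. For $A$ disjoint from the ground set of $M$, $M+_{co\ell}A$ is the $F$-matroid on $E\sqcup A$ with circuits $\mathcal C(M)\times\{0_A\}$, $0_A=(0,\dots,0)\in F^A$. $\chi_i\in F^E$ has $1$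 in coordinate $i$ and $0$ elsewhere. Initial matroids. For $\mathbf u\in\Gamma^E$ and $M$ with Plücker vector $P\colon\binom Er\to F[\Gamma]$, $M^{\mathbf u}$ is the $F$-matroid with Plücker vector $P^{\mathbf u}(I)=\theta(P(I))$ if $|P(I)|-\sum_{i\in I}u_i\le|P(J)|-\sum_{j\in J}u_j$ for all $J\in\binom Er$, and $0$ otherwise. For $\mathbf u\in(\Gamma\cup\{\infty\})^E$ put $Z_{\mathbf u}=\{i:u_i=\infty\}$, $\mathbf u^\circ=\mathbf u\setminus Z_{\mathbf u}\in\Gamma^{E\setminus Z_{\mathbf u}}$, and $M^{\mathbf u}=(M/Z_{\mathbf u})^{\mathbf u^\circ}+_{co\ell}Z_{\mathbf u}$. Initial circuits. For a tuple $C$ over $F[\Gamma]$ indexed by a set $E$ and $\mathbf u\in(\Gamma\cup\{\infty\})^E$, $C^{\mathbf u}\in F^E$ is given by $C^{\mathbf u}_i=\theta(C_i)$ if $|C_i|+u_i\neq\infty$ and $|C_i|+u_i\le|C_j|+u_j$ for all $j\in E$, and $C^{\mathbf u}_i=0$ otherwise. *)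

theory Defs
  imports
    "HOL-Algebra.Group"
    "HOL-Library.Multiset"
    "HOL-Combinatorics.Permutations"
begin

section \<open>Tracts\<close>

text \<open>
  The carrier is the group \<open>F\<^sup>\<times>\<close>.  Elements of the group semiring \<open>\<nat>[F\<^sup>\<times>]\<close> are finite
  multisets over the carrier, the empty multiset being the zero sum.  The set
  \<open>F = F\<^sup>\<times> \<union> {0}\<close> is rendered by options, with \<^term>\<open>None\<close> for zero.  The fixed involution
  is part of the data.
\<close>

record 'f tract = "'f monoid" +
  nullset :: "'f multiset set"
  invol :: "'f \<Rightarrow> 'f"

definition tract_hom :: "'f tract \<Rightarrow> 'h tract \<Rightarrow> ('f \<Rightarrow> 'h) \<Rightarrow> bool" where
  "tract_hom F G h \<longleftrightarrow> h \<in> hom F G \<and> (\<forall>N\<in>nullset F. image_mset h N \<in> nullset G)"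

locale tract = comm_group F for F :: "'f tract" (structure) +
  assumes nullset_carrier: "N \<in> nullset F \<Longrightarrow> set_mset N \<subseteq> carrier F"
    and zero_null: "{#} \<in> nullset F"
    and one_not_null: "{#\<one>#} \<notin> nullset F"
    and unique_neg_one: "\<exists>!e. e \<in> carrier F \<and> {#\<one>, e#} \<in> nullset F"
    and scale_null: "N \<in> nullset F \<Longrightarrow> c \<in> carrier F \<Longrightarrow> {#c \<otimes> a. a \<in># N#} \<in> nullset F"
    and invol_hom: "tract_hom F F (invol F)"
    and invol_invol: "a \<in> carrier F \<Longrightarrow> invol F (invol F a) = a"

definition neg_one :: "'f tract \<Rightarrow> 'f" where
  "neg_one F = (THE e. e \<in> carrier F \<and> {#\<one>\<^bsub>F\<^esub>, e#} \<in> nullset F)"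

fun mul :: "'f tract \<Rightarrow> 'f option \<Rightarrow> 'f option \<Rightarrow> 'f option" where
  "mul F (Some a) (Some b) = Some (a \<otimes>\<^bsub>F\<^esub> b)"
| "mul F None y = None"
| "mul F x None = None"

definition neg_one_pow :: "'f tract \<Rightarrow> nat \<Rightarrow> 'f option" where
  "neg_one_pow F n = Some (neg_one F [^]\<^bsub>F\<^esub> n)"

definition formal_sum :: "('i \<Rightarrow> 'f option) \<Rightarrow> 'i set \<Rightarrow> 'f multiset" where
  "formal_sum t S = {#the (t i). i \<in># mset_set {i \<in> S. t i \<noteq> None}#}"


section \<open>Tropical extensions\<close>

text \<open>The ordered set \<open>\<Gamma> \<union> {\<infinity>}\<close>.\<close>

datatype 'g ext = Fin (fin: 'g) | Infty

instantiation ext :: (linorder) linorder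
begin

fun less_eq_ext :: "'a ext \<Rightarrow> 'a ext \<Rightarrow> bool" where
  "Fin a \<le> Fin b \<longleftrightarrow> a \<le> b"
| "Infty \<le> Fin b \<longleftrightarrow> False"
| "x \<le> Infty \<longleftrightarrow> True"

definition less_ext :: "'a ext \<Rightarrow> 'a ext \<Rightarrow> bool" where
  "x < y \<longleftrightarrow> x \<le> y \<and> \<not> y \<le> (x :: 'a ext)"

instance
proof
  fix x y z :: "'a ext"
  show "x < y \<longleftrightarrow> x \<le> y \<and> \<not> y \<le> x" by (rule less_ext_def)
  show "x \<le> x" by (cases x) auto
  show "x \<le> y \<Longrightarrow> y \<le> z \<Longrightarrow> x \<le> z" by (cases x; cases y; cases z) auto
  show "x \<le> y \<Longrightarrow> y \<le> x \<Longrightarrow> x = y" by (cases x; cases y) auto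
  show "x \<le> y \<or> y \<le> x" by (cases x; cases y) auto
qed

end

instantiation ext :: (plus) plus
begin

fun plus_ext :: "'a ext \<Rightarrow> 'a ext \<Rightarrow> 'a ext" where
  "Fin a + Fin b = Fin (a + b)"
| "Infty + y = Infty"
| "x + Infty = Infty"

instance ..

end

definition leading :: "('f \<times> 'g::linorder) multiset \<Rightarrow> 'f multiset" where
  "leading N = image_mset fst {#x \<in># N. \<forall>y\<in>#N. snd x \<le> snd y#}"

definition trop_ext :: "'f tract \<Rightarrow> ('f \<times> 'g::linordered_ab_group_add) tract" where
  "trop_ext F = \<lparr>
     carrier = carrier F \<times> UNIV,
     monoid.mult = (\<lambda>(a, g) (b, h). (a \<otimes>\<^bsub>F\<^esub> b, g + h)),
     monoid.one = (\<one>\<^bsub>F\<^esub>, 0),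
     nullset = {N. set_mset N \<subseteq> carrier F \<times> UNIV \<and> (N = {#} \<or> leading N \<in> nullset F)},
     invol = (\<lambda>(a, g). (invol F a, g))\<rparr>"

text \<open>The zero element \<open>\<infinity>\<close> of \<open>F[\<Gamma>]\<close> is \<^term>\<open>None\<close>.\<close>

definition theta :: "('f \<times> 'g) option \<Rightarrow> 'f option" where
  "theta x = map_option fst x"

definition val :: "('f \<times> 'g) option \<Rightarrow> 'g ext" where
  "val x = (case x of None \<Rightarrow> Infty | Some (a, g) \<Rightarrow> Fin g)"


section \<open>Vectors\<close>

text \<open>
  A vector in \<open>F\<^sup>E\<close> is a function that is zero (\<^term>\<open>None\<close>) outside \<open>E\<close>.  Hence the
  restriction of \<open>X\<close> to the complement of \<open>A\<close> is obtained by zeroing the coordinates in \<open>A\<close>,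
  and extending \<open>X\<close> by zero to a larger index set leaves the function unchanged.
\<close>

definition supp :: "('e \<Rightarrow> 'f option) \<Rightarrow> 'e set" where
  "supp X = {i. X i \<noteq> None}"

definition scale :: "'f tract \<Rightarrow> 'f \<Rightarrow> ('i \<Rightarrow> 'f option) \<Rightarrow> 'i \<Rightarrow> 'f option" where
  "scale F c X = (\<lambda>i. mul F (Some c) (X i))"

definition delete :: "('e \<Rightarrow> 'f option) \<Rightarrow> 'e set \<Rightarrow> 'e \<Rightarrow> 'f option" where
  "delete X A = (\<lambda>i. if i \<in> A then None else X i)"

definition chi :: "'f tract \<Rightarrow> 'e \<Rightarrow> 'e \<Rightarrow> 'f option" where
  "chi F i = (\<lambda>j. if j = i then Some \<one>\<^bsub>F\<^esub> else None)"

definition min_supp :: "('e \<Rightarrow> 'f option) set \<Rightarrow> ('e \<Rightarrow> 'f option) set" where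
  "min_supp \<X> = {X \<in> \<X>. supp X \<noteq> {} \<and> \<not> (\<exists>Y\<in>\<X>. supp Y \<noteq> {} \<and> supp Y \<subset> supp X)}"


section \<open>Matroids over tracts\<close>

definition matroid_bases :: "'e set \<Rightarrow> 'e set set \<Rightarrow> bool" where
  "matroid_bases E \<B> \<longleftrightarrow> \<B> \<noteq> {} \<and> (\<forall>A\<in>\<B>. A \<subseteq> E) \<and>
     (\<forall>A\<in>\<B>. \<forall>B\<in>\<B>. \<forall>x\<in>A - B. \<exists>y\<in>B - A. insert y (A - {x}) \<in> \<B>)"

text \<open>
  A function on the \<open>r\<close>-subsets of \<open>E\<close> is extended by zero to all sets.
\<close>

definition pv_function :: "'f tract \<Rightarrow> 'e set \<Rightarrow> nat \<Rightarrow> ('e set \<Rightarrow> 'f option) \<Rightarrow> bool" where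
  "pv_function F E r P \<longleftrightarrow>
     (\<forall>I a. P I = Some a \<longrightarrow> I \<subseteq> E \<and> card I = r \<and> a \<in> carrier F) \<and> (\<exists>I. P I \<noteq> None)"

definition pluecker_relation ::
    "'f tract \<Rightarrow> ('e::linorder set \<Rightarrow> 'f option) \<Rightarrow> 'e set \<Rightarrow> 'e set \<Rightarrow> bool" where
  "pluecker_relation F P I J \<longleftrightarrow>
     formal_sum (\<lambda>j. mul F (neg_one_pow F (card {j' \<in> J. j < j'} + card {i \<in> I. j < i}))
                           (mul F (P (insert j I)) (P (J - {j})))) (J - I) \<in> nullset F"

datatype kind = Weak | Strong

text \<open>
  The sets \<open>I\<close> have size \<open>r - 1\<close>, which is written without truncated subtraction, so that there
  are none when \<open>r = 0\<close>.
\<close>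

fun pluecker :: "kind \<Rightarrow> 'f tract \<Rightarrow> 'e::linorder set \<Rightarrow> nat \<Rightarrow> ('e set \<Rightarrow> 'f option) \<Rightarrow> bool" where
  "pluecker Strong F E r P \<longleftrightarrow> pv_function F E r P \<and>
     (\<forall>I J. I \<subseteq> E \<and> J \<subseteq> E \<and> card I + 1 = r \<and> card J = r + 1 \<longrightarrow> pluecker_relation F P I J)"
| "pluecker Weak F E r P \<longleftrightarrow> pv_function F E r P \<and> matroid_bases E {B. P B \<noteq> None} \<and>
     (\<forall>I J. I \<subseteq> E \<and> J \<subseteq> E \<and> card I + 1 = r \<and> card J = r + 1 \<and> card (J - I) = 3
        \<longrightarrow> pluecker_relation F P I J)"

text \<open>A matroid over a tract: ground set, rank, and equivalence class of Pluecker vectors.\<close>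

record ('e, 'f) fmatroid =
  ground :: "'e set"
  rk :: nat
  pvs :: "('e set \<Rightarrow> 'f option) set"

definition scaling_class :: "'f tract \<Rightarrow> ('e set \<Rightarrow> 'f option) \<Rightarrow> ('e set \<Rightarrow> 'f option) set" where
  "scaling_class F P = {scale F c P | c. c \<in> carrier F}"

definition is_fmatroid :: "kind \<Rightarrow> 'f tract \<Rightarrow> ('e::linorder, 'f) fmatroid \<Rightarrow> bool" where
  "is_fmatroid k F M \<longleftrightarrow> finite (ground M) \<and> rk M \<le> card (ground M) \<and>
     (\<exists>P. pluecker k F (ground M) (rk M) P \<and> pvs M = scaling_class F P)"

definition circuit_vector ::
    "'f tract \<Rightarrow> ('e::linorder set \<Rightarrow> 'f option) \<Rightarrow> 'e set \<Rightarrow> 'e \<Rightarrow> 'f option" where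
  "circuit_vector F P \<tau> =
     (\<lambda>i. if i \<in> \<tau> then mul F (neg_one_pow F (card {j \<in> \<tau>. j < i})) (P (\<tau> - {i})) else None)"

definition circuits :: "'f tract \<Rightarrow> ('e::linorder, 'f) fmatroid \<Rightarrow> ('e \<Rightarrow> 'f option) set" where
  "circuits F M = {scale F c (circuit_vector F P \<tau>) | c P \<tau>.
     c \<in> carrier F \<and> P \<in> pvs M \<and> \<tau> \<subseteq> ground M \<and> card \<tau> = rk M + 1 \<and>
     supp (circuit_vector F P \<tau>) \<noteq> {}}"

text \<open>
  The permutation of \<open>E\<close> that sends the \<open>k\<close>-th element of \<open>E\<close> to the \<open>k\<close>-th entry of the list
  consisting of \<open>I\<close> followed by its complement, each in increasing order.
\<close>

definition listing_perm :: "'e::linorder set \<Rightarrow> 'e set \<Rightarrow> 'e \<Rightarrow> 'e" where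
  "listing_perm E I = (\<lambda>x. if x \<in> E
     then (sorted_list_of_set I @ sorted_list_of_set (E - I)) ! card {y \<in> E. y < x} else x)"

definition dual_pv ::
    "'f tract \<Rightarrow> 'e::linorder set \<Rightarrow> ('e set \<Rightarrow> 'f option) \<Rightarrow> 'e set \<Rightarrow> 'f option" where
  "dual_pv F E P = (\<lambda>I. if I \<subseteq> E
     then mul F (neg_one_pow F (if sign (listing_perm E I) = 1 then 0 else 1))
                (map_option (invol F) (P (E - I)))
     else None)"

text \<open>
  In the next definition, and in that of \<open>initial_fin\<close> below, the scaling class does not depend
  on the representative \<open>P\<close>, so the union is just that class.
\<close>

definition dual :: "'f tract \<Rightarrow> ('e::linorder, 'f) fmatroid \<Rightarrow> ('e, 'f) fmatroid" where
  "dual F M = \<lparr>ground = ground M, rk = card (ground M) - rk M,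
     pvs = (\<Union>P\<in>pvs M. scaling_class F (dual_pv F (ground M) P))\<rparr>"

definition cocircuits :: "'f tract \<Rightarrow> ('e::linorder, 'f) fmatroid \<Rightarrow> ('e \<Rightarrow> 'f option) set" where
  "cocircuits F M = circuits F (dual F M)"

definition contract ::
    "kind \<Rightarrow> 'f tract \<Rightarrow> ('e::linorder, 'f) fmatroid \<Rightarrow> 'e set \<Rightarrow> ('e, 'f) fmatroid" where
  "contract k F M A = (THE N. is_fmatroid k F N \<and> ground N = ground M - A \<and>
     circuits F N = min_supp {delete C A | C. C \<in> circuits F M})"

text \<open>Extending vectors by zero on \<open>A\<close> does not change the representing functions.\<close>

definition add_coloops ::
    "kind \<Rightarrow> 'f tract \<Rightarrow> ('e::linorder, 'f) fmatroid \<Rightarrow> 'e set \<Rightarrow> ('e, 'f) fmatroid" where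
  "add_coloops k F M A = (THE N. is_fmatroid k F N \<and> ground N = ground M \<union> A \<and>
     circuits F N = circuits F M)"


section \<open>Initial matroids and initial circuits\<close>

definition initial_pv ::
    "'e set \<Rightarrow> nat \<Rightarrow> ('e \<Rightarrow> 'g::linordered_ab_group_add) \<Rightarrow>
     ('e set \<Rightarrow> ('f \<times> 'g) option) \<Rightarrow> 'e set \<Rightarrow> 'f option" where
  "initial_pv E r v P = (\<lambda>I. if I \<subseteq> E \<and> card I = r \<and>
       (\<forall>J. J \<subseteq> E \<and> card J = r \<longrightarrow>
          val (P I) + Fin (- (\<Sum>i\<in>I. v i)) \<le> val (P J) + Fin (- (\<Sum>j\<in>J. v j)))
     then theta (P I) else None)"

definition initial_fin ::
    "'f tract \<Rightarrow> ('e, 'f \<times> 'g::linordered_ab_group_add) fmatroid \<Rightarrow> ('e \<Rightarrow> 'g) \<Rightarrow>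
     ('e, 'f) fmatroid" where
  "initial_fin F M v = \<lparr>ground = ground M, rk = rk M,
     pvs = (\<Union>P\<in>pvs M. scaling_class F (initial_pv (ground M) (rk M) v P))\<rparr>"

definition infty_set :: "'e set \<Rightarrow> ('e \<Rightarrow> 'g ext) \<Rightarrow> 'e set" where
  "infty_set E u = {i \<in> E. u i = Infty}"

definition initial ::
    "kind \<Rightarrow> 'f tract \<Rightarrow> ('e::linorder, 'f \<times> 'g::linordered_ab_group_add) fmatroid \<Rightarrow>
     ('e \<Rightarrow> 'g ext) \<Rightarrow> ('e, 'f) fmatroid" where
  "initial k F M u = (let Z = infty_set (ground M) u in
     add_coloops k F (initial_fin F (contract k (trop_ext F) M Z) (\<lambda>i. fin (u i))) Z)"

definition initial_vec ::
    "'e set \<Rightarrow> ('e \<Rightarrow> 'g::linordered_ab_group_add ext) \<Rightarrow> ('e \<Rightarrow> ('f \<times> 'g) option) \<Rightarrow>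
     'e \<Rightarrow> 'f option" where
  "initial_vec E u C = (\<lambda>i. if i \<in> E \<and> val (C i) + u i \<noteq> Infty \<and>
       (\<forall>j\<in>E. val (C i) + u i \<le> val (C j) + u j)
     then theta (C i) else None)"

end

theory Submission
  imports Defs "HOL-Library.Product_Plus" "HOL-Library.Product_Lexorder"
begin

text \<open>
  Only the three-term relations are used for the circuits, so weak and strong matroids are treated
  together.  Subtracting \<open>u\<close> from the valuation, \<open>M\<^sup>u\<close> lives on the bases of minimal weight
  \<open>w\<close>; they form a matroid by Murota's theorem that local exchange implies valuated exchange.
  The initial form of a circuit \<open>C\<^sub>\<tau>\<close> is supported on a dependent set of this matroid.  If that
  support \<open>T\<close> is minimal, let \<open>B\<close> be a basis of minimal weight that contains \<open>T - i\<close>.  Exchange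
  moves \<open>\<tau> - i\<close> towards \<open>B\<close>: replace some \<open>x \<in> \<tau> - T\<close> by some \<open>y \<in> B\<close>, where \<open>x\<close> is chosen to
  make \<open>\<tau> + y - x - i\<close> or \<open>\<tau> + y - x - j\<close> as light as possible.  Then one term of the three-term
  relation for \<open>i, j, x, y\<close> is too heavy to contribute, and the remaining two say that the ratio of
  the \<open>i\<close>- and \<open>j\<close>-entries is unchanged.  Hence the initial form of \<open>C\<^sub>\<tau>\<close> is proportional to the
  circuit \<open>C\<^bsub>B + i\<^esub>\<close> of \<open>M\<^sup>u\<close>.

  A weight \<open>\<infinity>\<close> on \<open>Z\<close> is a lexicographically dominant finite weight in \<open>\<int> \<times> \<Gamma>\<close>.  For such a
  weight the initial matroid splits along \<open>Z\<close>, and the circuits that avoid \<open>Z\<close> are those of the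
  contraction.  Cocircuits follow by duality, which turns contraction into deletion.
\<close>

section \<open>Tracts and formal sums\<close>

text \<open>The locale \<open>valuated\<close> separates coefficients in \<open>F\<close> from
  weights and keeps two consequences of the Pluecker relations: the exchange inequality and the
  three-term relation with a negligible third product. Both survive forgetting the weights, shifting
  them by a modular function, embedding them in a larger ordered group, and passing to the lightest
  bases. The same argument, run with different weights, thus yields the underlying matroid,
  contraction, and finite and infinite \<open>u\<close>. The obstacle is that an initial form may
  come from a \<tau> for which no \<tau> - k is a lightest basis; then it is not itself a vector of
  the initial Pluecker vector. Weak matroids offer only three-term relations for comparing it with a
  fundamental circuit, hence the walk through intermediate \<tau>. \<open>contract\<close> and
  \<open>add_coloops\<close> are definite descriptions. Explicit Pluecker vectors
  (\<open>restr\<close>, \<open>coext\<close>) give existence; uniqueness holds because circuits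
  determine the rank and, up to a scalar, the Pluecker vector.\<close>

definition elt :: "'f tract \<Rightarrow> 'f option \<Rightarrow> bool" where
  "elt F x \<longleftrightarrow> set_option x \<subseteq> carrier F"

lemma elt_None [simp]: "elt F None"
  and elt_Some [simp]: "elt F (Some a) \<longleftrightarrow> a \<in> carrier F"
  by (simp_all add: elt_def)

lemma mul_None_right [simp]: "mul F x None = None"
  by (cases x) auto

lemma mul_eq_None [simp]: "mul F x y = None \<longleftrightarrow> x = None \<or> y = None"
  by (cases x; cases y) auto

lemma trop_ext_sel [simp]:
  "carrier (trop_ext F) = carrier F \<times> UNIV"
  "monoid.mult (trop_ext F) = (\<lambda>x y. (fst x \<otimes>\<^bsub>F\<^esub> fst y, snd x + snd y))"
  "\<one>\<^bsub>trop_ext F\<^esub> = (\<one>\<^bsub>F\<^esub>, 0)"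
  "N \<in> nullset (trop_ext F) \<longleftrightarrow>
     set_mset N \<subseteq> carrier F \<times> UNIV \<and> (N = {#} \<or> leading N \<in> nullset F)"
  "invol (trop_ext F) = (\<lambda>x. (invol F (fst x), snd x))"
  by (auto simp: trop_ext_def case_prod_beta fun_eq_iff)

lemma neg_one_pow_neq_None [simp]: "neg_one_pow F n \<noteq> None"
  by (simp add: neg_one_pow_def)

lemma formal_sum_cong:
  assumes "\<And>j. j \<in> S \<Longrightarrow> s j = t j"
  shows "formal_sum s S = formal_sum t S"
proof -
  have "{i \<in> S. s i \<noteq> None} = {i \<in> S. t i \<noteq> None}" using assms by auto
  then show ?thesis unfolding formal_sum_def
    by (auto intro!: image_mset_cong simp: assms)
     (metis (no_types, lifting) assms elem_mset_set finite_set_mset_mset_set mem_Collect_eq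
       mset_set.infinite set_mset_empty empty_iff)
qed

lemma formal_sum_map:
  "formal_sum (\<lambda>j. map_option h (t j)) S = image_mset h (formal_sum t S)"
proof (cases "finite {i \<in> S. t i \<noteq> None}")
  case True
  then show ?thesis unfolding formal_sum_def
    by (auto simp: multiset.map_comp intro!: image_mset_cong)
next
  case False
  then show ?thesis by (simp add: formal_sum_def)
qed

lemma formal_sum_support:
  assumes "T \<subseteq> S" "\<And>j. j \<in> S - T \<Longrightarrow> t j = None"
  shows "formal_sum t S = formal_sum t T"
proof -
  have "{i \<in> S. t i \<noteq> None} = {i \<in> T. t i \<noteq> None}" 
    using assms(1) assms(2)[OF DiffI] by fastforce
  then show ?thesis by (simp add: formal_sum_def)
qed

lemma formal_sum_None: "(\<And>j. j \<in> S \<Longrightarrow> t j = None) \<Longrightarrow> formal_sum t S = {#}"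
  using formal_sum_support[of "{}" S t] by (simp add: formal_sum_def)

lemma formal_sum_insert:
  assumes "finite S" "x \<notin> S"
  shows "formal_sum t (insert x S) =
    (case t x of None \<Rightarrow> formal_sum t S | Some a \<Rightarrow> add_mset a (formal_sum t S))"
proof (cases "t x")
  case None
  then have "{i \<in> insert x S. t i \<noteq> None} = {i \<in> S. t i \<noteq> None}" by auto
  then show ?thesis using None by (simp add: formal_sum_def)
next
  case (Some a)
  then have "{i \<in> insert x S. t i \<noteq> None} = insert x {i \<in> S. t i \<noteq> None}" by auto
  then show ?thesis using Some assms by (simp add: formal_sum_def)
qed

lemma formal_sum_empty [simp]: "formal_sum t {} = {#}"
  by (simp add: formal_sum_def)

context tract
begin

lemma neg_one_closed [simp]: "neg_one F \<in> carrier F"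
  and neg_one_null: "{#\<one>, neg_one F#} \<in> nullset F"
  using theI'[OF unique_neg_one] by (simp_all add: neg_one_def)

lemma neg_one_unique: "e \<in> carrier F \<Longrightarrow> {#\<one>, e#} \<in> nullset F \<Longrightarrow> e = neg_one F"
  using unique_neg_one neg_one_closed neg_one_null by blast

lemma not_null_single: "a \<in> carrier F \<Longrightarrow> {#a#} \<notin> nullset F"
  using scale_null[of "{#a#}" "inv a"] one_not_null by auto

lemma null_pair:
  assumes "a \<in> carrier F" "b \<in> carrier F" "{#a, b#} \<in> nullset F"
  shows "b = neg_one F \<otimes> a"
proof -
  have "{#\<one>, inv a \<otimes> b#} \<in> nullset F"
    using scale_null[OF assms(3), of "inv a"] assms by simp
  then have "inv a \<otimes> b = neg_one F" using assms by (intro neg_one_unique) auto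
  then show ?thesis using assms by (metis inv_closed inv_solve_left m_comm neg_one_closed)
qed

lemma neg_one_square: "neg_one F \<otimes> neg_one F = \<one>"
  using null_pair[of "neg_one F" \<one>] neg_one_null by (simp add: add_mset_commute)

lemma invol_closed [simp]: "a \<in> carrier F \<Longrightarrow> invol F a \<in> carrier F"
  and invol_mult: "a \<in> carrier F \<Longrightarrow> b \<in> carrier F \<Longrightarrow> invol F (a \<otimes> b) = invol F a \<otimes> invol F b"
  and invol_null: "N \<in> nullset F \<Longrightarrow> image_mset (invol F) N \<in> nullset F"
  using invol_hom by (auto simp: tract_hom_def hom_def)

lemma invol_one [simp]: "invol F \<one> = \<one>"
  by (metis invol_closed invol_mult l_cancel_one one_closed r_one)

lemma invol_neg_one [simp]: "invol F (neg_one F) = neg_one F"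
  using invol_null[OF neg_one_null] by (intro neg_one_unique) auto

lemma elt_mul [simp]: "elt F x \<Longrightarrow> elt F y \<Longrightarrow> elt F (mul F x y)"
  by (cases x; cases y) auto

lemma mul_assoc: "elt F x \<Longrightarrow> elt F y \<Longrightarrow> elt F z \<Longrightarrow> mul F (mul F x y) z = mul F x (mul F y z)"
  by (cases x; cases y; cases z) (auto simp: m_assoc)

lemma mul_comm: "elt F x \<Longrightarrow> elt F y \<Longrightarrow> mul F x y = mul F y x"
  by (cases x; cases y) (auto simp: m_comm)

lemma mul_left_comm:
  "elt F x \<Longrightarrow> elt F y \<Longrightarrow> elt F z \<Longrightarrow> mul F x (mul F y z) = mul F y (mul F x z)"
  by (metis mul_assoc mul_comm)

lemmas mul_ac = mul_assoc mul_comm mul_left_comm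

lemma mul_one [simp]: "elt F x \<Longrightarrow> mul F (Some \<one>) x = x"
  by (cases x) auto

lemma mul_cancel:
  "c \<noteq> None \<Longrightarrow> elt F c \<Longrightarrow> elt F x \<Longrightarrow> elt F y \<Longrightarrow> mul F c x = mul F c y \<Longrightarrow> x = y"
  by (cases c; cases x; cases y) auto

abbreviation sg :: "nat \<Rightarrow> 'f option" where "sg \<equiv> neg_one_pow F"

lemma elt_sg [simp]: "elt F (sg n)"
  by (simp add: neg_one_pow_def)

lemma sg_add: "mul F (sg m) (sg n) = sg (m + n)"
  by (simp add: neg_one_pow_def nat_pow_mult)

lemma sg_even: "even n \<Longrightarrow> sg n = Some \<one>"
proof -
  assume "even n"
  then have "neg_one F [^] n = \<one>"
    by (induction n rule: nat_induct2) (auto simp: m_assoc neg_one_square)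
  then show ?thesis by (simp add: neg_one_pow_def)
qed

lemma sg_parity: "even (m + n) \<Longrightarrow> sg m = sg n"
proof (cases "even m")
  case False
  moreover assume "even (m + n)"
  ultimately obtain a b where "m = 1 + 2 * a" "n = 1 + 2 * b" by (metis oddE add.commute even_add)
  then show ?thesis using sg_add[of 1 "2 * a"] sg_add[of 1 "2 * b"] by (simp add: sg_even)
qed (simp add: sg_even)

lemma sg_sg: "elt F x \<Longrightarrow> mul F (sg m) (mul F (sg n) x) = mul F (sg (m + n)) x"
  by (simp add: mul_assoc[symmetric] sg_add)

lemma mul_sg_eq_iff:
  "elt F x \<Longrightarrow> elt F y \<Longrightarrow> mul F (sg m) x = mul F (sg n) y \<longleftrightarrow> x = mul F (sg (m + n)) y"
proof -
  assume x: "elt F x" and y: "elt F y"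
  have "mul F (sg m) x = mul F (sg m) (mul F (sg (m + n)) y) \<longleftrightarrow> x = mul F (sg (m + n)) y"
    using x y mul_cancel[of "sg m" x "mul F (sg (m + n)) y"] by auto
  moreover have "mul F (sg m) (mul F (sg (m + n)) y) = mul F (sg n) y"
    using sg_sg[OF y, of m "m + n"] sg_parity[of "m + (m + n)" n] by (metis add.assoc even_add)
  ultimately show ?thesis by simp
qed

lemma invol_sg: "map_option (invol F) (sg n) = sg n"
proof -
  have "invol F (neg_one F [^] n) = neg_one F [^] n"
    by (induction n) (auto simp: invol_mult)
  then show ?thesis by (simp add: neg_one_pow_def)
qed

lemma map_option_invol_mul:
  "elt F x \<Longrightarrow> elt F y \<Longrightarrow>
    map_option (invol F) (mul F x y) = mul F (map_option (invol F) x) (map_option (invol F) y)"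
  by (cases x; cases y) (auto simp: invol_mult)

lemma elt_map_invol [simp]: "elt F x \<Longrightarrow> elt F (map_option (invol F) x)"
  by (cases x) auto

lemma formal_sum_mul:
  "formal_sum (\<lambda>j. mul F (Some c) (t j)) S = {#c \<otimes> a. a \<in># formal_sum t S#}"
proof -
  have "mul F (Some c) x = map_option (\<lambda>a. c \<otimes> a) x" for x by (cases x) auto
  then show ?thesis by (simp add: formal_sum_map)
qed

lemma null_formal_sum_mul:
  assumes "c \<noteq> None" "elt F c" "formal_sum t S \<in> nullset F"
    "\<And>j. j \<in> S \<Longrightarrow> t' j = mul F c (t j)"
  shows "formal_sum t' S \<in> nullset F"
proof -
  obtain a where c: "c = Some a" "a \<in> carrier F" using assms by (cases c) auto
  have "formal_sum t' S = formal_sum (\<lambda>j. mul F c (t j)) S"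
    using assms by (intro formal_sum_cong) auto
  then show ?thesis using assms c by (auto simp: formal_sum_mul intro: scale_null)
qed

lemma tract_trop_ext: "tract (trop_ext F :: ('f \<times> 'g::linordered_ab_group_add) tract)"
proof -
  let ?T = "trop_ext F :: ('f \<times> 'g) tract"
  \<comment> \<open>Multiplication by a fixed element and the involution both send (a, g) to (h a,
    \<gamma> + g). A common shift of the valuations leaves the set of leading terms alone, so both
    axioms reduce to those of \<open>F\<close>.\<close>
  have leading_image: "leading (image_mset (\<lambda>x. (h (fst x), \<gamma> + snd x)) N) =
      image_mset h (leading N)" for h :: "'f \<Rightarrow> 'f" and \<gamma> and N :: "('f \<times> 'g) multiset"
    by (simp add: leading_def filter_mset_image_mset multiset.map_comp comp_def)
  have group: "comm_group ?T"
  proof (rule comm_groupI)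
    fix x assume "x \<in> carrier ?T"
    then show "\<exists>y\<in>carrier ?T. y \<otimes>\<^bsub>?T\<^esub> x = \<one>\<^bsub>?T\<^esub>"
      by (intro bexI[of _ "(inv (fst x), - snd x)"]) auto
  qed (auto simp: m_ac add.assoc add.commute)
  have neg: "\<exists>!e. e \<in> carrier ?T \<and> {#\<one>\<^bsub>?T\<^esub>, e#} \<in> nullset ?T"
  proof (rule ex1I[of _ "(neg_one F, 0)"])
    show "(neg_one F, 0) \<in> carrier ?T \<and> {#\<one>\<^bsub>?T\<^esub>, (neg_one F, 0)#} \<in> nullset ?T"
      using neg_one_null by (simp add: leading_def)
    \<comment> \<open>If \<open>e\<close> had nonzero valuation, the leading part would be a single
      element, and single elements are never null.\<close>
    fix e assume "e \<in> carrier ?T \<and> {#\<one>\<^bsub>?T\<^esub>, e#} \<in> nullset ?T"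
    then show "e = (neg_one F, 0)"
      using not_null_single neg_one_unique
      by (cases e) (auto simp: leading_def split: if_splits)
  qed
  have scale: "{#c \<otimes>\<^bsub>?T\<^esub> a. a \<in># N#} \<in> nullset ?T" if "N \<in> nullset ?T" "c \<in> carrier ?T" for N c
    using that leading_image[of "\<lambda>a. fst c \<otimes> a" "snd c" N] scale_null[of "leading N" "fst c"]
    by (auto simp: mem_Times_iff)
  have null: "image_mset (invol ?T) N \<in> nullset ?T" if "N \<in> nullset ?T" for N
    using that leading_image[of "invol F" 0 N] invol_null[of "leading N"]
    by (auto simp: mem_Times_iff)
  have hom: "tract_hom ?T ?T (invol ?T)"
    unfolding tract_hom_def by (intro conjI ballI null) (auto simp: hom_def invol_mult)
  have one: "{#\<one>\<^bsub>?T\<^esub>#} \<notin> nullset ?T"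
    using one_not_null by (simp add: leading_def)
  show ?thesis
  proof (intro tract.intro tract_axioms.intro group neg one hom scale)
    show "set_mset N \<subseteq> carrier ?T" if "N \<in> nullset ?T" for N
      using that by simp
  qed (simp_all add: invol_invol prod_eq_iff mem_Times_iff)
qed

end

section \<open>Local exchange in valuated matroids\<close>

lemma finite_minimizer:
  fixes f :: "'a \<Rightarrow> 'b::linorder"
  assumes "finite V" "V \<noteq> {}"
  obtains v where "v \<in> V" "\<And>x. x \<in> V \<Longrightarrow> f v \<le> f x"
  using arg_min_if_finite(1)[OF assms, of f] arg_min_least[OF assms, of _ f] that by blast

text \<open>Induction on |B - A|, with \<open>A\<close> and \<open>u\<close> fixed. If exchange at
  \<open>u\<close> fails, a potential \<open>p\<close> on B - A records the failure. The basis B' =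
  B - v0 + u0 is chosen with \<open>w B' - p v0\<close> least; the pair (A, B') is closer and so
  satisfies exchange, and local exchange between \<open>B\<close> and B' - v + u contradicts the
  resulting inequality.\<close>

lemma local_exchange_imp_exchange:
  fixes w :: "'e set \<Rightarrow> 'g::linordered_ab_group_add"
  assumes fin: "finite E"
    and bases: "matroid_bases E \<B>"
    and card: "\<And>B. B \<in> \<B> \<Longrightarrow> card B = r"
    and loc: "\<And>A B x. \<lbrakk>A \<in> \<B>; B \<in> \<B>; card (B - A) = 2; x \<in> A - B\<rbrakk> \<Longrightarrow>
      \<exists>y\<in>B - A. insert y (A - {x}) \<in> \<B> \<and> insert x (B - {y}) \<in> \<B> \<and>
        w (insert y (A - {x})) + w (insert x (B - {y})) \<le> w A + w B"
    and eps: "0 < (\<epsilon> :: 'g)"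
    and AB: "A \<in> \<B>" "B \<in> \<B>" "u \<in> A - B"
  shows "\<exists>y\<in>B - A. insert y (A - {u}) \<in> \<B> \<and> insert u (B - {y}) \<in> \<B> \<and>
    w (insert y (A - {u})) + w (insert u (B - {y})) \<le> w A + w B"
  using AB(2,3)
proof (induction "card (B - A)" arbitrary: B rule: less_induct)
  case less
  note B = \<open>B \<in> \<B>\<close> and u = \<open>u \<in> A - B\<close>
  have finite_basis: "finite C" if "C \<in> \<B>" for C
    using bases that fin unfolding matroid_bases_def by (meson finite_subset)
  have exch: "\<exists>y\<in>D - C. insert y (C - {x}) \<in> \<B>" if "C \<in> \<B>" "D \<in> \<B>" "x \<in> C - D" for C D x
    using bases that unfolding matroid_bases_def by blast
  have fA: "finite A" and fB: "finite B" using finite_basis AB(1) B by auto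
  have cards: "card (A - B) = card (B - A)"
    using card_le_sym_Diff[of A B] card_le_sym_Diff[of B A] fA fB card[OF AB(1)] card[OF B] by simp
  have pos: "card (B - A) > 0" using cards u fA by (metis card_gt_0_iff empty_iff finite_Diff)
  consider "card (B - A) = 1" | "card (B - A) = 2" | "card (B - A) \<ge> 3" using pos by linarith
  then show ?case
  proof cases
    case 1
    then obtain v where v: "B - A = {v}" by (auto simp: card_Suc_eq)
    have "card (A - B) = 1" using 1 cards by simp
    then have "A - B = {u}" using u by (metis card_1_singletonE singletonD)
    then have "insert v (A - {u}) = B" "insert u (B - {v}) = A" using v by auto
    then show ?thesis using v AB(1) B by (auto simp: add.commute)
  next
    case 2
    then show ?thesis using loc[OF AB(1) B] u by blast
  next
    case 3
    show ?thesis
    proof (rule ccontr)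
      assume "\<not> ?thesis"
      then have bad: "w A + w B < w (insert v (A - {u})) + w (insert u (B - {v}))"
        if "v \<in> B - A" "insert v (A - {u}) \<in> \<B>" "insert u (B - {v}) \<in> \<B>" for v
        using that by fastforce
      \<comment> \<open>Where A - u + v is a basis, adding \<open>p v\<close> to its weight gives
        \<open>w A\<close>, the same for all v. Elsewhere \<open>p\<close> is chosen for
        \<open>p1\<close> alone, and subtracting \<open>\<epsilon>\<close> makes that inequality
        strict.\<close>
      define p where "p v = (if insert v (A - {u}) \<in> \<B> then w A - w (insert v (A - {u}))
        else w (insert u (B - {v})) - w B - \<epsilon>)" for v
      have p1: "w B + p v < w (insert u (B - {v}))"
        if "v \<in> B - A" "insert u (B - {v}) \<in> \<B>" for v
      proof (cases "insert v (A - {u}) \<in> \<B>")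
        case True
        then show ?thesis using bad[OF that(1) True that(2)] by (simp add: p_def algebra_simps)
      qed (use eps in \<open>simp add: p_def algebra_simps\<close>)
      \<comment> \<open>Some u0 other than \<open>u\<close> can also be exchanged into
        \<open>B\<close>. If exchange at v1 offers \<open>u\<close>, go two steps towards
        \<open>A\<close>, adding \<open>u\<close> and then u2, and exchange \<open>u\<close> out
        again towards \<open>B\<close>: what remains is \<open>B\<close> with u2 in place of v1 or
        v2.\<close>
      obtain u0 v1 where u0: "u0 \<in> A - B" "u0 \<noteq> u" and v1: "v1 \<in> B - A" "insert u0 (B - {v1}) \<in> \<B>"
      proof -
        obtain v1 where v1: "v1 \<in> B - A" using 3 by (metis card.empty ex_in_conv not_numeral_le_zero)
        obtain u1 where u1: "u1 \<in> A - B" "insert u1 (B - {v1}) \<in> \<B>"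
          using exch[OF B AB(1) v1] by blast
        show ?thesis
        proof (cases "u1 = u")
          case False
          then show ?thesis using that u1 v1 by blast
        next
          case True
          define B1 where "B1 = insert u (B - {v1})"
          have B1: "B1 \<in> \<B>" using u1 True B1_def by simp
          have "card (B - A - {v1}) \<noteq> 0" using 3 v1 fB by simp
          then have "B - A - {v1} \<noteq> {}" by (metis card.empty)
          then obtain v2 where v2: "v2 \<in> B - A" "v2 \<noteq> v1" by blast
          then have "v2 \<in> B1 - A" using B1_def by auto
          then obtain u2 where u2: "u2 \<in> A - B1" "insert u2 (B1 - {v2}) \<in> \<B>"
            using exch[OF B1 AB(1)] by blast
          define B2 where "B2 = insert u2 (B1 - {v2})"
          have u2': "u2 \<in> A - B" "u2 \<noteq> u" using u2(1) v1 B1_def by auto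
          have "u \<in> B2 - B" using u v2 B1_def B2_def by auto
          then obtain v' where v': "v' \<in> B - B2" "insert v' (B2 - {u}) \<in> \<B>"
            using exch[of B2 B u] B u2(2) B2_def by blast
          have "v' = v1 \<or> v' = v2" using v' B1_def B2_def by auto
          then have "\<exists>v''\<in>{v1, v2}. insert v' (B2 - {u}) = insert u2 (B - {v''})"
            using v1 v2 u2' u B1_def B2_def by auto
          then show ?thesis using that u2' v1 v2 v'(2) by (metis insertE singletonD)
        qed
      qed
      let ?V = "{v \<in> B - A. insert u0 (B - {v}) \<in> \<B>}"
      have "finite ?V" "?V \<noteq> {}" using fB v1 by auto
      then obtain v0 where v0: "v0 \<in> ?V"
        and opt: "\<And>v. v \<in> ?V \<Longrightarrow> w (insert u0 (B - {v0})) - p v0 \<le> w (insert u0 (B - {v})) - p v"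
        using finite_minimizer[of ?V "\<lambda>v. w (insert u0 (B - {v})) - p v"] by blast
      define B' where "B' = insert u0 (B - {v0})"
      have B': "B' \<in> \<B>" "u \<in> A - B'" "B' - A = B - A - {v0}"
        using v0 u0 u B'_def by auto
      have "card (B' - A) < card (B - A)"
        unfolding B'(3) using v0 fB by (intro card_Diff1_less) auto
      from less.hyps[OF this B'(1,2)] obtain v where v: "v \<in> B' - A"
        "insert v (A - {u}) \<in> \<B>" "insert u (B' - {v}) \<in> \<B>"
        and le: "w (insert v (A - {u})) + w (insert u (B' - {v})) \<le> w A + w B'"
        by blast
      define B2 where "B2 = insert u (B' - {v})"
      have B2: "B2 \<in> \<B>" using v B2_def by simp
      have vB: "v \<in> B - A" "v \<noteq> v0" and v0B: "v0 \<in> B - A" using v(1) B'(3) v0 by auto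
      have diff: "B - B2 = {v, v0}" "u \<in> B2 - B"
        using vB v0B u u0 by (auto simp: B2_def B'_def)
      have "card (B - B2) = 2" using diff vB by simp
      from loc[OF B2 B this diff(2)] obtain z where z: "z \<in> {v, v0}"
        "insert z (B2 - {u}) \<in> \<B>" "insert u (B - {z}) \<in> \<B>"
        and le2: "w (insert z (B2 - {u})) + w (insert u (B - {z})) \<le> w B2 + w B"
        using diff by auto
      have pv: "p v = w A - w (insert v (A - {u}))" using v by (simp add: p_def)
      \<comment> \<open>The induction hypothesis reads \<open>w B2 \<le> w B' + p v\<close>, so this
        strict inequality is the contradiction. Local exchange between \<open>B2\<close> and
        \<open>B\<close> puts back either v, which gives B', or v0, which gives B - v + u0, a
        competitor of the optimal B'.\<close>
      have "w B' + p v < w B2"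
      proof (cases "z = v")
        case True
        have "insert z (B2 - {u}) = B'" using True v(1) B'(2) by (auto simp: B2_def)
        then have "w B' + w (insert u (B - {v})) \<le> w B2 + w B" using le2 True by simp
        moreover have "w B + p v < w (insert u (B - {v}))" using p1 vB z True by simp
        ultimately have "w B' + (w B + p v) < w B2 + w B"
          by (metis add_less_cancel_left order_less_le_trans)
        then show ?thesis by (simp add: algebra_simps)
      next
        case False
        then have zv: "z = v0" using z by simp
        have eq: "insert z (B2 - {u}) = insert u0 (B - {v})"
          using zv vB v0B u u0 by (auto simp: B2_def B'_def)
        have "w B' - p v0 \<le> w (insert u0 (B - {v})) - p v"
          using opt[of v] vB z(2) eq unfolding B'_def by simp
        moreover have "w B + p v0 < w (insert u (B - {v0}))" using p1 v0B z zv by simp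
        ultimately have "(w B' - p v0) + (w B + p v0) <
            (w (insert u0 (B - {v})) - p v) + w (insert u (B - {v0}))"
          by (rule add_le_less_mono)
        also have "\<dots> \<le> w B2 + w B - p v"
          using le2 eq zv by (simp add: algebra_simps)
        finally show ?thesis by (simp add: algebra_simps)
      qed
      then have "w A + w B' < w (insert v (A - {u})) + w B2"
        unfolding pv by (simp add: algebra_simps)
      then show False using le B2_def by simp
    qed
  qed
qed

text \<open>The lexicographic order on a product of ordered groups serves twice: to make room for a
  positive \<open>\<epsilon>\<close>, and to let one weight dominate another.\<close>

instance prod :: (linordered_ab_group_add, linordered_ab_group_add) linordered_ab_group_add
  by standard (auto simp: less_eq_prod_def less_prod_def)

text \<open>The value group may be trivial and contain no positive element. Placing the weights in
  the second component of a lexicographic product with \<open>int\<close> supplies \<epsilon> = (1,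
  0).\<close>

theorem matroid_local_exchange_imp_exchange:
  fixes w :: "'e set \<Rightarrow> 'g::linordered_ab_group_add"
  assumes "finite E" "matroid_bases E \<B>" "\<And>B. B \<in> \<B> \<Longrightarrow> card B = r"
    and loc: "\<And>A B x. \<lbrakk>A \<in> \<B>; B \<in> \<B>; card (B - A) = 2; x \<in> A - B\<rbrakk> \<Longrightarrow>
      \<exists>y\<in>B - A. insert y (A - {x}) \<in> \<B> \<and> insert x (B - {y}) \<in> \<B> \<and>
        w (insert y (A - {x})) + w (insert x (B - {y})) \<le> w A + w B"
    and "A \<in> \<B>" "B \<in> \<B>" "u \<in> A - B"
  shows "\<exists>y\<in>B - A. insert y (A - {u}) \<in> \<B> \<and> insert u (B - {y}) \<in> \<B> \<and>
    w (insert y (A - {u})) + w (insert u (B - {y})) \<le> w A + w B"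
proof -
  have "\<exists>y\<in>B - A. insert y (A - {u}) \<in> \<B> \<and> insert u (B - {y}) \<in> \<B> \<and>
    (0::int, w (insert y (A - {u}))) + (0, w (insert u (B - {y}))) \<le> (0, w A) + (0, w B)"
    by (rule local_exchange_imp_exchange[where \<epsilon> = "(1::int, 0::'g)"
          and w = "\<lambda>B. (0::int, w B)", OF assms(1-3)])
      (use loc assms in \<open>auto simp: less_eq_prod_def less_prod_def zero_prod_def\<close>)
  then show ?thesis by (simp add: less_eq_prod_def)
qed

section \<open>Valuated Pluecker vectors\<close>

declare not_None_eq [iff del]

definition circ ::
    "'f tract \<Rightarrow> 'e::linorder set \<Rightarrow> nat \<Rightarrow> ('e set \<Rightarrow> 'f option) \<Rightarrow> ('e \<Rightarrow> 'f option) set" where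
  "circ F E r P = {scale F c (circuit_vector F P \<tau>) | c \<tau>.
     c \<in> carrier F \<and> \<tau> \<subseteq> E \<and> card \<tau> = r + 1 \<and> supp (circuit_vector F P \<tau>) \<noteq> {}}"

lemma supp_scale [simp]: "supp (scale F c X) = supp X"
  by (simp add: supp_def scale_def)

lemma supp_circuit_vector: "supp (circuit_vector F P \<tau>) = {i \<in> \<tau>. P (\<tau> - {i}) \<noteq> None}"
  by (auto simp: supp_def circuit_vector_def)

text \<open>The three-term relation on the sets that arise from \<open>\<tau>\<close> and \<open>y\<close> by omitting two of
  \<open>i\<close>, \<open>j\<close>, \<open>x\<close>, \<open>y\<close> is only kept in the case where the product belonging to \<open>x\<close> does not
  contribute to the leading term.\<close>

locale valuated = tract F for F :: "'f tract" (structure) +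
  fixes E :: "'e::linorder set" and r :: nat and P :: "'e set \<Rightarrow> 'f option"
    and w :: "'e set \<Rightarrow> 'g::linordered_ab_group_add"
  assumes finite_E: "finite E"
    and pv: "pv_function F E r P"
    and exchange: "\<lbrakk>P A \<noteq> None; P B \<noteq> None; x \<in> A - B\<rbrakk> \<Longrightarrow>
      \<exists>y\<in>B - A. P (insert y (A - {x})) \<noteq> None \<and> P (insert x (B - {y})) \<noteq> None \<and>
        w (insert y (A - {x})) + w (insert x (B - {y})) \<le> w A + w B"
    and three_term: "\<lbrakk>\<tau> \<subseteq> E; card \<tau> = r + 1; i \<in> \<tau>; j \<in> \<tau>; x \<in> \<tau>; i \<noteq> j; i \<noteq> x; j \<noteq> x;
        y \<in> E; y \<notin> \<tau>; P (\<tau> - {i}) \<noteq> None; P (insert y (\<tau> - {x, j})) \<noteq> None;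
        \<lbrakk>P (\<tau> - {x}) \<noteq> None; P (insert y (\<tau> - {i, j})) \<noteq> None\<rbrakk> \<Longrightarrow>
          w (\<tau> - {i}) + w (insert y (\<tau> - {x, j})) < w (\<tau> - {x}) + w (insert y (\<tau> - {i, j}))\<rbrakk> \<Longrightarrow>
      P (\<tau> - {j}) \<noteq> None \<and> P (insert y (\<tau> - {x, i})) \<noteq> None \<and>
      w (\<tau> - {j}) + w (insert y (\<tau> - {x, i})) = w (\<tau> - {i}) + w (insert y (\<tau> - {x, j})) \<and>
      mul F (circuit_vector F P \<tau> i) (circuit_vector F P (insert y (\<tau> - {x})) j) =
      mul F (circuit_vector F P \<tau> j) (circuit_vector F P (insert y (\<tau> - {x})) i)"
begin

abbreviation cv :: "'e set \<Rightarrow> 'e \<Rightarrow> 'f option" where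
  "cv \<equiv> circuit_vector F P"

definition min_basis :: "'e set \<Rightarrow> bool" where
  "min_basis B \<longleftrightarrow> P B \<noteq> None \<and> (\<forall>A. P A \<noteq> None \<longrightarrow> w B \<le> w A)"

text \<open>Since (C_\<tau>)_i is \<open>P (\<tau> - {i})\<close> up to sign, the weight of \<tau> -
  i stands for |C_i| + u_i: subtracting the sum of u over \<tau> - i from the valuation gives |C_i|
  + u_i up to a term that depends on \<tau> only.\<close>

definition initial_coords :: "'e set \<Rightarrow> 'e set" where
  "initial_coords \<tau> = {i \<in> \<tau>. P (\<tau> - {i}) \<noteq> None \<and>
     (\<forall>k\<in>\<tau>. P (\<tau> - {k}) \<noteq> None \<longrightarrow> w (\<tau> - {i}) \<le> w (\<tau> - {k}))}"

definition initial_cv :: "'e set \<Rightarrow> 'e \<Rightarrow> 'f option" where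
  "initial_cv \<tau> = (\<lambda>i. if i \<in> initial_coords \<tau> then cv \<tau> i else None)"

definition initial_P :: "'e set \<Rightarrow> 'f option" where
  "initial_P B = (if min_basis B then P B else None)"

lemma basis_subset: "P B \<noteq> None \<Longrightarrow> B \<subseteq> E"
  and card_basis: "P B \<noteq> None \<Longrightarrow> card B = r"
  and elt_P [simp]: "elt F (P B)"
  using pv by (cases "P B"; auto simp: pv_function_def)+

lemma basis_exists: "\<exists>B. P B \<noteq> None"
  using pv by (simp add: pv_function_def)

lemma finite_basis: "P B \<noteq> None \<Longrightarrow> finite B"
  using basis_subset finite_E finite_subset by blast

lemma elt_cv [simp]: "elt F (cv \<tau> i)"
  by (simp add: circuit_vector_def)

lemma cv_eq_None: "cv \<tau> i = None \<longleftrightarrow> i \<notin> \<tau> \<or> P (\<tau> - {i}) = None"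
  by (simp add: circuit_vector_def)

lemma min_basisD: "min_basis B \<Longrightarrow> P B \<noteq> None"
  by (simp add: min_basis_def)

lemma min_basis_exists: "\<exists>B. min_basis B"
proof -
  have "finite {B. P B \<noteq> None}"
    by (rule finite_subset[of _ "Pow E"]) (use basis_subset finite_E in auto)
  moreover have "{B. P B \<noteq> None} \<noteq> {}" using basis_exists by auto
  ultimately show ?thesis
    using finite_minimizer[of "{B. P B \<noteq> None}" w] unfolding min_basis_def by auto
qed

text \<open>Suppose a lightest basis \<open>B\<close> contained all initial coordinates,
  \<open>i\<close> among them. Exchanging \<open>i\<close> between \<open>B\<close> and \<tau> - i
  replaces it by some y outside \<open>B\<close>. As \<open>B\<close> does not get lighter, \<tau> -
  y is no heavier than \<tau> - i, so y is an initial coordinate outside \<open>B\<close>.\<close>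

lemma initial_coords_dependent:
  assumes B: "min_basis B" and ne: "initial_coords \<tau> \<noteq> {}"
  shows "\<not> initial_coords \<tau> \<subseteq> B"
proof
  assume sub: "initial_coords \<tau> \<subseteq> B"
  obtain i where i: "i \<in> initial_coords \<tau>" using ne by blast
  let ?A = "\<tau> - {i}"
  have A: "P ?A \<noteq> None" and min: "\<And>k. k \<in> \<tau> \<Longrightarrow> P (\<tau> - {k}) \<noteq> None \<Longrightarrow> w ?A \<le> w (\<tau> - {k})"
    using i by (auto simp: initial_coords_def)
  have "i \<in> B - ?A" using sub i by auto
  from exchange[OF min_basisD[OF B] A this] obtain y where y: "y \<in> ?A - B"
    "P (insert y (B - {i})) \<noteq> None" "P (insert i (?A - {y})) \<noteq> None"
    and le: "w (insert y (B - {i})) + w (insert i (?A - {y})) \<le> w B + w ?A" by blast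
  have eq: "insert i (?A - {y}) = \<tau> - {y}" using y i by (auto simp: initial_coords_def)
  have "w B \<le> w (insert y (B - {i}))" using B y(2) by (simp add: min_basis_def)
  then have "w (\<tau> - {y}) \<le> w ?A"
    using le unfolding eq by (meson add_le_cancel_left add_right_mono order_trans)
  then have "y \<in> initial_coords \<tau>"
    using y(1,3) min unfolding eq initial_coords_def by (auto intro: order_trans)
  then show False using y(1) sub by blast
qed

text \<open>Entries of C_\<tau> outside \<open>T\<close> are strictly heavier than those at
  \<open>i\<close> and \<open>j\<close>, and this has to be maintained along the walk. The measure
  is lexicographic: a step either makes \<tau> - i strictly lighter, which lowers the number of
  lighter bases whatever happens to the distance from \<open>B\<close>, or keeps the weight and
  brings \<tau> - i one element closer to \<open>B\<close>.\<close>

lemma proportional_to_fundamental_circuit: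
  assumes B: "min_basis B" and iE: "i \<in> E" and iB: "i \<notin> B"
    and T: "i \<in> T" "j \<in> T" "i \<noteq> j" "T - {i} \<subseteq> B"
    and "\<tau> \<subseteq> E" "card \<tau> = r + 1" "T \<subseteq> \<tau>" "P (\<tau> - {i}) \<noteq> None" "P (\<tau> - {j}) \<noteq> None"
      "w (\<tau> - {j}) = w (\<tau> - {i})"
      "\<And>x. x \<in> \<tau> - T \<Longrightarrow> P (\<tau> - {x}) \<noteq> None \<Longrightarrow> w (\<tau> - {i}) < w (\<tau> - {x})"
  shows "mul F (cv \<tau> i) (cv (insert i B) j) = mul F (cv \<tau> j) (cv (insert i B) i)"
  using assms(8-)
proof (induction "(card {S \<in> Pow E. P S \<noteq> None \<and> w S < w (\<tau> - {i})}, card (B - (\<tau> - {i})))"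
    arbitrary: \<tau> rule: less_induct)
  case less
  note \<tau> = less.prems(1-3) and bi = less.prems(4) and bj = less.prems(5)
    and wj = less.prems(6) and wx = less.prems(7)
  have PB: "P B \<noteq> None" and minB: "\<And>A. P A \<noteq> None \<Longrightarrow> w B \<le> w A"
    using B by (auto simp: min_basis_def)
  have ij: "i \<in> \<tau>" "j \<in> \<tau>" "j \<in> B" using T \<tau> by auto
  let ?A = "\<tau> - {i}"
  show ?case
  proof (cases "?A \<subseteq> B")
    case True
    then have "?A = B"
      using card_subset_eq[OF finite_basis[OF PB] True] card_basis[OF PB] card_basis[OF bi] by simp
    then have "\<tau> = insert i B" using ij by auto
    then show ?thesis by (simp add: mul_comm)
  next
    case False
    then obtain x0 where x0: "x0 \<in> ?A - B" by blast
    from exchange[OF bi PB this] obtain y where y: "y \<in> B - ?A"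
      and y1: "P (insert y (?A - {x0})) \<noteq> None" "P (insert x0 (B - {y})) \<noteq> None"
      and le: "w (insert y (?A - {x0})) + w (insert x0 (B - {y})) \<le> w ?A + w B" by blast
    have yn: "y \<notin> \<tau>" "y \<in> E" "y \<noteq> i" "y \<in> B" using y iB basis_subset[OF PB] by auto
    have x0T: "x0 \<in> \<tau> - T" using x0 T by auto
    have eq0: "insert y (?A - {x0}) = insert y (\<tau> - {x0, i})" by auto
    have le0: "w (insert y (\<tau> - {x0, i})) \<le> w ?A"
      using le minB[OF y1(2)] unfolding eq0
      by (meson add_le_cancel_right add_left_mono order_trans)
    \<comment> \<open>Candidates for the next step: remove some x outside \<open>T\<close>, and look
      at the bases that result from also omitting \<open>i\<close> or \<open>j\<close>. Exchange
      with \<open>B\<close> has shown that (x0, i) is a candidate no heavier than \<tau> -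
      i.\<close>
    define C where "C = {(x, l). x \<in> \<tau> - T \<and> l \<in> {i, j} \<and> P (insert y (\<tau> - {x, l})) \<noteq> None}"
    define h where "h = (\<lambda>(x, l). w (insert y (\<tau> - {x, l})))"
    have c0: "(x0, i) \<in> C" using x0T y1 eq0 by (simp add: C_def)
    have "finite (\<tau> \<times> {i, j})" using finite_subset[OF \<tau>(1) finite_E] by simp
    then have "finite C" by (rule finite_subset[rotated]) (auto simp: C_def)
    then obtain xl where xl: "xl \<in> C" "\<And>z. z \<in> C \<Longrightarrow> h xl \<le> h z"
      using finite_minimizer[of C h] c0 by blast
    \<comment> \<open>A lightest candidate is taken. If it does not beat \<tau> - i, then (x0, i) is
      lightest as well and is preferred, because x0 \<notin> B makes the distance to
      \<open>B\<close> drop.\<close>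
    obtain x l where c: "(x, l) \<in> C" and opt: "\<And>z. z \<in> C \<Longrightarrow> h (x, l) \<le> h z"
      and dec: "h (x, l) < w ?A \<or> h (x, l) = w ?A \<and> x = x0"
    proof (cases "h xl < w ?A")
      case True
      then show ?thesis using that[of "fst xl" "snd xl"] xl by simp
    next
      case False
      have "h (x0, i) \<le> w ?A" using le0 by (simp add: h_def)
      then have "h (x0, i) = w ?A" using xl(2)[OF c0] False by simp
      then show ?thesis
        using that[of x0 i] c0 xl(2) xl(1) False by (metis leI order_trans xl(2))
    qed
    have x: "x \<in> \<tau>" "x \<notin> T" "x \<noteq> i" "x \<noteq> j" and l: "l = i \<or> l = j"
      and bl: "P (insert y (\<tau> - {x, l})) \<noteq> None" using c T by (auto simp: C_def)
    have hl: "h (x, l) = w (insert y (\<tau> - {x, l}))" by (simp add: h_def)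
    have hA: "h (x, l) \<le> w ?A" using dec by auto
    \<comment> \<open>The product that belongs to x is too heavy: its first factor because x
      \<notin> T, its second because exchanging \<open>j\<close> into it from \<open>B\<close> turns
      it into a candidate without making it heavier.\<close>
    have third: "w ?A + h (x, l) < w (\<tau> - {x}) + w (insert y (\<tau> - {i, j}))"
      if "P (\<tau> - {x}) \<noteq> None" "P (insert y (\<tau> - {i, j})) \<noteq> None"
    proof (rule add_less_le_mono)
      show "w ?A < w (\<tau> - {x})" using wx x that by blast
      let ?D = "insert y (\<tau> - {i, j})"
      have "j \<in> B - ?D" using ij yn by auto
      from exchange[OF PB that(2) this] obtain z where z: "z \<in> ?D - B"
        and z1: "P (insert z (B - {j})) \<noteq> None" "P (insert j (?D - {z})) \<noteq> None"
        and lez: "w (insert z (B - {j})) + w (insert j (?D - {z})) \<le> w B + w ?D" by blast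
      have zz: "z \<in> \<tau> - T" using z yn T by auto
      then have eqz: "insert j (?D - {z}) = insert y (\<tau> - {z, i})"
        using yn ij T z by auto
      have "w (insert y (\<tau> - {z, i})) \<le> w ?D"
        using lez minB[OF z1(1)] unfolding eqz
        by (meson add_le_cancel_left add_right_mono order_trans)
      moreover have "(z, i) \<in> C" using zz z1(2) unfolding eqz by (simp add: C_def)
      then have "h (x, l) \<le> w (insert y (\<tau> - {z, i}))" using opt h_def by fastforce
      ultimately show "h (x, l) \<le> w ?D" by simp
    qed
    let ?\<tau>' = "insert y (\<tau> - {x})"
    \<comment> \<open>The relation is started from whichever of the two bases is known; for l = i
      the roles of \<open>i\<close> and \<open>j\<close> are interchanged.\<close>
    have swap: "P (insert y (\<tau> - {x, i})) \<noteq> None \<and> P (insert y (\<tau> - {x, j})) \<noteq> None \<and>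
      w (insert y (\<tau> - {x, i})) = h (x, l) \<and> w (insert y (\<tau> - {x, j})) = h (x, l) \<and>
      mul F (cv \<tau> i) (cv ?\<tau>' j) = mul F (cv \<tau> j) (cv ?\<tau>' i)"
    proof (cases "l = j")
      case True
      then show ?thesis
        using three_term[OF \<tau>(1,2) ij(1,2) x(1) T(3) x(3,4)[symmetric] yn(2,1) bi] bl third wj hl
        by auto
    next
      case False
      then have "l = i" using l by simp
      then show ?thesis
        using three_term[OF \<tau>(1,2) ij(2,1) x(1) T(3)[symmetric] x(4,3)[symmetric] yn(2,1) bj]
          bl third wj hl by (auto simp: insert_commute)
    qed
    have sets: "?\<tau>' - {k} = insert y (\<tau> - {x, k})" if "k \<in> \<tau>" for k using that yn by auto
    have IH: "mul F (cv ?\<tau>' i) (cv (insert i B) j) = mul F (cv ?\<tau>' j) (cv (insert i B) i)"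
    proof (rule less.hyps)
      have fin: "finite {S \<in> Pow E. P S \<noteq> None \<and> w S < w ?A}" using finite_E by simp
      show "(card {S \<in> Pow E. P S \<noteq> None \<and> w S < w (?\<tau>' - {i})}, card (B - (?\<tau>' - {i})))
        < (card {S \<in> Pow E. P S \<noteq> None \<and> w S < w ?A}, card (B - ?A))"
        using dec
      proof
        assume lt: "h (x, l) < w ?A"
        have "card {S \<in> Pow E. P S \<noteq> None \<and> w S < w (?\<tau>' - {i})} <
          card {S \<in> Pow E. P S \<noteq> None \<and> w S < w ?A}"
        proof (rule psubset_card_mono[OF fin], rule psubsetI)
          show "{S \<in> Pow E. P S \<noteq> None \<and> w S < w (?\<tau>' - {i})} \<subseteq>
            {S \<in> Pow E. P S \<noteq> None \<and> w S < w ?A}"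
            using lt swap sets[OF ij(1)] by auto
          have "?\<tau>' - {i} \<in> {S \<in> Pow E. P S \<noteq> None \<and> w S < w ?A}"
            using lt swap sets[OF ij(1)] basis_subset by auto
          then show "{S \<in> Pow E. P S \<noteq> None \<and> w S < w (?\<tau>' - {i})} \<noteq>
            {S \<in> Pow E. P S \<noteq> None \<and> w S < w ?A}" by blast
        qed
        then show ?thesis by simp
      next
        assume "h (x, l) = w ?A \<and> x = x0"
        then have eq: "w (?\<tau>' - {i}) = w ?A" "x = x0" using swap sets[OF ij(1)] by auto
        have "B - (?\<tau>' - {i}) = (B - ?A) - {y}" using eq(2) x0 yn by auto
        moreover have "card ((B - ?A) - {y}) < card (B - ?A)"
          using y finite_basis[OF PB] by (intro card_Diff1_less) auto
        ultimately show ?thesis unfolding eq(1) by simp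
      qed
    next
      \<comment> \<open>Entries of the new vector outside \<open>T\<close> stay strictly heavier.
        For k = y the entry belongs to \<tau> - x. For any other k, a light entry would make the
        relation for \<open>i\<close>, k, x, y a two-term one, and \<tau> - k would be no heavier
        than \<tau> - i, against k \<notin> T.\<close>
      fix k assume k: "k \<in> ?\<tau>' - T" and bk: "P (?\<tau>' - {k}) \<noteq> None"
      have goal: "w (?\<tau>' - {i}) = h (x, l)" using swap sets[OF ij(1)] by simp
      show "w (?\<tau>' - {i}) < w (?\<tau>' - {k})"
      proof (cases "k = y")
        case True
        then have eq: "?\<tau>' - {k} = \<tau> - {x}" using yn by auto
        then have "w ?A < w (\<tau> - {x})" using wx x bk by simp
        then show ?thesis using goal hA eq by simp
      next
        case False
        then have k': "k \<in> \<tau>" "k \<notin> T" "k \<noteq> x" using k by auto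
        have ki: "k \<noteq> i" using k' T by auto
        show ?thesis
        proof (rule ccontr)
          assume "\<not> ?thesis"
          then have le: "w (insert y (\<tau> - {x, k})) \<le> h (x, l)" using goal sets[OF k'(1)] by simp
          have bk': "P (insert y (\<tau> - {x, k})) \<noteq> None" using bk sets[OF k'(1)] by simp
          have "w ?A + w (insert y (\<tau> - {x, k})) < w (\<tau> - {x}) + w (insert y (\<tau> - {i, k}))"
            if b: "P (\<tau> - {x}) \<noteq> None" "P (insert y (\<tau> - {i, k})) \<noteq> None"
          proof (rule add_less_le_mono)
            show "w ?A < w (\<tau> - {x})" using wx x b by blast
            have "(k, i) \<in> C" using b k' by (simp add: C_def insert_commute)
            then have "h (x, l) \<le> w (insert y (\<tau> - {i, k}))"
              using opt by (fastforce simp: h_def insert_commute)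
            then show "w (insert y (\<tau> - {x, k})) \<le> w (insert y (\<tau> - {i, k}))" using le by simp
          qed
          from three_term[OF \<tau>(1,2) ij(1) k'(1) x(1) ki[symmetric] x(3)[symmetric] k'(3) yn(2,1) bi bk' this]
          have "P (\<tau> - {k}) \<noteq> None"
            and eq: "w (\<tau> - {k}) + h (x, l) = w ?A + w (insert y (\<tau> - {x, k}))"
            using swap by auto
          then have "w ?A < w (\<tau> - {k})" using wx k' by blast
          then have "w ?A + w (insert y (\<tau> - {x, k})) < w (\<tau> - {k}) + h (x, l)"
            using le by (rule add_less_le_mono)
          then show False using eq by simp
        qed
      qed
    next
      show "card ?\<tau>' = r + 1"
        using \<tau> x yn finite_E finite_subset[OF \<tau>(1)] by (simp add: card_Diff_singleton)
    qed (use \<tau> x yn swap sets ij T in auto)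
    \<comment> \<open>The entry of the intermediate vector at \<open>j\<close> links the two
      proportions and, being nonzero, can be cancelled.\<close>
    have ne: "cv ?\<tau>' j \<noteq> None"
      using swap ij x sets[OF ij(2)] by (simp add: cv_eq_None)
    have "mul F (cv ?\<tau>' j) (mul F (cv \<tau> i) (cv (insert i B) j)) =
      mul F (mul F (cv \<tau> i) (cv ?\<tau>' j)) (cv (insert i B) j)" by (simp add: mul_ac)
    also have "\<dots> = mul F (cv \<tau> j) (mul F (cv ?\<tau>' i) (cv (insert i B) j))"
      using swap by (simp add: mul_assoc)
    also have "\<dots> = mul F (cv ?\<tau>' j) (mul F (cv \<tau> j) (cv (insert i B) i))"
      unfolding IH by (simp add: mul_ac)
    finally show ?thesis using mul_cancel[OF ne] by simp
  qed
qed

end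

section \<open>Circuits of the initial matroid\<close>

lemma add_mono_eqD:
  fixes a b c d :: "'g::linordered_ab_group_add"
  assumes "a \<le> c" "b \<le> d" "c + d \<le> a + b"
  shows "c = a" "d = b"
  using assms add_less_le_mono[of a c b d] add_le_less_mono[of a c b d]
  by (auto simp: order_le_less)

context tract
begin

lemma proportional_vectors:
  assumes elt: "\<And>i. elt F (X i)" "\<And>i. elt F (Y i)" and supp: "supp X = supp Y"
    and i: "i \<in> supp X"
    and eq: "\<And>j. j \<in> supp X \<Longrightarrow> j \<noteq> i \<Longrightarrow> mul F (X i) (Y j) = mul F (X j) (Y i)"
  shows "\<exists>c\<in>carrier F. X = scale F c Y"
proof -
  obtain a b where a: "X i = Some a" and b: "Y i = Some b"
    using i supp unfolding supp_def by fastforce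
  have ab: "a \<in> carrier F" "b \<in> carrier F" using elt(1)[of i] elt(2)[of i] a b by auto
  have "X j = scale F (a \<otimes> inv b) Y j" for j
  proof (cases "j \<in> supp X")
    case False
    then have "X j = None" "Y j = None" using supp by (auto simp: supp_def)
    then show ?thesis by (simp add: scale_def)
  next
    case True
    then obtain x y where x: "X j = Some x" and y: "Y j = Some y"
      using supp unfolding supp_def by fastforce
    have xy: "x \<in> carrier F" "y \<in> carrier F" using elt(1)[of j] elt(2)[of j] x y by auto
    have "a \<otimes> y = x \<otimes> b"
      using eq[OF True] a b x y xy ab by (cases "j = i") (auto simp: m_comm)
    then have "a \<otimes> y \<otimes> inv b = x" using ab xy by (simp add: m_assoc)
    then have "a \<otimes> inv b \<otimes> y = x" using ab xy by (simp add: m_ac)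
    then show ?thesis using x y by (simp add: scale_def)
  qed
  then show ?thesis using ab by blast
qed

lemma scale_scale:
  assumes "\<And>i. elt F (X i)" "c \<in> carrier F" "d \<in> carrier F"
  shows "scale F c (scale F d X) = scale F (c \<otimes> d) X"
  unfolding scale_def using assms by (auto simp: mul_assoc[symmetric])

end

context valuated
begin

lemma finite_bases: "finite {B. P B \<noteq> None \<and> Q B}"
  by (rule finite_subset[of _ "Pow E"]) (use basis_subset finite_E in auto)

lemma circuit_vector_initial_P:
  "circuit_vector F initial_P \<tau> i = (if min_basis (\<tau> - {i}) then cv \<tau> i else None)"
  by (simp add: circuit_vector_def initial_P_def)

text \<open>For weight 0 the condition in \<open>three_term\<close> says that the third product
  vanishes, which implies the condition for any weight. All bases are then lightest, and the results
  above speak about the underlying matroid.\<close>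

lemma valuated_zero: "valuated F E r P (\<lambda>_. 0::int)"
proof
  fix A B x assume "P A \<noteq> None" "P B \<noteq> None" "x \<in> A - B"
  then show "\<exists>y\<in>B - A. P (insert y (A - {x})) \<noteq> None \<and> P (insert x (B - {y})) \<noteq> None \<and>
    (0::int) + 0 \<le> 0 + 0" using exchange by (metis order_refl)
qed (use three_term finite_E pv in blast)+

text \<open>Two lightest bases have the least total weight of any pair of bases. So an exchange or a
  relation that does not raise this total stays among the lightest bases, and a product that
  vanishes for \<open>initial_P\<close> either vanishes for \<open>P\<close> or is strictly
  heavier.\<close>

lemma valuated_initial: "valuated F E r initial_P (\<lambda>_. 0::int)"
proof
  show "pv_function F E r initial_P"
    using pv min_basis_exists min_basisD unfolding pv_function_def initial_P_def by auto
next
  fix A B x assume "initial_P A \<noteq> None" "initial_P B \<noteq> None" and x: "x \<in> A - B"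
  then have A: "min_basis A" and B: "min_basis B" by (auto simp: initial_P_def split: if_splits)
  from exchange[OF min_basisD[OF A] min_basisD[OF B] x] obtain y where y: "y \<in> B - A"
    "P (insert y (A - {x})) \<noteq> None" "P (insert x (B - {y})) \<noteq> None"
    and le: "w (insert y (A - {x})) + w (insert x (B - {y})) \<le> w A + w B" by blast
  have ge: "w A \<le> w (insert y (A - {x}))" "w B \<le> w (insert x (B - {y}))"
    using A B y by (auto simp: min_basis_def)
  then have "w (insert y (A - {x})) = w A" "w (insert x (B - {y})) = w B"
    using add_mono_eqD[OF ge le] by simp_all
  then have "min_basis (insert y (A - {x}))" "min_basis (insert x (B - {y}))"
    using A B y by (auto simp: min_basis_def)
  then show "\<exists>y\<in>B - A. initial_P (insert y (A - {x})) \<noteq> None \<and>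
      initial_P (insert x (B - {y})) \<noteq> None \<and> (0::int) + 0 \<le> 0 + 0"
    using y by (auto simp: initial_P_def)
next
  fix \<tau> i j x y
  assume \<tau>: "\<tau> \<subseteq> E" "card \<tau> = r + 1" and i: "i \<in> \<tau>" "j \<in> \<tau>" "x \<in> \<tau>" "i \<noteq> j" "i \<noteq> x" "j \<noteq> x"
    and y: "y \<in> E" "y \<notin> \<tau>"
    and b: "initial_P (\<tau> - {i}) \<noteq> None" "initial_P (insert y (\<tau> - {x, j})) \<noteq> None"
    and third: "\<lbrakk>initial_P (\<tau> - {x}) \<noteq> None; initial_P (insert y (\<tau> - {i, j})) \<noteq> None\<rbrakk> \<Longrightarrow>
      (0::int) + 0 < 0 + 0"
  have m: "min_basis (\<tau> - {i})" "min_basis (insert y (\<tau> - {x, j}))"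
    using b by (auto simp: initial_P_def split: if_splits)
  have lt: "w (\<tau> - {i}) + w (insert y (\<tau> - {x, j})) < w (\<tau> - {x}) + w (insert y (\<tau> - {i, j}))"
    if p: "P (\<tau> - {x}) \<noteq> None" "P (insert y (\<tau> - {i, j})) \<noteq> None"
  proof -
    have ge: "w (\<tau> - {i}) \<le> w (\<tau> - {x})" "w (insert y (\<tau> - {x, j})) \<le> w (insert y (\<tau> - {i, j}))"
      using m p by (auto simp: min_basis_def)
    have "\<not> (min_basis (\<tau> - {x}) \<and> min_basis (insert y (\<tau> - {i, j})))"
      using third p by (auto simp: initial_P_def)
    then have "w (\<tau> - {i}) \<noteq> w (\<tau> - {x}) \<or> w (insert y (\<tau> - {x, j})) \<noteq> w (insert y (\<tau> - {i, j}))"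
      using m p by (auto simp: min_basis_def)
    then show ?thesis
      using add_mono_eqD[OF ge] leI by metis
  qed
  from three_term[OF \<tau> i y min_basisD[OF m(1)] min_basisD[OF m(2)] lt]
  have q: "P (\<tau> - {j}) \<noteq> None" "P (insert y (\<tau> - {x, i})) \<noteq> None"
    and sum: "w (\<tau> - {j}) + w (insert y (\<tau> - {x, i})) = w (\<tau> - {i}) + w (insert y (\<tau> - {x, j}))"
    and eq: "mul F (cv \<tau> i) (cv (insert y (\<tau> - {x})) j) = mul F (cv \<tau> j) (cv (insert y (\<tau> - {x})) i)"
    by blast+
  have "w (\<tau> - {i}) \<le> w (\<tau> - {j})" "w (insert y (\<tau> - {x, j})) \<le> w (insert y (\<tau> - {x, i}))"
    using m q by (auto simp: min_basis_def)
  then have "w (\<tau> - {j}) = w (\<tau> - {i})" "w (insert y (\<tau> - {x, i})) = w (insert y (\<tau> - {x, j}))"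
    using add_mono_eqD[of "w (\<tau> - {i})" "w (\<tau> - {j})"] sum by auto
  then have m': "min_basis (\<tau> - {j})" "min_basis (insert y (\<tau> - {x, i}))"
    using m q by (auto simp: min_basis_def)
  have "insert y (\<tau> - {x}) - {i} = insert y (\<tau> - {x, i})"
    "insert y (\<tau> - {x}) - {j} = insert y (\<tau> - {x, j})" using i y by auto
  then show "initial_P (\<tau> - {j}) \<noteq> None \<and> initial_P (insert y (\<tau> - {x, i})) \<noteq> None \<and>
      (0::int) + 0 = 0 + 0 \<and>
      mul F (circuit_vector F initial_P \<tau> i) (circuit_vector F initial_P (insert y (\<tau> - {x})) j) =
      mul F (circuit_vector F initial_P \<tau> j) (circuit_vector F initial_P (insert y (\<tau> - {x})) i)"
    using m m' q eq by (simp add: circuit_vector_initial_P) (simp add: initial_P_def)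
qed (use finite_E in blast)

section \<open>Independence and circuits of the underlying matroid\<close>

definition indep :: "'e set \<Rightarrow> bool" where
  "indep S \<longleftrightarrow> (\<exists>B. P B \<noteq> None \<and> S \<subseteq> B)"

definition circuit_support :: "'e set \<Rightarrow> bool" where
  "circuit_support T \<longleftrightarrow> T \<subseteq> E \<and> \<not> indep T \<and> (\<forall>k\<in>T. indep (T - {k}))"

lemma indep_mono: "S \<subseteq> T \<Longrightarrow> indep T \<Longrightarrow> indep S"
  unfolding indep_def by blast

lemma circuit_support_nonempty: "circuit_support T \<Longrightarrow> T \<noteq> {}"
  using basis_exists by (auto simp: circuit_support_def indep_def)

lemma circuit_support_antichain:
  assumes "circuit_support T" "S \<subseteq> T" "\<not> indep S"
  shows "S = T"
proof (rule ccontr)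
  assume "S \<noteq> T"
  then obtain k where "k \<in> T" "S \<subseteq> T - {k}" using assms(2) by blast
  then show False using assms indep_mono unfolding circuit_support_def by blast
qed

lemma dependent_contains_circuit_support:
  assumes "T \<subseteq> E" "\<not> indep T"
  obtains S where "S \<subseteq> T" "circuit_support S"
proof -
  have "finite T" using assms finite_E finite_subset by blast
  then have "\<exists>S\<subseteq>T. circuit_support S" using assms
  proof (induction T rule: finite_psubset_induct)
    case (psubset T)
    show ?case
    proof (cases "circuit_support T")
      case False
      then obtain k where "k \<in> T" "\<not> indep (T - {k})"
        using psubset.prems by (auto simp: circuit_support_def)
      then have "\<exists>S\<subseteq>T - {k}. circuit_support S"
        using psubset.IH[of "T - {k}"] psubset.prems by blast
      then show ?thesis by blast
    qed blast
  qed
  then show ?thesis using that by blast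
qed

text \<open>For weight 0 the initial coordinates are the whole support, so it is dependent by
  \<open>initial_coords_dependent\<close>; without k it lies in the basis \<tau> - k.\<close>

lemma circuit_support_supp:
  assumes "supp (cv \<tau>) \<noteq> {}" "\<tau> \<subseteq> E"
  shows "circuit_support (supp (cv \<tau>))"
proof -
  interpret Z: valuated F E r P "\<lambda>_. 0::int" by (rule valuated_zero)
  have "Z.initial_coords \<tau> = supp (cv \<tau>)"
    by (auto simp: Z.initial_coords_def supp_circuit_vector)
  then have "\<not> indep (supp (cv \<tau>))"
    using Z.initial_coords_dependent[of _ \<tau>] assms by (auto simp: indep_def Z.min_basis_def)
  moreover have "indep (supp (cv \<tau>) - {k})" if "k \<in> supp (cv \<tau>)" for k
    using that by (auto simp: indep_def supp_circuit_vector intro!: exI[of _ "\<tau> - {k}"])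
  ultimately show ?thesis using assms by (auto simp: circuit_support_def supp_circuit_vector)
qed

lemma fundamental_circuit:
  assumes T: "circuit_support T" "i \<in> T" and B: "P B \<noteq> None" "T - {i} \<subseteq> B"
  shows "i \<notin> B" "insert i B \<subseteq> E" "card (insert i B) = r + 1" "supp (cv (insert i B)) = T"
proof -
  show i: "i \<notin> B" using T B unfolding circuit_support_def indep_def by blast
  show "insert i B \<subseteq> E" using T basis_subset[OF B(1)] by (auto simp: circuit_support_def)
  show "card (insert i B) = r + 1" using i finite_basis[OF B(1)] card_basis[OF B(1)] by simp
  have dep: "\<not> T \<subseteq> C" if "P C \<noteq> None" for C
    using T(1) that unfolding circuit_support_def indep_def by blast
  have "k \<in> T" if "P (insert i B - {k}) \<noteq> None" for k
  proof (rule ccontr)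
    assume "k \<notin> T"
    then have "T \<subseteq> insert i B - {k}" using B(2) by auto
    then show False using dep[OF that] by simp
  qed
  \<comment> \<open>Among the bases that contain T - k take one with fewest elements outside B + i.
    Exchange with \<open>B\<close> would remove such an element, so it lies inside B + i. It misses
    k, and by cardinality it is B + i - k.\<close>
  moreover have "P (insert i B - {k}) \<noteq> None" if k: "k \<in> T" for k
  proof -
    have "indep (T - {k})" using T k by (simp add: circuit_support_def)
    then have "{C. P C \<noteq> None \<and> T - {k} \<subseteq> C} \<noteq> {}" unfolding indep_def by blast
    then obtain C where C0: "C \<in> {C. P C \<noteq> None \<and> T - {k} \<subseteq> C}"
      and min: "\<And>D. D \<in> {C. P C \<noteq> None \<and> T - {k} \<subseteq> C} \<Longrightarrow>
        card (C - insert i B) \<le> card (D - insert i B)"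
      by (rule finite_minimizer[OF finite_bases, where f = "\<lambda>C. card (C - insert i B)"])
        (rule that; blast)
    then have C: "P C \<noteq> None" "T - {k} \<subseteq> C" by auto
    have "C \<subseteq> insert i B"
    proof (rule ccontr)
      assume "\<not> ?thesis"
      then obtain x where x: "x \<in> C - insert i B" by blast
      from exchange[OF C(1) B(1)] x obtain y where y: "y \<in> B - C" "P (insert y (C - {x})) \<noteq> None"
        by blast
      have "T - {k} \<subseteq> insert y (C - {x})" using x C(2) B(2) by auto
      then have "card (C - insert i B) \<le> card (insert y (C - {x}) - insert i B)"
        using min y(2) by simp
      moreover have "insert y (C - {x}) - insert i B = (C - insert i B) - {x}" using y by auto
      moreover have "card ((C - insert i B) - {x}) < card (C - insert i B)"
        using x finite_basis[OF C(1)] by (intro card_Diff1_less) auto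
      ultimately show False by simp
    qed
    moreover have "k \<notin> C" using dep[OF C(1)] C(2) k by blast
    ultimately have sub: "C \<subseteq> insert i B - {k}" by blast
    have "k \<in> insert i B" using k B(2) by blast
    then have "card (insert i B - {k}) = card C"
      using i finite_basis[OF B(1)] card_basis[OF B(1)] card_basis[OF C(1)] by simp
    then have "C = insert i B - {k}"
      using card_subset_eq[OF _ sub] finite_basis[OF B(1)] by simp
    then show ?thesis using C(1) by simp
  qed
  ultimately show "supp (cv (insert i B)) = T"
    unfolding supp_circuit_vector using B(2) T(2) by blast
qed

text \<open>The case of weight 0 of \<open>proportional_to_fundamental_circuit\<close>: every basis
  \<sigma> - i is lightest, and with \<open>T\<close> the full support there are no nonzero entries
  outside \<open>T\<close> to compare.\<close>

lemma same_support_proportional: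
  assumes \<tau>: "\<tau> \<subseteq> E" "card \<tau> = r + 1" and \<sigma>: "\<sigma> \<subseteq> E" "card \<sigma> = r + 1"
    and supp: "supp (cv \<tau>) = supp (cv \<sigma>)" "supp (cv \<sigma>) \<noteq> {}"
  shows "\<exists>c\<in>carrier F. cv \<tau> = scale F c (cv \<sigma>)"
proof -
  interpret Z: valuated F E r P "\<lambda>_. 0::int" by (rule valuated_zero)
  obtain i where i: "i \<in> supp (cv \<tau>)" using supp by blast
  have i': "i \<in> \<sigma>" "i \<in> \<tau>" "P (\<sigma> - {i}) \<noteq> None" "P (\<tau> - {i}) \<noteq> None"
    using i supp by (auto simp: supp_circuit_vector)
  have "mul F (cv \<tau> i) (cv \<sigma> j) = mul F (cv \<tau> j) (cv \<sigma> i)" if j: "j \<in> supp (cv \<tau>)" "j \<noteq> i" for j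
  proof -
    have j': "j \<in> \<sigma>" "j \<in> \<tau>" "P (\<sigma> - {j}) \<noteq> None" "P (\<tau> - {j}) \<noteq> None"
      using j supp by (auto simp: supp_circuit_vector)
    have "mul F (cv \<tau> i) (cv (insert i (\<sigma> - {i})) j) = mul F (cv \<tau> j) (cv (insert i (\<sigma> - {i})) i)"
    proof (rule Z.proportional_to_fundamental_circuit[where T = "supp (cv \<tau>)"])
      show "Z.min_basis (\<sigma> - {i})" using i' by (simp add: Z.min_basis_def)
      show "supp (cv \<tau>) - {i} \<subseteq> \<sigma> - {i}" using supp by (auto simp: supp_circuit_vector)
      show "(0::int) < 0" if "x \<in> \<tau> - supp (cv \<tau>)" "P (\<tau> - {x}) \<noteq> None" for x
        using that by (auto simp: supp_circuit_vector)
    qed (use i i' j j' \<tau> \<sigma> in \<open>auto simp: supp_circuit_vector\<close>)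
    then show ?thesis using i' by (simp add: insert_absorb)
  qed
  then show ?thesis using proportional_vectors[OF _ _ supp(1) i] by simp
qed

text \<open>The nonzero vectors of \<open>initial_P\<close> are the \<open>initial_cv \<tau>\<close>
  for which some \<tau> - k is a lightest basis. All other nonzero initial forms have dependent
  supports too, so none is properly contained in a circuit; those of minimal support are shown to be
  multiples of fundamental circuits.\<close>

theorem circ_initial:
  "circ F E r initial_P = min_supp {scale F c (initial_cv \<tau>) | c \<tau>.
     c \<in> carrier F \<and> \<tau> \<subseteq> E \<and> card \<tau> = r + 1}" (is "_ = min_supp ?X")
proof -
  interpret I: valuated F E r initial_P "\<lambda>_. 0::int" by (rule valuated_initial)
  have supp_initial: "supp (initial_cv \<tau>) = initial_coords \<tau>" for \<tau>
    by (auto simp: supp_def initial_cv_def initial_coords_def cv_eq_None)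
  have I_cv: "I.cv \<tau> = initial_cv \<tau>" if "supp (I.cv \<tau>) \<noteq> {}" for \<tau>
  proof
    obtain k where k: "k \<in> \<tau>" "min_basis (\<tau> - {k})"
      using \<open>supp (I.cv \<tau>) \<noteq> {}\<close> by (auto simp: supp_circuit_vector initial_P_def split: if_splits)
    fix i
    have "min_basis (\<tau> - {i}) \<longleftrightarrow> i \<in> initial_coords \<tau>" if "i \<in> \<tau>"
    proof
      assume "min_basis (\<tau> - {i})"
      then show "i \<in> initial_coords \<tau>" using that by (simp add: min_basis_def initial_coords_def)
    next
      assume "i \<in> initial_coords \<tau>"
      then have "P (\<tau> - {i}) \<noteq> None" "w (\<tau> - {i}) \<le> w (\<tau> - {k})"
        using k by (auto simp: initial_coords_def min_basis_def)
      then show "min_basis (\<tau> - {i})" using k by (auto simp: min_basis_def intro: order_trans)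
    qed
    then show "I.cv \<tau> i = initial_cv \<tau> i"
      by (cases "i \<in> \<tau>") (auto simp: circuit_vector_initial_P initial_cv_def cv_eq_None initial_coords_def)
  qed
  have dep: "\<not> I.indep (initial_coords \<tau>)" if "initial_coords \<tau> \<noteq> {}" for \<tau>
    using initial_coords_dependent[OF _ that] by (auto simp: I.indep_def initial_P_def split: if_splits)
  have coords: "initial_coords \<tau> \<subseteq> \<tau>" for \<tau> by (auto simp: initial_coords_def)
  have elt: "elt F (initial_cv \<tau> i)" for \<tau> i by (simp add: initial_cv_def)
  show ?thesis
  proof (intro equalityI subsetI)
    fix X assume "X \<in> circ F E r initial_P"
    then obtain c \<tau> where X: "X = scale F c (I.cv \<tau>)" "c \<in> carrier F" "\<tau> \<subseteq> E" "card \<tau> = r + 1"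
      and ne: "supp (I.cv \<tau>) \<noteq> {}" by (auto simp: circ_def)
    have "X \<in> ?X" using X I_cv[OF ne] by auto
    moreover have "\<not> supp Y \<subset> supp X" if Y: "Y \<in> ?X" "supp Y \<noteq> {}" for Y
    proof
      assume sub: "supp Y \<subset> supp X"
      obtain d \<sigma> where "Y = scale F d (initial_cv \<sigma>)" using Y(1) by blast
      then have "supp Y = initial_coords \<sigma>" by (simp add: supp_initial)
      then have "\<not> I.indep (supp Y)" using dep Y by simp
      then show False
        using I.circuit_support_antichain[OF I.circuit_support_supp[OF ne X(3)]] sub X by auto
    qed
    ultimately show "X \<in> min_supp ?X" using ne X by (auto simp: min_supp_def)
  next
    fix X assume X: "X \<in> min_supp ?X"
    then obtain c \<tau> where c: "X = scale F c (initial_cv \<tau>)" "c \<in> carrier F"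
      and \<tau>: "\<tau> \<subseteq> E" "card \<tau> = r + 1" by (auto simp: min_supp_def)
    have suppX: "supp X = initial_coords \<tau>" using c supp_initial by simp
    have ne: "initial_coords \<tau> \<noteq> {}" using X suppX by (auto simp: min_supp_def)
    \<comment> \<open>A circuit \<open>T\<close> of the initial matroid inside the support is
      realised by the fundamental circuit of a lightest basis \<open>B\<close>, which is itself
      among the initial forms. Minimality of \<open>X\<close> therefore makes \<open>T\<close> the
      whole support.\<close>
    obtain T where T: "T \<subseteq> initial_coords \<tau>" "I.circuit_support T"
      using I.dependent_contains_circuit_support[OF _ dep[OF ne]] coords \<tau> by blast
    obtain i where i: "i \<in> T" using I.circuit_support_nonempty[OF T(2)] by blast
    have "I.indep (T - {i})" using T(2) i by (simp add: I.circuit_support_def)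
    then obtain B where B: "initial_P B \<noteq> None" "T - {i} \<subseteq> B" by (auto simp: I.indep_def)
    note fund = I.fundamental_circuit[OF T(2) i B]
    have ne': "supp (I.cv (insert i B)) \<noteq> {}" using fund i by auto
    have "initial_cv (insert i B) \<in> ?X"
      using fund elt by (intro CollectI exI[of _ \<one>] exI[of _ "insert i B"]) (simp add: scale_def)
    moreover have supp_fund: "supp (initial_cv (insert i B)) = T" using fund I_cv[OF ne'] by simp
    ultimately have "\<not> T \<subset> supp X"
      using X fund i unfolding min_supp_def by blast
    then have TX: "T = initial_coords \<tau>" using T suppX by blast
    have minB: "min_basis B" using B by (auto simp: initial_P_def split: if_splits)
    have iT: "i \<in> \<tau>" "P (\<tau> - {i}) \<noteq> None" "\<And>k. k \<in> \<tau> \<Longrightarrow> P (\<tau> - {k}) \<noteq> None \<Longrightarrow> w (\<tau> - {i}) \<le> w (\<tau> - {k})"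
      using i TX by (auto simp: initial_coords_def)
    have "mul F (initial_cv \<tau> i) (initial_cv (insert i B) j) =
        mul F (initial_cv \<tau> j) (initial_cv (insert i B) i)" if j: "j \<in> T" "j \<noteq> i" for j
    proof -
      have jT: "j \<in> \<tau>" "P (\<tau> - {j}) \<noteq> None" "\<And>k. k \<in> \<tau> \<Longrightarrow> P (\<tau> - {k}) \<noteq> None \<Longrightarrow> w (\<tau> - {j}) \<le> w (\<tau> - {k})"
        using j TX by (auto simp: initial_coords_def)
      have "mul F (cv \<tau> i) (cv (insert i B) j) = mul F (cv \<tau> j) (cv (insert i B) i)"
      proof (rule proportional_to_fundamental_circuit[OF minB _ fund(1) i j(1) j(2)[symmetric] B(2) \<tau>])
        show "w (\<tau> - {j}) = w (\<tau> - {i})" using iT jT by (intro order_antisym) auto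
        show "w (\<tau> - {i}) < w (\<tau> - {x})" if x: "x \<in> \<tau> - T" "P (\<tau> - {x}) \<noteq> None" for x
        proof (rule ccontr)
          assume "\<not> ?thesis"
          then have "x \<in> initial_coords \<tau>" using x iT(3) unfolding initial_coords_def by fastforce
          then show False using x TX by blast
        qed
      qed (use fund iT jT TX coords in auto)
      then show ?thesis
        using i j TX supp_fund supp_initial[of "insert i B"] by (simp add: initial_cv_def)
    qed
    then obtain d where d: "d \<in> carrier F" "initial_cv \<tau> = scale F d (initial_cv (insert i B))"
      using proportional_vectors[of "initial_cv \<tau>" "initial_cv (insert i B)" i] elt i TX supp_fund
        supp_initial by auto
    have "X = scale F (c \<otimes> d) (I.cv (insert i B))"
      unfolding I_cv[OF ne'] using c d elt by (simp add: scale_scale)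
    then show "X \<in> circ F E r initial_P"
      unfolding circ_def using fund ne' c(2) d(1)
      by (intro CollectI exI[of _ "c \<otimes> d"] exI[of _ "insert i B"]) simp
  qed
qed

end

text \<open>For disjoint \<open>I\<close> and \<open>S\<close>, the number of inversions of the list
  \<open>I\<close> followed by \<open>S\<close>, each increasing; its parity is the sign of merging
  the two.\<close>

definition minor_sign :: "'e::linorder set \<Rightarrow> 'e set \<Rightarrow> nat" where
  "minor_sign S I = (\<Sum>a\<in>I. card {s \<in> S. s < a})"

text \<open>The Pluecker vector of a minor on the complement of \<open>Z\<close>, where
  \<open>S\<close> is the part of some basis in \<open>Z\<close>: a contraction of \<open>Z\<close>
  if \<open>S\<close> is largest possible, a deletion of \<open>Z\<close> if it is smallest
  possible.\<close>

definition restr ::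
    "'f tract \<Rightarrow> 'e::linorder set \<Rightarrow> 'e set \<Rightarrow> ('e set \<Rightarrow> 'f option) \<Rightarrow> 'e set \<Rightarrow> 'f option" where
  "restr F Z S P = (\<lambda>I. if I \<inter> Z = {} then mul F (neg_one_pow F (minor_sign S I)) (P (I \<union> S)) else None)"

lemma minor_sign_remove:
  "finite I \<Longrightarrow> i \<in> I \<Longrightarrow> minor_sign S I = minor_sign S (I - {i}) + card {s \<in> S. s < i}"
  by (simp add: minor_sign_def sum.remove)

lemma card_less_Un:
  fixes i :: "'e::linorder"
  assumes "finite A" "finite B" "A \<inter> B = {}"
  shows "card {x \<in> A \<union> B. x < i} = card {x \<in> A. x < i} + card {x \<in> B. x < i}"
proof -
  have "{x \<in> A \<union> B. x < i} = {x \<in> A. x < i} \<union> {x \<in> B. x < i}" by auto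
  moreover have "{x \<in> A. x < i} \<inter> {x \<in> B. x < i} = {}" using assms by auto
  ultimately show ?thesis using assms by (simp add: card_Un_disjoint)
qed

section \<open>Circuits of a single Pluecker vector\<close>

context tract
begin

lemma elt_scale [simp]: "c \<in> carrier F \<Longrightarrow> elt F (X i) \<Longrightarrow> elt F (scale F c X i)"
  by (simp add: scale_def)

lemma scale_one [simp]: "(\<And>i. elt F (X i)) \<Longrightarrow> scale F \<one> X = X"
  by (simp add: scale_def)

lemma elt_circuit_vector [simp]: "(\<And>I. elt F (P I)) \<Longrightarrow> elt F (circuit_vector F P \<tau> i)"
  by (simp add: circuit_vector_def)

lemma circuit_vector_scale:
  assumes "\<And>I. elt F (P I)" "c \<in> carrier F"
  shows "circuit_vector F (scale F c P) \<tau> = scale F c (circuit_vector F P \<tau>)"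
  using assms by (simp add: fun_eq_iff circuit_vector_def scale_def mul_left_comm)

lemma circI:
  assumes "c \<in> carrier F" "\<tau> \<subseteq> E" "card \<tau> = r + 1"
    "supp (circuit_vector F P \<tau>) \<noteq> {}" "X = scale F c (circuit_vector F P \<tau>)"
  shows "X \<in> circ F E r P"
  using assms unfolding circ_def by blast

lemma circE:
  assumes "X \<in> circ F E r P"
  obtains c \<tau> where "c \<in> carrier F" "\<tau> \<subseteq> E" "card \<tau> = r + 1"
    "supp (circuit_vector F P \<tau>) \<noteq> {}" "X = scale F c (circuit_vector F P \<tau>)"
  using assms unfolding circ_def by blast

lemma circ_scaled_closed:
  assumes "\<And>I. elt F (P I)" "X \<in> circ F E r P" "c \<in> carrier F"
  shows "scale F c X \<in> circ F E r P"
  using assms(2)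
proof (rule circE)
  fix d \<tau> assume "d \<in> carrier F" "\<tau> \<subseteq> E" "card \<tau> = r + 1"
    "supp (circuit_vector F P \<tau>) \<noteq> {}" "X = scale F d (circuit_vector F P \<tau>)"
  then show ?thesis
    using assms(1,3) by (intro circI[where c = "c \<otimes> d" and \<tau> = \<tau>]) (auto simp: scale_scale)
qed

lemma circ_subset:
  assumes "\<And>I. elt F (Q I)"
    and "\<And>\<tau>. \<tau> \<subseteq> E \<Longrightarrow> card \<tau> = r + 1 \<Longrightarrow> supp (circuit_vector F P \<tau>) \<noteq> {} \<Longrightarrow>
      circuit_vector F P \<tau> \<in> circ F E' r' Q"
  shows "circ F E r P \<subseteq> circ F E' r' Q"
proof
  fix X assume "X \<in> circ F E r P"
  then obtain c \<tau> where "c \<in> carrier F" "\<tau> \<subseteq> E" "card \<tau> = r + 1"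
    "supp (circuit_vector F P \<tau>) \<noteq> {}" "X = scale F c (circuit_vector F P \<tau>)" by (rule circE)
  then show "X \<in> circ F E' r' Q"
    using circ_scaled_closed[of Q] assms by metis
qed

lemma circ_scale:
  assumes P: "\<And>I. elt F (P I)" and c: "c \<in> carrier F"
  shows "circ F E r (scale F c P) = circ F E r P"
proof
  show "circ F E r (scale F c P) \<subseteq> circ F E r P"
  proof (rule circ_subset[of P, OF P])
    fix \<tau> assume "\<tau> \<subseteq> E" "card \<tau> = r + 1" "supp (circuit_vector F (scale F c P) \<tau>) \<noteq> {}"
    then show "circuit_vector F (scale F c P) \<tau> \<in> circ F E r P"
      using P c by (intro circI[OF c]) (auto simp: circuit_vector_scale)
  qed
  show "circ F E r P \<subseteq> circ F E r (scale F c P)"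
  proof (rule circ_subset)
    fix \<tau> assume "\<tau> \<subseteq> E" "card \<tau> = r + 1" "supp (circuit_vector F P \<tau>) \<noteq> {}"
    then show "circuit_vector F P \<tau> \<in> circ F E r (scale F c P)"
      using P c by (intro circI[of "inv c"]) (auto simp: circuit_vector_scale scale_scale)
  qed (use P c in simp)
qed

text \<open>No basis meets \<open>Z\<close>, so a nonzero C_\<tau> with z \<in> \<tau> \<inter> Z
  lives on z alone; such vectors arise from \<tau> = B + z for a basis B. Applied to the dual, this
  accounts for the multiples of \<open>chi\<close> among the cocircuits.\<close>

lemma circ_loops:
  assumes pv: "pv_function F E r Q" and Z: "E \<inter> Z = {}" and fin: "finite E"
  shows "circ F (E \<union> Z) r Q = circ F E r Q \<union> {scale F \<alpha> (chi F i) | \<alpha> i. \<alpha> \<in> carrier F \<and> i \<in> Z}"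
proof -
  have Q: "elt F (Q I)" for I using pv by (cases "Q I") (auto simp: pv_function_def)
  have sub: "I \<subseteq> E" "card I = r" if "Q I \<noteq> None" for I
    using pv that by (cases "Q I"; auto simp: pv_function_def)+
  have elt_chi: "elt F (chi F i j)" for i j by (simp add: chi_def)
  have loop: "\<exists>a\<in>carrier F. circuit_vector F Q \<tau> = scale F a (chi F z)"
    if z: "z \<in> \<tau>" "z \<in> Z" and ne: "supp (circuit_vector F Q \<tau>) \<noteq> {}" for z \<tau>
  proof -
    have only: "i = z" if "Q (\<tau> - {i}) \<noteq> None" for i
      using sub[OF that] z Z by blast
    obtain i where "Q (\<tau> - {i}) \<noteq> None" using ne by (auto simp: supp_circuit_vector)
    then have "Q (\<tau> - {z}) \<noteq> None" using only by blast
    then obtain a where a: "circuit_vector F Q \<tau> z = Some a"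
      using z by (cases "circuit_vector F Q \<tau> z") (auto simp: circuit_vector_def)
    have "circuit_vector F Q \<tau> z = scale F a (chi F z) z"
      using a elt_circuit_vector[of Q \<tau> z, OF Q] by (simp add: scale_def chi_def)
    moreover have "circuit_vector F Q \<tau> i = scale F a (chi F z) i" if "i \<noteq> z" for i
      using that only[of i] by (auto simp: circuit_vector_def scale_def chi_def)
    ultimately have "circuit_vector F Q \<tau> = scale F a (chi F z)" by (metis ext)
    then show ?thesis using a elt_circuit_vector[of Q \<tau> z, OF Q] by auto
  qed
  show ?thesis
  proof (intro equalityI subsetI)
    fix X assume "X \<in> circ F (E \<union> Z) r Q"
    then obtain c \<tau> where X: "c \<in> carrier F" "\<tau> \<subseteq> E \<union> Z" "card \<tau> = r + 1"
      "supp (circuit_vector F Q \<tau>) \<noteq> {}" "X = scale F c (circuit_vector F Q \<tau>)" by (rule circE)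
    show "X \<in> circ F E r Q \<union> {scale F \<alpha> (chi F i) | \<alpha> i. \<alpha> \<in> carrier F \<and> i \<in> Z}"
    proof (cases "\<tau> \<subseteq> E")
      case True
      then show ?thesis using circI[OF X(1) True X(3,4,5)] by blast
    next
      case False
      then obtain z where z: "z \<in> \<tau>" "z \<in> Z" using X by blast
      from loop[OF this X(4)] obtain a where "a \<in> carrier F" "circuit_vector F Q \<tau> = scale F a (chi F z)"
        by blast
      then have "X = scale F (c \<otimes> a) (chi F z)" "c \<otimes> a \<in> carrier F"
        using X scale_scale[of "chi F z" c a] elt_chi[of z] by auto
      then show ?thesis using z by blast
    qed
  next
    fix X assume X: "X \<in> circ F E r Q \<union> {scale F \<alpha> (chi F i) | \<alpha> i. \<alpha> \<in> carrier F \<and> i \<in> Z}"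
    show "X \<in> circ F (E \<union> Z) r Q"
    proof (cases "X \<in> circ F E r Q")
      case True
      then show ?thesis unfolding circ_def by blast
    next
      case False
      then obtain \<alpha> z where \<alpha>: "X = scale F \<alpha> (chi F z)" "\<alpha> \<in> carrier F" "z \<in> Z" using X by blast
      obtain B where B: "Q B \<noteq> None" using pv by (auto simp: pv_function_def)
      have zB: "z \<notin> B" using sub[OF B] \<alpha> Z by blast
      have "finite B" using sub[OF B] fin finite_subset by blast
      then have \<tau>: "insert z B \<subseteq> E \<union> Z" "card (insert z B) = r + 1" "supp (circuit_vector F Q (insert z B)) \<noteq> {}"
        using sub[OF B] \<alpha> zB B by (auto simp: supp_circuit_vector)
      from loop[OF _ \<alpha>(3) \<tau>(3)] obtain a where a: "a \<in> carrier F"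
        "circuit_vector F Q (insert z B) = scale F a (chi F z)" by blast
      have "X = scale F (\<alpha> \<otimes> inv a) (circuit_vector F Q (insert z B))"
        using a \<alpha> scale_scale[of "chi F z" "\<alpha> \<otimes> inv a" a] elt_chi[of z] by (simp add: m_assoc)
      then show ?thesis using circI[OF _ \<tau>] a \<alpha> by simp
    qed
  qed
qed

end

text \<open>In an exchange or a Pluecker relation every product involves the same elements with the
  same multiplicities, so a modular function adds the same amount to each.\<close>

lemma (in valuated) valuated_shift:
  fixes v :: "'e \<Rightarrow> 'g"
  shows "valuated F E r P (\<lambda>S. w S + sum v S)"
proof
  fix A B x assume A: "P A \<noteq> None" and B: "P B \<noteq> None" and x: "x \<in> A - B"
  from exchange[OF this] obtain y where y: "y \<in> B - A"
    "P (insert y (A - {x})) \<noteq> None" "P (insert x (B - {y})) \<noteq> None"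
    "w (insert y (A - {x})) + w (insert x (B - {y})) \<le> w A + w B" by blast
  have "sum v (insert y (A - {x})) = v y + (sum v A - v x)"
    "sum v (insert x (B - {y})) = v x + (sum v B - v y)"
    using y x finite_basis[OF A] finite_basis[OF B] by (auto simp: sum_diff1)
  then have eq: "sum v (insert y (A - {x})) + sum v (insert x (B - {y})) = sum v A + sum v B" by simp
  have rearr: "w a + s + (w b + t) = (w a + w b) + (s + t)" for a b s t by (simp add: algebra_simps)
  show "\<exists>y\<in>B - A. P (insert y (A - {x})) \<noteq> None \<and> P (insert x (B - {y})) \<noteq> None \<and>
      w (insert y (A - {x})) + sum v (insert y (A - {x})) + (w (insert x (B - {y})) + sum v (insert x (B - {y})))
      \<le> w A + sum v A + (w B + sum v B)"
    using y unfolding rearr by (intro bexI[of _ y]) (auto simp: eq)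
next
  fix \<tau> i j x y
  assume \<tau>: "\<tau> \<subseteq> E" "card \<tau> = r + 1" and i: "i \<in> \<tau>" "j \<in> \<tau>" "x \<in> \<tau>" "i \<noteq> j" "i \<noteq> x" "j \<noteq> x"
    and y: "y \<in> E" "y \<notin> \<tau>"
    and b: "P (\<tau> - {i}) \<noteq> None" "P (insert y (\<tau> - {x, j})) \<noteq> None"
    and third: "\<lbrakk>P (\<tau> - {x}) \<noteq> None; P (insert y (\<tau> - {i, j})) \<noteq> None\<rbrakk> \<Longrightarrow>
      w (\<tau> - {i}) + sum v (\<tau> - {i}) + (w (insert y (\<tau> - {x, j})) + sum v (insert y (\<tau> - {x, j})))
      < w (\<tau> - {x}) + sum v (\<tau> - {x}) + (w (insert y (\<tau> - {i, j})) + sum v (insert y (\<tau> - {i, j})))"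
  have fin: "finite \<tau>" using \<tau> finite_E finite_subset by blast
  have one: "sum v (\<tau> - {a}) = sum v \<tau> - v a" if "a \<in> \<tau>" for a
    using fin that by (simp add: sum_diff1)
  have two: "sum v (insert y (\<tau> - {a, b})) = v y + sum v \<tau> - v a - v b"
    if "a \<in> \<tau>" "b \<in> \<tau>" "a \<noteq> b" for a b
  proof -
    have "\<tau> - {a, b} = \<tau> - {a} - {b}" by auto
    then show ?thesis using fin that y by (simp add: sum_diff1 algebra_simps)
  qed
  have eqs: "sum v (\<tau> - {i}) + sum v (insert y (\<tau> - {x, j})) =
      sum v (\<tau> - {x}) + sum v (insert y (\<tau> - {i, j}))"
    "sum v (\<tau> - {i}) + sum v (insert y (\<tau> - {x, j})) =
      sum v (\<tau> - {j}) + sum v (insert y (\<tau> - {x, i}))"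
    using i by (simp_all add: one two algebra_simps)
  have rearr: "w a + s + (w b + t) = (w a + w b) + (s + t)" for a b s t by (simp add: algebra_simps)
  have "w (\<tau> - {i}) + w (insert y (\<tau> - {x, j})) < w (\<tau> - {x}) + w (insert y (\<tau> - {i, j}))"
    if "P (\<tau> - {x}) \<noteq> None" "P (insert y (\<tau> - {i, j})) \<noteq> None"
    using third[OF that] unfolding rearr eqs(1) by simp
  from three_term[OF \<tau> i y b this]
  show "P (\<tau> - {j}) \<noteq> None \<and> P (insert y (\<tau> - {x, i})) \<noteq> None \<and>
      w (\<tau> - {j}) + sum v (\<tau> - {j}) + (w (insert y (\<tau> - {x, i})) + sum v (insert y (\<tau> - {x, i}))) =
      w (\<tau> - {i}) + sum v (\<tau> - {i}) + (w (insert y (\<tau> - {x, j})) + sum v (insert y (\<tau> - {x, j}))) \<and>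
      mul F (cv \<tau> i) (cv (insert y (\<tau> - {x})) j) = mul F (cv \<tau> j) (cv (insert y (\<tau> - {x})) i)"
    unfolding rearr eqs(2) by simp
qed (use finite_E pv in auto)

text \<open>Makes room for weights in the first component, which dominate \<open>w\<close>.\<close>

lemma (in valuated) valuated_embed: "valuated F E r P (\<lambda>S. (0::int, w S))"
proof
  fix A B x assume "P A \<noteq> None" "P B \<noteq> None" "x \<in> A - B"
  from exchange[OF this]
  show "\<exists>y\<in>B - A. P (insert y (A - {x})) \<noteq> None \<and> P (insert x (B - {y})) \<noteq> None \<and>
    (0::int, w (insert y (A - {x}))) + (0, w (insert x (B - {y}))) \<le> (0, w A) + (0, w B)"
    by (simp add: less_eq_prod_def)
next
  fix \<tau> i j x y
  assume \<tau>: "\<tau> \<subseteq> E" "card \<tau> = r + 1" "i \<in> \<tau>" "j \<in> \<tau>" "x \<in> \<tau>" "i \<noteq> j" "i \<noteq> x" "j \<noteq> x"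
    "y \<in> E" "y \<notin> \<tau>" "P (\<tau> - {i}) \<noteq> None" "P (insert y (\<tau> - {x, j})) \<noteq> None"
    and third: "\<lbrakk>P (\<tau> - {x}) \<noteq> None; P (insert y (\<tau> - {i, j})) \<noteq> None\<rbrakk> \<Longrightarrow>
      (0::int, w (\<tau> - {i})) + (0, w (insert y (\<tau> - {x, j}))) < (0, w (\<tau> - {x})) + (0, w (insert y (\<tau> - {i, j})))"
  have "w (\<tau> - {i}) + w (insert y (\<tau> - {x, j})) < w (\<tau> - {x}) + w (insert y (\<tau> - {i, j}))"
    if "P (\<tau> - {x}) \<noteq> None" "P (insert y (\<tau> - {i, j})) \<noteq> None"
    using third[OF that] by (simp add: less_prod_def)
  from three_term[OF \<tau> this]
  show "P (\<tau> - {j}) \<noteq> None \<and> P (insert y (\<tau> - {x, i})) \<noteq> None \<and>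
      (0::int, w (\<tau> - {j})) + (0, w (insert y (\<tau> - {x, i}))) = (0, w (\<tau> - {i})) + (0, w (insert y (\<tau> - {x, j}))) \<and>
      mul F (cv \<tau> i) (cv (insert y (\<tau> - {x})) j) = mul F (cv \<tau> j) (cv (insert y (\<tau> - {x})) i)"
    by simp
qed (use finite_E pv in auto)

section \<open>Deletion, and reconstruction from circuits\<close>

context tract
begin

lemma neg_one_pow_closed [simp]: "neg_one F [^] (n::nat) \<in> carrier F"
  by simp

lemma scale_neg_one_pow: "scale F (neg_one F [^] (n::nat)) X i = mul F (sg n) (X i)"
  by (simp add: scale_def neg_one_pow_def)

text \<open>By the last hypothesis the vector of \<tau> \<union> S vanishes on \<open>S\<close>, so
  it lives on \<tau>. There the elements of \<open>S\<close> below i are counted once in the circuit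
  sign and once in the change of \<open>minor_sign\<close>, and cancel.\<close>

lemma circuit_vector_restr:
  assumes P: "\<And>I. elt F (P I)" and fin: "finite \<tau>" "finite S"
    and \<tau>: "\<tau> \<inter> Z = {}" "S \<subseteq> Z"
    and zero: "\<And>i. i \<in> S \<Longrightarrow> P (\<tau> \<union> S - {i}) = None"
  shows "circuit_vector F (restr F Z S P) \<tau> =
    scale F (neg_one F [^] minor_sign S \<tau>) (circuit_vector F P (\<tau> \<union> S))"
proof
  fix i
  consider "i \<in> \<tau>" | "i \<in> S" "i \<notin> \<tau>" | "i \<notin> \<tau> \<union> S" by blast
  then show "circuit_vector F (restr F Z S P) \<tau> i =
    scale F (neg_one F [^] minor_sign S \<tau>) (circuit_vector F P (\<tau> \<union> S)) i"
  proof cases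
    case 1
    then have "i \<notin> S" using \<tau> by blast
    then have eq: "\<tau> - {i} \<union> S = \<tau> \<union> S - {i}" by blast
    have dis: "(\<tau> - {i}) \<inter> Z = {}" "\<tau> \<inter> S = {}" using \<tau> by auto
    let ?Q = "P (\<tau> \<union> S - {i})"
    have "circuit_vector F (restr F Z S P) \<tau> i =
        mul F (sg (card {j \<in> \<tau>. j < i} + minor_sign S (\<tau> - {i}))) ?Q"
      using 1 P dis by (simp add: circuit_vector_def restr_def eq sg_sg)
    also have "sg (card {j \<in> \<tau>. j < i} + minor_sign S (\<tau> - {i})) =
        sg (minor_sign S \<tau> + card {j \<in> \<tau> \<union> S. j < i})"
      using minor_sign_remove[OF fin(1) 1, of S] card_less_Un[OF fin dis(2), of i]
      by (intro sg_parity) (auto simp del: Un_iff)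
    also have "mul F \<dots> ?Q = scale F (neg_one F [^] minor_sign S \<tau>) (circuit_vector F P (\<tau> \<union> S)) i"
      using 1 P by (simp add: scale_neg_one_pow circuit_vector_def sg_sg)
    finally show ?thesis .
  qed (use zero in \<open>auto simp: circuit_vector_def scale_def\<close>)
qed

end

context valuated
begin

text \<open>As \<open>S\<close> is smallest possible, this is deletion. The vector of \<tau>
  \<union> S vanishes on \<open>S\<close>, since \<tau> \<union> S - i would meet \<open>Z\<close>
  in fewer elements for i \<in> S. Conversely, for a circuit that avoids \<open>Z\<close>, a basis
  through all but one of its elements can be chosen to meet \<open>Z\<close> exactly in
  \<open>S\<close>.\<close>

theorem circ_restr:
  assumes B0: "P B0 \<noteq> None" and S: "S = B0 \<inter> Z"
    and min: "\<And>B. P B \<noteq> None \<Longrightarrow> card S \<le> card (B \<inter> Z)"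
  shows "circ F (E - Z) (r - card S) (restr F Z S P) = {X \<in> circ F E r P. supp X \<inter> Z = {}}"
proof -
  have elt_restr: "elt F (restr F Z S P I)" for I by (simp add: restr_def)
  have finS: "finite S" and SZ: "S \<subseteq> Z" and SE: "S \<subseteq> E"
    using S finite_basis[OF B0] basis_subset[OF B0] by auto
  have rS: "card S \<le> r"
    using card_mono[OF finite_basis[OF B0], of S] S card_basis[OF B0] by auto
  have cv_restr: "circuit_vector F (restr F Z S P) \<tau> =
      scale F (neg_one F [^] minor_sign S \<tau>) (cv (\<tau> \<union> S))"
    if "\<tau> \<subseteq> E - Z" for \<tau>
  proof (rule circuit_vector_restr[OF _ _ finS _ SZ])
    show "finite \<tau>" using that finite_E finite_subset by blast
    fix i assume i: "i \<in> S"
    have "(\<tau> \<union> S - {i}) \<inter> Z = S - {i}" using that SZ by blast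
    moreover have "card (S - {i}) < card S" using i finS by (intro card_Diff1_less) auto
    ultimately show "P (\<tau> \<union> S - {i}) = None"
      using min[of "\<tau> \<union> S - {i}"] by (cases "P (\<tau> \<union> S - {i})") auto
  qed (use that in auto)
  have card_Un: "card (\<tau> \<union> S) = card \<tau> + card S" if "\<tau> \<subseteq> E - Z" for \<tau>
    using that SZ finS finite_subset[OF that] finite_E by (subst card_Un_disjoint) auto
  show ?thesis
  proof (intro equalityI subsetI)
    fix X assume "X \<in> circ F (E - Z) (r - card S) (restr F Z S P)"
    then obtain c \<tau> where X: "c \<in> carrier F" "\<tau> \<subseteq> E - Z" "card \<tau> = r - card S + 1"
      "supp (circuit_vector F (restr F Z S P) \<tau>) \<noteq> {}"
      "X = scale F c (circuit_vector F (restr F Z S P) \<tau>)" by (rule circE)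
    have "X = scale F (c \<otimes> neg_one F [^] minor_sign S \<tau>) (cv (\<tau> \<union> S))"
      using X cv_restr[OF X(2)] by (simp add: scale_scale)
    moreover have "supp (cv (\<tau> \<union> S)) \<noteq> {}" using X cv_restr[OF X(2)] by simp
    ultimately have "X \<in> circ F E r P"
      using X SE rS card_Un[OF X(2)] by (intro circI) auto
    moreover have "supp X \<inter> Z = {}"
      using X by (auto simp: supp_circuit_vector)
    ultimately show "X \<in> {X \<in> circ F E r P. supp X \<inter> Z = {}}" by simp
  next
    fix X assume "X \<in> {X \<in> circ F E r P. supp X \<inter> Z = {}}"
    then have "X \<in> circ F E r P" and XZ: "supp X \<inter> Z = {}" by auto
    from this(1) obtain c \<sigma> where X: "c \<in> carrier F" "\<sigma> \<subseteq> E" "card \<sigma> = r + 1"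
      "supp (cv \<sigma>) \<noteq> {}" "X = scale F c (cv \<sigma>)" by (rule circE)
    let ?T = "supp (cv \<sigma>)"
    have T: "circuit_support ?T" using circuit_support_supp[OF X(4,2)] .
    obtain i where i: "i \<in> ?T" using X by blast
    then have iZ: "i \<notin> Z" using X XZ by auto
    have "indep (?T - {i})" using T i by (simp add: circuit_support_def)
    then have "{C. P C \<noteq> None \<and> ?T - {i} \<subseteq> C} \<noteq> {}" unfolding indep_def by blast
    \<comment> \<open>Exchanging an element of \<open>Z\<close> outside \<open>S\<close> against
      \<open>B0\<close> brings in no new one, as \<open>B0\<close> meets \<open>Z\<close> in
      \<open>S\<close>; and the circuit, avoiding \<open>Z\<close>, is not disturbed. So the minimum
      is 0.\<close>
    then obtain B where B': "B \<in> {C. P C \<noteq> None \<and> ?T - {i} \<subseteq> C}"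
      and opt: "\<And>D. D \<in> {C. P C \<noteq> None \<and> ?T - {i} \<subseteq> C} \<Longrightarrow> card (B \<inter> Z - S) \<le> card (D \<inter> Z - S)"
      by (rule finite_minimizer[OF finite_bases, where f = "\<lambda>C. card (C \<inter> Z - S)"])
        (rule that; blast)
    then have B: "P B \<noteq> None" "?T - {i} \<subseteq> B" by auto
    have "B \<inter> Z \<subseteq> S"
    proof (rule ccontr)
      assume "\<not> ?thesis"
      then obtain x where x: "x \<in> B \<inter> Z - S" by blast
      then have "x \<in> B - B0" using S by blast
      from exchange[OF B(1) B0 this] obtain y where y: "y \<in> B0 - B" "P (insert y (B - {x})) \<noteq> None"
        by blast
      have "x \<notin> ?T" using x X XZ by auto
      then have "?T - {i} \<subseteq> insert y (B - {x})" using B(2) by blast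
      then have "card (B \<inter> Z - S) \<le> card (insert y (B - {x}) \<inter> Z - S)" using opt y(2) by simp
      moreover have "insert y (B - {x}) \<inter> Z - S = (B \<inter> Z - S) - {x}" using y S by blast
      moreover have "card ((B \<inter> Z - S) - {x}) < card (B \<inter> Z - S)"
        using x finite_basis[OF B(1)] by (intro card_Diff1_less) auto
      ultimately show False by simp
    qed
    then have BZ: "B \<inter> Z = S" using min[OF B(1)] card_seteq[OF finS] by blast
    note fund = fundamental_circuit[OF T i B]
    let ?\<tau> = "insert i B - Z"
    have \<tau>: "?\<tau> \<subseteq> E - Z" "?\<tau> \<union> S = insert i B" using fund BZ SZ iZ by auto
    obtain d where d: "d \<in> carrier F" "cv \<sigma> = scale F d (cv (insert i B))"
      using same_support_proportional[OF X(2,3) fund(2,3)] fund(4) X(4) by auto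
    let ?s = "neg_one F [^] minor_sign S ?\<tau>"
    have eq: "circuit_vector F (restr F Z S P) ?\<tau> = scale F ?s (cv (insert i B))"
      using cv_restr[OF \<tau>(1)] \<tau>(2) by simp
    show "X \<in> circ F (E - Z) (r - card S) (restr F Z S P)"
    proof (rule circI)
      show "c \<otimes> d \<otimes> inv ?s \<in> carrier F" using X d by simp
      show "card ?\<tau> = r - card S + 1" using card_Un[OF \<tau>(1)] \<tau>(2) fund(3) rS by simp
      show "supp (circuit_vector F (restr F Z S P) ?\<tau>) \<noteq> {}" using eq fund(4) X(4) by simp
      show "X = scale F (c \<otimes> d \<otimes> inv ?s) (circuit_vector F (restr F Z S P) ?\<tau>)"
        using eq X d by (simp add: scale_scale m_assoc)
    qed (rule \<tau>)
  qed
qed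

lemma supp_circ: "supp ` circ F E r P = {T. circuit_support T}"
proof (intro equalityI subsetI)
  fix T assume "T \<in> supp ` circ F E r P"
  then obtain X where "X \<in> circ F E r P" "T = supp X" by blast
  then show "T \<in> {T. circuit_support T}"
    using circuit_support_supp by (metis circE mem_Collect_eq supp_scale)
next
  fix T assume "T \<in> {T. circuit_support T}"
  then have T: "circuit_support T" by simp
  obtain i where i: "i \<in> T" using circuit_support_nonempty[OF T] by blast
  have "indep (T - {i})" using T i by (simp add: circuit_support_def)
  then obtain B where B: "P B \<noteq> None" "T - {i} \<subseteq> B" by (auto simp: indep_def)
  note fund = fundamental_circuit[OF T i B]
  have "cv (insert i B) \<in> circ F E r P"
    using fund i by (intro circI[of \<one>]) auto
  then show "T \<in> supp ` circ F E r P" using fund(4) by blast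
qed

lemma indep_iff: "indep S \<longleftrightarrow> S \<subseteq> E \<and> \<not> (\<exists>T\<subseteq>S. circuit_support T)"
proof
  assume S: "indep S"
  then have "S \<subseteq> E" using basis_subset unfolding indep_def by blast
  moreover have "\<not> circuit_support T" if "T \<subseteq> S" for T
    using indep_mono[OF that S] by (simp add: circuit_support_def)
  ultimately show "S \<subseteq> E \<and> \<not> (\<exists>T\<subseteq>S. circuit_support T)" by blast
next
  assume "S \<subseteq> E \<and> \<not> (\<exists>T\<subseteq>S. circuit_support T)"
  then show "indep S" by (meson dependent_contains_circuit_support)
qed

lemma basis_iff: "P B \<noteq> None \<longleftrightarrow> indep B \<and> (\<forall>C. indep C \<longrightarrow> B \<subseteq> C \<longrightarrow> C = B)"
proof
  assume B: "P B \<noteq> None"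
  have "C = B" if "indep C" "B \<subseteq> C" for C
  proof -
    obtain D where D: "P D \<noteq> None" "C \<subseteq> D" using \<open>indep C\<close> by (auto simp: indep_def)
    then have "B = D"
      using card_subset_eq[OF finite_basis[OF D(1)], of B] \<open>B \<subseteq> C\<close> card_basis B by auto
    then show ?thesis using D \<open>B \<subseteq> C\<close> by blast
  qed
  then show "indep B \<and> (\<forall>C. indep C \<longrightarrow> B \<subseteq> C \<longrightarrow> C = B)" using B by (auto simp: indep_def)
next
  assume *: "indep B \<and> (\<forall>C. indep C \<longrightarrow> B \<subseteq> C \<longrightarrow> C = B)"
  then obtain D where D: "P D \<noteq> None" "B \<subseteq> D" by (auto simp: indep_def)
  then have "indep D" by (auto simp: indep_def)
  then have "D = B" using * D(2) by blast
  then show "P B \<noteq> None" using D(1) by simp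
qed

end

text \<open>Supports of circuits determine the bases. The scalar is fixed at one basis
  \<open>B0\<close> and carried along exchanges towards it: neighbouring bases \<open>B\<close> and
  B - x + y both supply entries of the vector for \<tau> = B + y, and the vectors of
  \<open>P\<close> and \<open>P'\<close> on this \<tau> are proportional, since circuits with equal
  support are.\<close>

theorem circ_determines_pv:
  assumes val: "valuated F E r P w" "valuated F E r' P' w'"
    and circ: "circ F E r P = circ F E r' P'"
  shows "r = r'" "\<exists>c\<in>carrier F. P = scale F c P'"
proof -
  interpret A: valuated F E r P w by fact
  interpret B: valuated F E r' P' w' by fact
  have "A.circuit_support T \<longleftrightarrow> B.circuit_support T" for T
    using A.supp_circ B.supp_circ circ by (metis mem_Collect_eq)
  then have "A.indep S \<longleftrightarrow> B.indep S" for S by (simp add: A.indep_iff B.indep_iff)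
  then have bases: "P' S \<noteq> None \<longleftrightarrow> P S \<noteq> None" for S by (simp add: A.basis_iff B.basis_iff)
  obtain B0 where B0: "P B0 \<noteq> None" using A.basis_exists by blast
  then show r: "r = r'" using A.card_basis B.card_basis bases by metis
  obtain a b where ab: "P B0 = Some a" "P' B0 = Some b"
    using B0 bases[of B0] by (cases "P B0"; cases "P' B0") auto
  have ab': "a \<in> carrier F" "b \<in> carrier F" using ab A.elt_P[of B0] B.elt_P[of B0] by auto
  define c where "c = a \<otimes>\<^bsub>F\<^esub> inv\<^bsub>F\<^esub> b"
  have c: "c \<in> carrier F" using ab' by (simp add: c_def)
  have B0_eq: "P B0 = mul F (Some c) (P' B0)"
    using ab ab' by (simp add: c_def A.m_assoc)
  have "P B = mul F (Some c) (P' B)" if "P B \<noteq> None" for B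
    using that
  proof (induction "card (B - B0)" arbitrary: B rule: less_induct)
    case less
    note B = less.prems
    show ?case
    proof (cases "B \<subseteq> B0")
      case True
      then have "B = B0"
        using card_subset_eq[OF A.finite_basis[OF B0]] A.card_basis B B0 by metis
      then show ?thesis using B0_eq by simp
    next
      case False
      then obtain x where x: "x \<in> B - B0" by blast
      from A.exchange[OF B B0 this] obtain y where y: "y \<in> B0 - B" "P (insert y (B - {x})) \<noteq> None"
        by blast
      let ?B' = "insert y (B - {x})" and ?\<tau> = "insert y B"
      have "?B' - B0 = (B - B0) - {x}" using y by blast
      moreover have "card ((B - B0) - {x}) < card (B - B0)"
        using x A.finite_basis[OF B] by (intro card_Diff1_less) auto
      ultimately have IH: "P ?B' = mul F (Some c) (P' ?B')" using less.hyps y(2) by metis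
      have \<tau>: "?\<tau> \<subseteq> E" "card ?\<tau> = r + 1"
        using A.basis_subset[OF B] A.basis_subset[OF B0] y A.finite_basis[OF B] A.card_basis[OF B]
        by auto
      have sets: "?\<tau> - {y} = B" "?\<tau> - {x} = ?B'" using x y by auto
      have "y \<in> supp (A.cv ?\<tau>)" using B sets(1) by (simp add: supp_circuit_vector)
      then have ne: "supp (A.cv ?\<tau>) \<noteq> {}" by blast
      then have "A.cv ?\<tau> \<in> circ F E r P" using \<tau> by (intro A.circI[of "\<one>\<^bsub>F\<^esub>"]) simp_all
      then obtain d \<sigma> where d: "d \<in> carrier F" "\<sigma> \<subseteq> E" "card \<sigma> = r' + 1"
        "A.cv ?\<tau> = scale F d (B.cv \<sigma>)" unfolding circ by (rule A.circE)
      have supp: "supp (A.cv ?\<tau>) = supp (B.cv ?\<tau>)" by (simp add: supp_circuit_vector bases)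
      then obtain e where e: "e \<in> carrier F" "B.cv \<sigma> = scale F e (B.cv ?\<tau>)"
        using B.same_support_proportional[OF d(2,3) \<tau>(1)] \<tau>(2) r d(4) ne by auto
      define f where "f = d \<otimes>\<^bsub>F\<^esub> e"
      have f: "f \<in> carrier F" "A.cv ?\<tau> = scale F f (B.cv ?\<tau>)"
        using d(1,4) e A.scale_scale[of "B.cv ?\<tau>" d e] by (simp_all add: f_def)
      have Pf: "P (?\<tau> - {z}) = mul F (Some f) (P' (?\<tau> - {z}))" if "z \<in> ?\<tau>" for z
      proof -
        let ?s = "neg_one_pow F (card {j \<in> ?\<tau>. j < z})"
        have "mul F ?s (P (?\<tau> - {z})) = mul F (Some f) (mul F ?s (P' (?\<tau> - {z})))"
          using fun_cong[OF f(2), of z] that by (simp add: circuit_vector_def scale_def)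
        also have "\<dots> = mul F ?s (mul F (Some f) (P' (?\<tau> - {z})))"
          using f(1) B.elt_P by (intro A.mul_left_comm) (simp_all only: A.elt_sg elt_Some)
        finally show ?thesis
          using A.mul_cancel[of ?s "P (?\<tau> - {z})" "mul F (Some f) (P' (?\<tau> - {z}))"] f(1) by simp
      qed
      have "mul F (Some c) (P' ?B') = mul F (Some f) (P' ?B')" using Pf[of x] IH x sets by simp
      then have "f = c"
        using y(2) bases[of ?B'] c f(1) B.elt_P[of ?B'] by (cases "P' ?B'") auto
      then show ?thesis using Pf[of y] sets by simp
    qed
  qed
  then have "P B = scale F c P' B" for B
    using bases[of B] by (cases "P B = None") (auto simp: scale_def)
  then show "\<exists>c\<in>carrier F. P = scale F c P'" using c by blast
qed

section \<open>Pluecker relations\<close>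

definition pluecker_term ::
    "'f tract \<Rightarrow> ('e::linorder set \<Rightarrow> 'f option) \<Rightarrow> 'e set \<Rightarrow> 'e set \<Rightarrow> 'e \<Rightarrow> 'f option" where
  "pluecker_term F P I J j =
     mul F (neg_one_pow F (card {j' \<in> J. j < j'} + card {i \<in> I. j < i}))
           (mul F (P (insert j I)) (P (J - {j})))"

lemma pluecker_relation_iff:
  "pluecker_relation F P I J \<longleftrightarrow> formal_sum (pluecker_term F P I J) (J - I) \<in> nullset F"
  by (simp add: pluecker_relation_def pluecker_term_def[abs_def])

text \<open>A common form for both kinds. Each construction below transports single relations and
  preserves |J - I|, so weak and strong vectors are handled at once.\<close>

lemma pluecker_iff:
  "pluecker k F E r P \<longleftrightarrow> pv_function F E r P \<and>
    (k = Weak \<longrightarrow> matroid_bases E {B. P B \<noteq> None}) \<and>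
    (\<forall>I J. I \<subseteq> E \<and> J \<subseteq> E \<and> card I + 1 = r \<and> card J = r + 1 \<and> (k = Weak \<longrightarrow> card (J - I) = 3)
      \<longrightarrow> pluecker_relation F P I J)"
  by (cases k) auto

lemma pluecker_term_eq_None:
  "pluecker_term F P I J j = None \<longleftrightarrow> P (insert j I) = None \<or> P (J - {j}) = None"
  by (simp add: pluecker_term_def)

text \<open>The leading part of a sum over F[\<Gamma>] after coefficients and weights have been
  separated, still indexed by \<open>S\<close>.\<close>

definition minimal_part :: "('i \<Rightarrow> 'f option) \<Rightarrow> ('i \<Rightarrow> 'g::linorder) \<Rightarrow> 'i set \<Rightarrow> 'i \<Rightarrow> 'f option" where
  "minimal_part t W S = (\<lambda>j. if t j \<noteq> None \<and> (\<forall>k\<in>S. t k \<noteq> None \<longrightarrow> W j \<le> W k) then t j else None)"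

lemma leading_formal_sum:
  assumes "finite S"
  shows "leading (formal_sum t S) =
    formal_sum (minimal_part (\<lambda>j. map_option fst (t j)) (\<lambda>j. snd (the (t j))) S) S"
proof -
  define D where "D = {i \<in> S. t i \<noteq> None}"
  define M where "M = {i \<in> D. \<forall>k\<in>D. snd (the (t i)) \<le> snd (the (t k))}"
  let ?m = "minimal_part (\<lambda>j. map_option fst (t j)) (\<lambda>j. snd (the (t j))) S"
  have fin: "finite D" "finite M" using assms by (auto simp: D_def M_def)
  have "{#x \<in># formal_sum t S. \<forall>y\<in>#formal_sum t S. snd x \<le> snd y#} =
      image_mset (\<lambda>i. the (t i)) (mset_set M)"
    using fin by (simp add: formal_sum_def filter_mset_image_mset D_def[symmetric] M_def)
  then have "leading (formal_sum t S) = image_mset (\<lambda>i. fst (the (t i))) (mset_set M)"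
    by (simp add: leading_def multiset.map_comp comp_def)
  also have "\<dots> = image_mset (\<lambda>i. the (?m i)) (mset_set M)"
  proof (rule image_mset_cong)
    fix i assume "i \<in># mset_set M"
    then have "i \<in> M" using fin by simp
    then show "fst (the (t i)) = the (?m i)"
      by (auto simp: minimal_part_def M_def D_def option.map_sel)
  qed
  also have "M = {i \<in> S. ?m i \<noteq> None}" by (auto simp: minimal_part_def M_def D_def)
  finally show ?thesis by (simp add: formal_sum_def)
qed

context tract
begin

lemma formal_sum_single_not_null:
  assumes "formal_sum t S \<in> nullset F" "i \<in> S" "t i \<noteq> None" "elt F (t i)"
  shows "\<exists>j\<in>S - {i}. t j \<noteq> None"
proof (rule ccontr)
  assume "\<not> ?thesis"
  then have "formal_sum t S = formal_sum t {i}"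
    using assms by (intro formal_sum_support) auto
  also have "\<dots> = {#the (t i)#}"
    using formal_sum_insert[of "{}" i t] assms by (cases "t i") auto
  finally show False using assms not_null_single[of "the (t i)"] by (cases "t i") auto
qed

lemma formal_sum_pair:
  assumes "formal_sum t {i, j} \<in> nullset F" "i \<noteq> j" "t i \<noteq> None" "t j \<noteq> None"
    "elt F (t i)" "elt F (t j)"
  shows "t j = mul F (sg 1) (t i)"
proof -
  obtain a b where ab: "t i = Some a" "t j = Some b" using assms(3,4) by fastforce
  then have "{#a, b#} \<in> nullset F"
    using assms(1,2) by (simp add: formal_sum_insert)
  then show ?thesis using null_pair[of a b] assms ab by (simp add: neg_one_pow_def)
qed

text \<open>Pluecker signs count elements above an index, circuit signs those below; in \<tau> and
  in \<tau>' the two counts add up to the cardinality minus 1, for \<open>i\<close> and for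
  \<open>j\<close>. Removing \<open>i\<close> and \<open>j\<close> from \<tau>' loses exactly one
  count, according to i < j or j < i, and this odd term cancels the sign -1 of the two-term
  relation.\<close>

lemma exchange_swap:
  fixes P :: "'e::linorder set \<Rightarrow> 'f option"
  assumes P: "\<And>I. elt F (P I)" and fin: "finite \<tau>" "finite \<tau>'" and ij: "i \<noteq> j" "i \<in> \<tau>" "j \<in> \<tau>" "i \<in> \<tau>'" "j \<in> \<tau>'"
    and eq: "pluecker_term F P (\<tau>' - {i, j}) \<tau> j = mul F (sg 1) (pluecker_term F P (\<tau>' - {i, j}) \<tau> i)"
  shows "mul F (circuit_vector F P \<tau> i) (circuit_vector F P \<tau>' j) =
    mul F (circuit_vector F P \<tau> j) (circuit_vector F P \<tau>' i)"
proof -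
  have split: "card {k \<in> A. k < x} + card {k \<in> A. x < k} + 1 = card A" if "finite A" "x \<in> A"
    for A and x :: 'e
  proof -
    have "A = insert x ({k \<in> A. k < x} \<union> {k \<in> A. x < k})" using that by auto
    then have "card A = card (insert x ({k \<in> A. k < x} \<union> {k \<in> A. x < k}))" by simp
    also have "\<dots> = Suc (card ({k \<in> A. k < x} \<union> {k \<in> A. x < k}))"
      using that by (intro card_insert_disjoint) auto
    also have "card ({k \<in> A. k < x} \<union> {k \<in> A. x < k}) = card {k \<in> A. k < x} + card {k \<in> A. x < k}"
      using that by (intro card_Un_disjoint) auto
    finally show ?thesis by simp
  qed
  have above: "card {k \<in> \<tau>'. x < k} = card {k \<in> \<tau>' - {x, y}. x < k} + (if x < y then 1 else 0)"
    if "y \<in> \<tau>'" for x y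
  proof (cases "x < y")
    case True
    then have "{k \<in> \<tau>'. x < k} = insert y {k \<in> \<tau>' - {x, y}. x < k}" using that by auto
    then show ?thesis using True fin by simp
  next
    case False
    then have "{k \<in> \<tau>'. x < k} = {k \<in> \<tau>' - {x, y}. x < k}" by auto
    then show ?thesis using False by simp
  qed
  let ?I = "\<tau>' - {i, j}"
  define b where "b x = card {k \<in> \<tau>. x < k}" for x
  define c where "c x = card {k \<in> ?I. x < k}" for x
  have ji: "\<tau>' - {j, i} = ?I" by auto
  have sets: "insert i ?I = \<tau>' - {j}" "insert j ?I = \<tau>' - {i}" using ij by auto
  have "card {k \<in> \<tau>'. i < k} = c i + (if i < j then 1 else 0)"
    unfolding c_def by (rule above[OF ij(5)])
  moreover have "card {k \<in> \<tau>'. j < k} = c j + (if j < i then 1 else 0)"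
    unfolding c_def ji[symmetric] by (rule above[OF ij(4)])
  moreover have "(if i < j then 1 else 0) + (if j < i then 1 else 0) = (1::nat)"
    using ij(1) by (auto simp: neq_iff)
  ultimately have "card {k \<in> \<tau>'. i < k} + card {k \<in> \<tau>'. j < k} = c i + c j + 1" by linarith
  then have par: "even (card {k \<in> \<tau>. k < i} + card {k \<in> \<tau>'. k < j} + (card {k \<in> \<tau>. k < j} + card {k \<in> \<tau>'. k < i})
      + (b i + c i + (b j + c j) + 1))"
    using split[OF fin(1) ij(2)] split[OF fin(1) ij(3)] split[OF fin(2) ij(4)] split[OF fin(2) ij(5)]
    unfolding b_def by presburger
  let ?p = "\<lambda>x. P (\<tau> - {x})" and ?q = "\<lambda>x. P (\<tau>' - {x})"
  have "mul F (sg (b j + c j)) (mul F (?q i) (?p j)) =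
      mul F (sg (1 + (b i + c i))) (mul F (?q j) (?p i))"
    using eq P by (simp add: pluecker_term_def sets b_def c_def sg_sg)
  then have eq': "mul F (?q i) (?p j) = mul F (sg (b j + c j + (1 + (b i + c i)))) (mul F (?q j) (?p i))"
    using P by (subst (asm) mul_sg_eq_iff) simp_all
  have swap: "mul F (mul F (sg m) (?p x)) (mul F (sg n) (?q y)) = mul F (sg (m + n)) (mul F (?q y) (?p x))"
    for m n x y
    using P mul_assoc[of "sg m" "?p x" "mul F (sg n) (?q y)"] mul_left_comm[of "?p x" "sg n" "?q y"]
      mul_comm[of "?p x" "?q y"] by (simp add: sg_sg)
  have "mul F (circuit_vector F P \<tau> j) (circuit_vector F P \<tau>' i) =
      mul F (sg (card {k \<in> \<tau>. k < j} + card {k \<in> \<tau>'. k < i})) (mul F (?q i) (?p j))"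
    using ij swap by (simp add: circuit_vector_def)
  also have "\<dots> = mul F (sg (card {k \<in> \<tau>. k < j} + card {k \<in> \<tau>'. k < i} + (b j + c j + (1 + (b i + c i)))))
      (mul F (?q j) (?p i))"
    unfolding eq' using P by (simp add: sg_sg)
  also have "sg (card {k \<in> \<tau>. k < j} + card {k \<in> \<tau>'. k < i} + (b j + c j + (1 + (b i + c i)))) =
      sg (card {k \<in> \<tau>. k < i} + card {k \<in> \<tau>'. k < j})"
    by (rule sg_parity) (use par in presburger)
  also have "mul F \<dots> (mul F (?q j) (?p i)) = mul F (circuit_vector F P \<tau> i) (circuit_vector F P \<tau>' j)"
    using ij swap by (simp add: circuit_vector_def)
  finally show ?thesis by simp
qed

text \<open>Both axioms of the locale come from three-term relations: when the terms of least weight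
  form a null sum, there cannot be exactly one of them.\<close>

lemma valuatedI:
  fixes E :: "'e::linorder set" and w :: "'e set \<Rightarrow> 'g::linordered_ab_group_add"
  assumes fin: "finite E" and pv: "pv_function F E r P" and bases: "matroid_bases E {B. P B \<noteq> None}"
    and rel: "\<And>I J. \<lbrakk>I \<subseteq> E; J \<subseteq> E; card I + 1 = r; card J = r + 1; card (J - I) = 3\<rbrakk> \<Longrightarrow>
      formal_sum (minimal_part (pluecker_term F P I J) (\<lambda>j. w (insert j I) + w (J - {j})) (J - I))
        (J - I) \<in> nullset F"
  shows "valuated F E r P w"
proof
  have P: "elt F (P I)" for I using pv by (cases "P I") (auto simp: pv_function_def)
  then have elt_term: "elt F (pluecker_term F P I J j)" for I J j by (simp add: pluecker_term_def)
  have sub: "B \<subseteq> E" "card B = r" if "P B \<noteq> None" for B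
    using pv that by (cases "P B"; auto simp: pv_function_def)+
  have fin_sub: "finite B" if "B \<subseteq> E" for B using fin finite_subset that by blast
  show "\<exists>y\<in>B - A. P (insert y (A - {x})) \<noteq> None \<and> P (insert x (B - {y})) \<noteq> None \<and>
      w (insert y (A - {x})) + w (insert x (B - {y})) \<le> w A + w B"
    if AB: "P A \<noteq> None" "P B \<noteq> None" "x \<in> A - B" for A B x
  proof -
    have "\<exists>y\<in>B - A. insert y (A - {u}) \<in> {B. P B \<noteq> None} \<and> insert u (B - {y}) \<in> {B. P B \<noteq> None} \<and>
      w (insert y (A - {u})) + w (insert u (B - {y})) \<le> w A + w B"
      if A: "A \<in> {B. P B \<noteq> None}" and B: "B \<in> {B. P B \<noteq> None}" and two: "card (B - A) = 2"
        and u: "u \<in> A - B" for A B u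
    proof -
      \<comment> \<open>The term of \<open>u\<close> is the product of the entries at
        \<open>A\<close> and \<open>B\<close>; the other two terms are the possible exchanges.
        Either one of these is strictly lighter, or the term of \<open>u\<close> is lightest and
        shares this with another.\<close>
      let ?I = "A - {u}" and ?J = "insert u B"
      let ?t = "pluecker_term F P ?I ?J" and ?W = "\<lambda>j. w (insert j ?I) + w (?J - {j})"
      have A': "A \<subseteq> E" "card A = r" and B': "B \<subseteq> E" "card B = r" using A B sub by auto
      have diff: "?J - ?I = insert u (B - A)" using u by auto
      have Wu: "?W u = w A + w B" using u by (simp add: insert_absorb)
      have tu: "?t u \<noteq> None" using A B u by (simp add: pluecker_term_eq_None insert_absorb)
      have Wy: "?W y = w (insert y (A - {u})) + w (insert u (B - {y}))" if "y \<in> B" for y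
        using that u by (metis DiffD2 insert_Diff_if singletonD)
      have good: ?thesis if "y \<in> B - A" "?t y \<noteq> None" "?W y \<le> ?W u" for y
      proof -
        have "?J - {y} = insert u (B - {y})" using that u by auto
        then show ?thesis using that Wu by (auto simp: pluecker_term_eq_None)
      qed
      have "card (?J - ?I) = 3" unfolding diff using two u fin_sub[OF B'(1)] by simp
      moreover have "card ?I + 1 = r"
        using A' u fin_sub[OF A'(1)] by (metis DiffD1 Suc_eq_plus1 card_Suc_Diff1)
      moreover have "card ?J = r + 1" using B' u fin_sub[OF B'(1)] by simp
      ultimately have null: "formal_sum (minimal_part ?t ?W (?J - ?I)) (?J - ?I) \<in> nullset F"
        using A' B' u by (intro rel) auto
      show ?thesis
      proof (cases "\<forall>k\<in>?J - ?I. ?t k \<noteq> None \<longrightarrow> ?W u \<le> ?W k")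
        case True
        then have "minimal_part ?t ?W (?J - ?I) u = ?t u" using tu unfolding minimal_part_def by auto
        then obtain y where y: "y \<in> (?J - ?I) - {u}" "minimal_part ?t ?W (?J - ?I) y \<noteq> None"
          using formal_sum_single_not_null[OF null, of u] tu elt_term diff by auto
        then have "?t y \<noteq> None" "?W y \<le> ?W u"
          using tu diff unfolding minimal_part_def by (auto split: if_splits)
        moreover have "y \<in> B - A" using y(1) unfolding diff by blast
        ultimately show ?thesis by (intro good)
      next
        case False
        then obtain y where y: "y \<in> ?J - ?I" "?t y \<noteq> None" "?W y < ?W u" by (meson not_le)
        then have "y \<noteq> u" by blast
        then have "y \<in> B - A" using y(1) unfolding diff by simp
        then show ?thesis using y(2) less_imp_le[OF y(3)] by (rule good)
      qed
    qed
    note loc = this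
    have "card B = r" if "B \<in> {B. P B \<noteq> None}" for B using sub(2) that by simp
    then have "\<exists>y\<in>B - A. insert y (A - {x}) \<in> {B. P B \<noteq> None} \<and> insert x (B - {y}) \<in> {B. P B \<noteq> None} \<and>
      w (insert y (A - {x})) + w (insert x (B - {y})) \<le> w A + w B"
      by (rule matroid_local_exchange_imp_exchange[OF fin bases _ loc]) (use AB in simp_all)
    then show ?thesis by simp
  qed
  fix \<tau> i j x y
  assume \<tau>: "\<tau> \<subseteq> E" "card \<tau> = r + 1" and i: "i \<in> \<tau>" "j \<in> \<tau>" "x \<in> \<tau>" "i \<noteq> j" "i \<noteq> x" "j \<noteq> x"
    and y: "y \<in> E" "y \<notin> \<tau>"
    and b: "P (\<tau> - {i}) \<noteq> None" "P (insert y (\<tau> - {x, j})) \<noteq> None"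
    and third: "\<lbrakk>P (\<tau> - {x}) \<noteq> None; P (insert y (\<tau> - {i, j})) \<noteq> None\<rbrakk> \<Longrightarrow>
      w (\<tau> - {i}) + w (insert y (\<tau> - {x, j})) < w (\<tau> - {x}) + w (insert y (\<tau> - {i, j}))"
  \<comment> \<open>With J = \<tau> and I = \<tau> + y - x - i - j the three terms belong to
    \<open>i\<close>, \<open>j\<close> and x. The assumption keeps x out of the leading part, which
    therefore consists of the terms of \<open>i\<close> and \<open>j\<close>.\<close>
  let ?\<tau>' = "insert y (\<tau> - {x})"
  let ?I = "?\<tau>' - {i, j}"
  let ?t = "pluecker_term F P ?I \<tau>" and ?W = "\<lambda>j. w (insert j ?I) + w (\<tau> - {j})"
  let ?m = "minimal_part ?t ?W {i, j, x}"
  have diff: "\<tau> - ?I = {i, j, x}" using i y by auto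
  have sets: "insert i ?I = insert y (\<tau> - {x, j})" "insert j ?I = insert y (\<tau> - {x, i})"
    "insert x ?I = insert y (\<tau> - {i, j})" using i y by auto
  have fin': "finite \<tau>" "finite ?\<tau>'" using fin_sub[OF \<tau>(1)] by auto
  have "card ?\<tau>' = r + 1" using \<tau> i y fin' by simp
  moreover have "card ?\<tau>' = card ?I + 2"
  proof -
    have "?\<tau>' = insert i (insert j ?I)" using i y by auto
    then have "card ?\<tau>' = card (insert i (insert j ?I))" by simp
    then show ?thesis using i fin' by simp
  qed
  ultimately have "card ?I + 1 = r" by simp
  moreover have "card (\<tau> - ?I) = 3" unfolding diff using i by simp
  ultimately have null: "formal_sum ?m {i, j, x} \<in> nullset F"
    using rel[of ?I \<tau>] \<tau> y unfolding diff by auto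
  have ti: "?t i \<noteq> None" using b sets by (simp add: pluecker_term_eq_None)
  have Wx: "?W i < ?W x" if "?t x \<noteq> None"
    using third that sets by (simp add: pluecker_term_eq_None add.commute)
  have elt_m: "elt F (?m k)" for k using elt_term by (simp add: minimal_part_def)
  have "?t j \<noteq> None \<and> ?W j = ?W i"
  proof (cases "\<forall>k\<in>{i, j, x}. ?t k \<noteq> None \<longrightarrow> ?W i \<le> ?W k")
    case True
    then have "?m i \<noteq> None" using ti unfolding minimal_part_def by auto
    then obtain k where k: "k \<in> {i, j, x} - {i}" "?m k \<noteq> None"
      using formal_sum_single_not_null[OF null _ _ elt_m] by blast
    then have k': "?t k \<noteq> None" "?W k \<le> ?W i"
      using ti unfolding minimal_part_def by (auto split: if_splits)
    then have "k \<noteq> x" using Wx by auto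
    then have "k = j" using k by auto
    then show ?thesis using k' True by force
  next
    case False
    then obtain k where k: "k \<in> {i, j, x}" "?t k \<noteq> None" "?W k < ?W i" by (meson not_le)
    then have kj: "k = j" using Wx by auto
    then have "\<forall>l\<in>{i, j, x}. ?t l \<noteq> None \<longrightarrow> ?W j \<le> ?W l" using k Wx by fastforce
    then have "?m j \<noteq> None" using k(2) kj unfolding minimal_part_def by auto
    then obtain l where l: "l \<in> {i, j, x} - {j}" "?m l \<noteq> None"
      using formal_sum_single_not_null[OF null _ _ elt_m] by blast
    then have "?t l \<noteq> None" "?W l \<le> ?W j"
      using k kj unfolding minimal_part_def by (auto split: if_splits)
    then show ?thesis using l k kj Wx by auto
  qed
  then have tj: "?t j \<noteq> None" and Wj: "?W j = ?W i" by auto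
  have "?m x = None" using Wx ti unfolding minimal_part_def by (auto simp: not_le)
  then have "formal_sum ?m {i, j, x} = formal_sum ?m {i, j}"
    by (intro formal_sum_support) auto
  moreover have "?m i = ?t i" "?m j = ?t j"
    using tj Wj ti Wx unfolding minimal_part_def by (auto simp: less_imp_le)
  ultimately have "?t j = mul F (sg 1) (?t i)"
    using formal_sum_pair[of ?m i j] null i ti tj elt_term by auto
  then have "mul F (circuit_vector F P \<tau> i) (circuit_vector F P ?\<tau>' j) =
      mul F (circuit_vector F P \<tau> j) (circuit_vector F P ?\<tau>' i)"
    using i y fin' by (intro exchange_swap P) auto
  then show "P (\<tau> - {j}) \<noteq> None \<and> P (insert y (\<tau> - {x, i})) \<noteq> None \<and>
      w (\<tau> - {j}) + w (insert y (\<tau> - {x, i})) = w (\<tau> - {i}) + w (insert y (\<tau> - {x, j})) \<and>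
      mul F (circuit_vector F P \<tau> i) (circuit_vector F P ?\<tau>' j) =
      mul F (circuit_vector F P \<tau> j) (circuit_vector F P ?\<tau>' i)"
    using tj Wj sets by (simp add: pluecker_term_eq_None add.commute)
qed (use assms in auto)

end

section \<open>Initial, restricted and extended Pluecker vectors\<close>

text \<open>The Pluecker vector after adding the coloops \<open>Z\<close>. The sign is that of
  \<open>restr\<close> for S = Z, so contracting \<open>Z\<close> recovers a \<open>P\<close> whose
  ground set is disjoint from \<open>Z\<close>.\<close>

definition coext ::
    "'f tract \<Rightarrow> 'e::linorder set \<Rightarrow> ('e set \<Rightarrow> 'f option) \<Rightarrow> 'e set \<Rightarrow> 'f option" where
  "coext F Z P = (\<lambda>I. if Z \<subseteq> I then mul F (neg_one_pow F (minor_sign Z (I - Z))) (P (I - Z)) else None)"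

text \<open>The right side does not depend on j: signs given by \<open>minor_sign\<close> contribute
  the same factor to every term of a relation.\<close>

lemma minor_sign_insert_remove:
  assumes "finite I" "finite J" "j \<in> J - I"
  shows "minor_sign S (insert j I) + minor_sign S (J - {j}) = minor_sign S I + minor_sign S J"
  using minor_sign_remove[of J j S] assms by (simp add: minor_sign_def)

lemma card_greater_Un:
  fixes i :: "'e::linorder"
  assumes "finite A" "finite B" "A \<inter> B = {}"
  shows "card {x \<in> A \<union> B. i < x} = card {x \<in> A. i < x} + card {x \<in> B. i < x}"
proof -
  have "{x \<in> A \<union> B. i < x} = {x \<in> A. i < x} \<union> {x \<in> B. i < x}" by auto
  moreover have "{x \<in> A. i < x} \<inter> {x \<in> B. i < x} = {}" using assms by auto
  ultimately show ?thesis using assms by (simp add: card_Un_disjoint)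
qed

lemma theta_eq_None [simp]: "theta x = None \<longleftrightarrow> x = None"
  by (simp add: theta_def)

lemma minimal_part_cong:
  assumes "\<And>j. j \<in> S \<Longrightarrow> s j = t j" "\<And>j. j \<in> S \<Longrightarrow> t j \<noteq> None \<Longrightarrow> V j = W j" "j \<in> S"
  shows "minimal_part s V S j = minimal_part t W S j"
  using assms by (auto simp: minimal_part_def)

context tract
begin

lemma pv_elt: "pv_function F E r P \<Longrightarrow> elt F (P I)"
  by (cases "P I") (auto simp: pv_function_def)

lemma pv_basis: "pv_function F E r P \<Longrightarrow> P I \<noteq> None \<Longrightarrow> I \<subseteq> E \<and> card I = r"
  by (cases "P I") (auto simp: pv_function_def)

lemma pluecker_imp_pv: "pluecker k F E r P \<Longrightarrow> pv_function F E r P"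
  by (simp add: pluecker_iff)

text \<open>The relation for I = A - x and J = B + x contains the nonzero product of the entries at
  \<open>A\<close> and \<open>B\<close>. A null sum cannot consist of a single term, so some other y
  gives a basis A - x + y.\<close>

lemma pluecker_imp_weak:
  fixes E :: "'e::linorder set"
  assumes fin: "finite E" and P: "pluecker k F E r P"
  shows "pluecker Weak F E r P"
proof (cases k)
  case Strong
  have pv: "pv_function F E r P" using P by (rule pluecker_imp_pv)
  have rel: "formal_sum (pluecker_term F P I J) (J - I) \<in> nullset F"
    if "I \<subseteq> E" "J \<subseteq> E" "card I + 1 = r" "card J = r + 1" for I J
    using P Strong that by (simp add: pluecker_relation_iff)
  have "\<exists>y\<in>B - A. P (insert y (A - {x})) \<noteq> None"
    if A: "P A \<noteq> None" and B: "P B \<noteq> None" and x: "x \<in> A - B" for A B x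
  proof -
    have A': "A \<subseteq> E" "card A = r" and B': "B \<subseteq> E" "card B = r"
      using pv_basis[OF pv A] pv_basis[OF pv B] by auto
    then have finAB: "finite A" "finite B" using fin finite_subset by auto
    let ?t = "pluecker_term F P (A - {x}) (insert x B)"
    have "card (A - {x}) + 1 = r"
      using A' x finAB by (metis DiffD1 Suc_eq_plus1 card_Suc_Diff1)
    then have null: "formal_sum ?t (insert x B - (A - {x})) \<in> nullset F"
      using A' B' x finAB by (intro rel) auto
    have "?t x \<noteq> None" using A B x by (simp add: pluecker_term_eq_None insert_absorb)
    then obtain y where "y \<in> insert x B - (A - {x}) - {x}" "?t y \<noteq> None"
      using formal_sum_single_not_null[OF null, of x] pv_elt[OF pv] x
      by (auto simp: pluecker_term_def)
    then show ?thesis by (intro bexI[of _ y]) (auto simp: pluecker_term_eq_None)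
  qed
  then have "matroid_bases E {B. P B \<noteq> None}"
    using pv_basis[OF pv] pv unfolding matroid_bases_def pv_function_def by auto
  then show ?thesis using P Strong by auto
qed (use P in simp)

text \<open>For weight 0 every term has least weight, so the hypothesis of \<open>valuatedI\<close>
  is the relation itself.\<close>

lemma valuated_of_pluecker:
  fixes E :: "'e::linorder set"
  assumes fin: "finite E" and P: "pluecker k F E r P"
  shows "valuated F E r P (\<lambda>_. 0::int)"
proof -
  have W: "pluecker Weak F E r P" using fin P by (rule pluecker_imp_weak)
  then have pv: "pv_function F E r P" by (rule pluecker_imp_pv)
  show ?thesis
  proof (rule valuatedI[OF fin pv])
    fix I J assume IJ: "I \<subseteq> E" "J \<subseteq> E" "card I + 1 = r" "card J = r + 1" "card (J - I) = 3"
    have "formal_sum (pluecker_term F P I J) (J - I) \<in> nullset F"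
      using W IJ by (simp add: pluecker_relation_iff)
    moreover have "minimal_part (pluecker_term F P I J) (\<lambda>j. 0 + 0 :: int) (J - I) = pluecker_term F P I J"
      by (auto simp: minimal_part_def)
    ultimately show "formal_sum (minimal_part (pluecker_term F P I J) (\<lambda>j. 0 + 0 :: int) (J - I)) (J - I)
        \<in> nullset F" by (simp only:)
  qed (use W in simp)
qed

lemma neg_one_trop: "neg_one (trop_ext F :: ('f \<times> 'g::linordered_ab_group_add) tract) = (neg_one F, 0)"
proof -
  interpret T: tract "trop_ext F :: ('f \<times> 'g) tract" by (rule tract_trop_ext)
  have "{#\<one>\<^bsub>trop_ext F\<^esub>, (neg_one F, 0::'g)#} \<in> nullset (trop_ext F)"
    using neg_one_null by (simp add: leading_def)
  then show ?thesis using T.neg_one_unique[of "(neg_one F, 0)"] by simp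
qed

lemma neg_one_pow_trop:
  "neg_one_pow (trop_ext F :: ('f \<times> 'g::linordered_ab_group_add) tract) n = Some (neg_one F [^] n, 0)"
proof -
  interpret T: tract "trop_ext F :: ('f \<times> 'g) tract" by (rule tract_trop_ext)
  have "(neg_one F, 0::'g) [^]\<^bsub>trop_ext F\<^esub> n = (neg_one F [^] n, 0)"
    by (induction n) simp_all
  then show ?thesis unfolding neg_one_pow_def neg_one_trop by (rule arg_cong)
qed

lemma theta_neg_one_pow: "theta (neg_one_pow (trop_ext F :: ('f \<times> 'g::linordered_ab_group_add) tract) n) = sg n"
  unfolding neg_one_pow_trop by (simp add: theta_def neg_one_pow_def)

lemma theta_mul: "theta (mul (trop_ext F) x y) = mul F (theta x) (theta y)"
  by (cases x; cases y) (auto simp: theta_def)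

lemma theta_pluecker_term:
  fixes P :: "'e::linorder set \<Rightarrow> ('f \<times> 'g::linordered_ab_group_add) option"
  shows "theta (pluecker_term (trop_ext F) P I J j) = pluecker_term F (\<lambda>B. theta (P B)) I J j"
  by (simp add: pluecker_term_def theta_mul theta_neg_one_pow)

lemma snd_pluecker_term:
  fixes P :: "'e::linorder set \<Rightarrow> ('f \<times> 'g::linordered_ab_group_add) option"
  assumes "pluecker_term (trop_ext F) P I J j \<noteq> None"
  shows "snd (the (pluecker_term (trop_ext F) P I J j)) =
    snd (the (P (insert j I))) + snd (the (P (J - {j})))"
  using assms
  by (cases "P (insert j I)"; cases "P (J - {j})") (auto simp: pluecker_term_def neg_one_pow_trop)

lemma trop_relation:
  fixes P :: "'e::linorder set \<Rightarrow> ('f \<times> 'g::linordered_ab_group_add) option"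
  assumes rel: "pluecker_relation (trop_ext F) P I J" and fin: "finite J"
  shows "formal_sum (minimal_part (pluecker_term F (\<lambda>B. theta (P B)) I J)
    (\<lambda>j. snd (the (P (insert j I))) + snd (the (P (J - {j})))) (J - I)) (J - I) \<in> nullset F"
proof -
  let ?t = "pluecker_term (trop_ext F) P I J"
  have "formal_sum (minimal_part (pluecker_term F (\<lambda>B. theta (P B)) I J)
    (\<lambda>j. snd (the (P (insert j I))) + snd (the (P (J - {j})))) (J - I)) (J - I) =
    formal_sum (minimal_part (\<lambda>j. map_option fst (?t j)) (\<lambda>j. snd (the (?t j))) (J - I)) (J - I)"
    by (intro formal_sum_cong minimal_part_cong)
      (auto simp: snd_pluecker_term theta_pluecker_term[unfolded theta_def] theta_def
        pluecker_term_eq_None)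
  also have "\<dots> = leading (formal_sum ?t (J - I))"
    using fin by (simp add: leading_formal_sum)
  also have "\<dots> \<in> nullset F"
    using rel zero_null by (auto simp: pluecker_relation_iff leading_def)
  finally show ?thesis .
qed

text \<open>Off the bases the weight is an unspecified value; the locale compares weights of bases
  only.\<close>

lemma valuated_of_trop_pluecker:
  fixes E :: "'e::linorder set" and P :: "'e set \<Rightarrow> ('f \<times> 'g::linordered_ab_group_add) option"
  assumes fin: "finite E" and P: "pluecker k (trop_ext F) E r P"
  shows "valuated F E r (\<lambda>B. theta (P B)) (\<lambda>B. snd (the (P B)))"
proof -
  interpret T: tract "trop_ext F :: ('f \<times> 'g) tract" by (rule tract_trop_ext)
  have W: "pluecker Weak (trop_ext F) E r P" using fin P by (rule T.pluecker_imp_weak)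
  have pv: "pv_function (trop_ext F) E r P" using W by (rule T.pluecker_imp_pv)
  show ?thesis
  proof (rule valuatedI[OF fin])
    show "pv_function F E r (\<lambda>B. theta (P B))"
      using pv unfolding pv_function_def theta_def by fastforce
    fix I J assume IJ: "I \<subseteq> E" "J \<subseteq> E" "card I + 1 = r" "card J = r + 1" "card (J - I) = 3"
    show "formal_sum (minimal_part (pluecker_term F (\<lambda>B. theta (P B)) I J)
        (\<lambda>j. snd (the (P (insert j I))) + snd (the (P (J - {j})))) (J - I)) (J - I) \<in> nullset F"
      using W IJ fin by (intro trop_relation) (auto intro: finite_subset)
  qed (use W in simp)
qed

end

lemma (in valuated) matroid_bases: "matroid_bases E {B. P B \<noteq> None}"
  unfolding matroid_bases_def
proof (intro conjI ballI)
  fix A B x assume "A \<in> {B. P B \<noteq> None}" "B \<in> {B. P B \<noteq> None}" "x \<in> A - B"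
  then show "\<exists>y\<in>B - A. insert y (A - {x}) \<in> {B. P B \<noteq> None}"
    using exchange[of A B x] by auto
qed (use basis_exists basis_subset in auto)

section \<open>Initial forms, minors and coloops of Pluecker vectors\<close>

context tract
begin

lemma initial_pv_eq:
  fixes P :: "'e::linorder set \<Rightarrow> ('f \<times> 'g::linordered_ab_group_add) option" and v :: "'e \<Rightarrow> 'g"
  assumes pv: "pv_function (trop_ext F) E r P"
  defines "w \<equiv> \<lambda>B. snd (the (P B)) + sum (\<lambda>i. - v i) B"
  shows "initial_pv E r v P B =
    (if P B \<noteq> None \<and> (\<forall>A. P A \<noteq> None \<longrightarrow> w B \<le> w A) then theta (P B) else None)"
proof (cases "P B")
  case None
  then show ?thesis by (simp add: initial_pv_def)
next
  case (Some a)
  interpret T: tract "trop_ext F :: ('f \<times> 'g) tract" by (rule tract_trop_ext)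
  have basis: "A \<subseteq> E \<and> card A = r" if "P A \<noteq> None" for A using T.pv_basis[OF pv that] .
  have val: "val (P A) + Fin (- (\<Sum>i\<in>A. v i)) = (if P A = None then Infty else Fin (w A))" for A
    by (cases "P A") (auto simp: val_def w_def sum_negf)
  have le: "x \<le> Infty" for x :: "'g ext" by (cases x) auto
  have "(\<forall>J. J \<subseteq> E \<and> card J = r \<longrightarrow> val (P B) + Fin (- (\<Sum>i\<in>B. v i)) \<le> val (P J) + Fin (- (\<Sum>j\<in>J. v j)))
    \<longleftrightarrow> (\<forall>A. P A \<noteq> None \<longrightarrow> w B \<le> w A)"
    unfolding val using Some basis le by auto
  then show ?thesis using Some basis[of B] by (simp add: initial_pv_def)
qed

text \<open>If all terms of the relation for the initial vector vanish, it is the zero sum.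
  Otherwise some term multiplies two lightest bases, and then the terms of least weight in the
  relation for \<open>P\<close> are exactly the products of two lightest bases; the shift by
  \<open>v\<close> adds the constant \<open>?c\<close> to all of them.\<close>

lemma pluecker_initial:
  fixes E :: "'e::linorder set" and P :: "'e set \<Rightarrow> ('f \<times> 'g::linordered_ab_group_add) option"
  assumes fin: "finite E" and P: "pluecker k (trop_ext F) E r P"
  shows "pluecker k F E r (initial_pv E r v P)"
proof -
  interpret T: tract "trop_ext F :: ('f \<times> 'g) tract" by (rule tract_trop_ext)
  have pv: "pv_function (trop_ext F) E r P" using P by (rule T.pluecker_imp_pv)
  define w where "w = (\<lambda>B. snd (the (P B)) + sum (\<lambda>i. - v i) B)"
  interpret V: valuated F E r "\<lambda>B. theta (P B)" w
    unfolding w_def by (rule valuated.valuated_shift[OF valuated_of_trop_pluecker[OF fin P]])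
  interpret I: valuated F E r V.initial_P "\<lambda>_. 0::int" by (rule V.valuated_initial)
  have "w B = snd (the (P B)) + sum (\<lambda>i. - v i) B" for B by (simp add: w_def)
  then have eq: "initial_pv E r v P = V.initial_P"
    by (auto simp: fun_eq_iff initial_pv_eq[OF pv] V.initial_P_def V.min_basis_def)
  let ?P = "\<lambda>B. theta (P B)" and ?Q = V.initial_P
  have "pluecker_relation F ?Q I J"
    if I: "I \<subseteq> E" "card I + 1 = r" and J: "J \<subseteq> E" "card J = r + 1" and rel: "pluecker_relation (trop_ext F) P I J"
    for I J
  proof (cases "\<forall>j\<in>J - I. pluecker_term F ?Q I J j = None")
    case True
    then have "formal_sum (pluecker_term F ?Q I J) (J - I) = {#}" by (intro formal_sum_None) auto
    then show ?thesis using zero_null by (simp add: pluecker_relation_iff)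
  next
    case False
    have finIJ: "finite I" "finite J" using I J fin finite_subset by auto
    let ?W = "\<lambda>j. snd (the (P (insert j I))) + snd (the (P (J - {j})))"
    let ?c = "sum (\<lambda>i. - v i) I + sum (\<lambda>i. - v i) J"
    have W: "w (insert j I) + w (J - {j}) = ?W j + ?c" if "j \<in> J - I" for j
      using that finIJ by (simp add: w_def sum_diff1 algebra_simps)
    obtain j0 where j0: "j0 \<in> J - I" "V.min_basis (insert j0 I)" "V.min_basis (J - {j0})"
      using False by (auto simp: pluecker_term_eq_None V.initial_P_def split: if_splits)
    have terms: "pluecker_term F ?Q I J j = minimal_part (pluecker_term F ?P I J) ?W (J - I) j"
      if j: "j \<in> J - I" for j
    proof (cases "V.min_basis (insert j I) \<and> V.min_basis (J - {j})")
      case True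
      have "?W j \<le> ?W k" if k: "k \<in> J - I" "pluecker_term F ?P I J k \<noteq> None" for k
      proof -
        have "w (insert j I) + w (J - {j}) \<le> w (insert k I) + w (J - {k})"
          using True k by (intro add_mono) (auto simp: V.min_basis_def pluecker_term_eq_None)
        then show ?thesis using W[OF j] W[OF k(1)] by simp
      qed
      then show ?thesis
        using True by (auto simp: minimal_part_def V.initial_P_def pluecker_term_def V.min_basis_def)
    next
      case False
      have "minimal_part (pluecker_term F ?P I J) ?W (J - I) j = None"
      proof (rule ccontr)
        assume "\<not> ?thesis"
        then have jb: "?P (insert j I) \<noteq> None" "?P (J - {j}) \<noteq> None"
          and min: "\<And>k. k \<in> J - I \<Longrightarrow> pluecker_term F ?P I J k \<noteq> None \<Longrightarrow> ?W j \<le> ?W k"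
          by (auto simp: minimal_part_def pluecker_term_eq_None split: if_splits)
        have "?W j \<le> ?W j0"
          using min[OF j0(1)] j0 by (simp add: pluecker_term_eq_None V.min_basis_def)
        then have le: "w (insert j I) + w (J - {j}) \<le> w (insert j0 I) + w (J - {j0})"
          using W[OF j] W[OF j0(1)] by simp
        have "w (insert j0 I) \<le> w (insert j I)" "w (J - {j0}) \<le> w (J - {j})"
          using j0 jb by (auto simp: V.min_basis_def)
        from add_mono_eqD[OF this le] have "V.min_basis (insert j I)" "V.min_basis (J - {j})"
          using j0 jb by (auto simp: V.min_basis_def)
        then show False using False by blast
      qed
      then show ?thesis using False by (auto simp: pluecker_term_eq_None V.initial_P_def)
    qed
    have "formal_sum (pluecker_term F ?Q I J) (J - I) =
        formal_sum (minimal_part (pluecker_term F ?P I J) ?W (J - I)) (J - I)"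
      using terms by (rule formal_sum_cong)
    then show ?thesis using trop_relation[OF rel finIJ(2)] by (simp add: pluecker_relation_iff)
  qed
  then show ?thesis
    using P I.pv I.matroid_bases unfolding eq pluecker_iff by auto
qed

text \<open>The relation for I, J is a common multiple of the one for I \<union> S, J \<union> S:
  elements of \<open>S\<close> above j are counted in both I \<union> S and J \<union> S, hence
  twice, and the \<open>minor_sign\<close> exponents add up to a value free of j.\<close>

lemma pluecker_restr:
  fixes E :: "'e::linorder set"
  assumes fin: "finite E" and P: "pluecker k F E r P" and B0: "P B0 \<noteq> None" and S: "S = B0 \<inter> Z"
  shows "pluecker k F (E - Z) (r - card S) (restr F Z S P)"
proof -
  have pv: "pv_function F E r P" using P by (rule pluecker_imp_pv)
  have elt: "elt F (P I)" for I using pv_elt[OF pv] .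
  have B0': "B0 \<subseteq> E" "card B0 = r" using pv_basis[OF pv B0] by auto
  then have finS: "finite S" and SE: "S \<subseteq> E" and SZ: "S \<subseteq> Z" using S fin finite_subset by auto
  have rS: "card S \<le> r" using card_mono[of B0 S] S B0' fin finite_subset by auto
  have basis: "I \<inter> Z = {}" "P (I \<union> S) \<noteq> None" if "restr F Z S P I \<noteq> None" for I
    using that by (auto simp: restr_def split: if_splits)
  have basis': "restr F Z S P I \<noteq> None \<longleftrightarrow> I \<inter> Z = {} \<and> P (I \<union> S) \<noteq> None" for I
    by (simp add: restr_def)
  have "(B0 - Z) \<union> S = B0" using S by blast
  then have "restr F Z S P (B0 - Z) \<noteq> None" using B0 by (auto simp: basis')
  moreover have "I \<subseteq> E - Z \<and> card I = r - card S" if "restr F Z S P I \<noteq> None" for I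
  proof -
    have I: "I \<subseteq> E" "card (I \<union> S) = r" "I \<inter> S = {}"
      using pv_basis[OF pv basis(2)[OF that]] basis(1)[OF that] SZ by auto
    then have "card I + card S = r" using card_Un_disjoint[of I S] finS fin finite_subset by metis
    then show ?thesis using I basis(1)[OF that] by auto
  qed
  moreover have "elt F (restr F Z S P I)" for I by (simp add: restr_def elt)
  ultimately have pv': "pv_function F (E - Z) (r - card S) (restr F Z S P)"
    unfolding pv_function_def by (metis elt_Some option.distinct(1))
  have "matroid_bases (E - Z) {B. restr F Z S P B \<noteq> None}" if "matroid_bases E {B. P B \<noteq> None}"
    unfolding matroid_bases_def
  proof (intro conjI ballI)
    show "{B. restr F Z S P B \<noteq> None} \<noteq> {}" using pv' by (auto simp: pv_function_def)
    fix A assume A: "A \<in> {B. restr F Z S P B \<noteq> None}"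
    then show "A \<subseteq> E - Z" using pv_basis[OF pv'] by auto
    fix B x assume B: "B \<in> {B. restr F Z S P B \<noteq> None}" and x: "x \<in> A - B"
    have AB: "P (A \<union> S) \<noteq> None" "P (B \<union> S) \<noteq> None" "A \<inter> Z = {}" "B \<inter> Z = {}"
      using A B basis by auto
    then have x': "x \<in> (A \<union> S) - (B \<union> S)" "x \<notin> S" using x SZ by auto
    then obtain y where y: "y \<in> (B \<union> S) - (A \<union> S)" "P (insert y (A \<union> S - {x})) \<noteq> None"
      using \<open>matroid_bases E _\<close> AB unfolding matroid_bases_def by blast
    have "insert y (A \<union> S - {x}) = insert y (A - {x}) \<union> S" using x' by blast
    then show "\<exists>y\<in>B - A. insert y (A - {x}) \<in> {B. restr F Z S P B \<noteq> None}"
      using y AB by (intro bexI[of _ y]) (auto simp: basis')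
  qed
  moreover have "pluecker_relation F (restr F Z S P) I J"
    if I: "I \<subseteq> E - Z" "J \<subseteq> E - Z" and rel: "pluecker_relation F P (I \<union> S) (J \<union> S)" for I J
    unfolding pluecker_relation_iff
  proof (rule null_formal_sum_mul)
    have diff: "(J \<union> S) - (I \<union> S) = J - I" using I SZ by blast
    show "formal_sum (pluecker_term F P (I \<union> S) (J \<union> S)) (J - I) \<in> nullset F"
      using rel by (simp add: pluecker_relation_iff diff)
    fix j assume j: "j \<in> J - I"
    have fins: "finite I" "finite J" using I fin finite_subset by (metis finite_Diff)+
    have dis: "I \<inter> S = {}" "J \<inter> S = {}" "j \<notin> Z" "j \<notin> S" using I j SZ by auto
    have sets: "insert j I \<union> S = insert j (I \<union> S)" "(J - {j}) \<union> S = (J \<union> S) - {j}"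
      using dis by auto
    have "sg (card {j' \<in> J. j < j'} + card {i \<in> I. j < i} +
        (minor_sign S (insert j I) + minor_sign S (J - {j}))) =
      sg (minor_sign S I + minor_sign S J + (card {j' \<in> J \<union> S. j < j'} + card {i \<in> I \<union> S. j < i}))"
      using card_greater_Un[OF fins(1) finS dis(1), of j] card_greater_Un[OF fins(2) finS dis(2), of j]
        minor_sign_insert_remove[OF fins j, of S]
      by (intro sg_parity) (auto simp del: Un_iff)
    moreover have "pluecker_term F (restr F Z S P) I J j =
      mul F (sg (card {j' \<in> J. j < j'} + card {i \<in> I. j < i} +
        (minor_sign S (insert j I) + minor_sign S (J - {j}))))
        (mul F (P (insert j (I \<union> S))) (P (J \<union> S - {j})))"
    proof -
      have "insert j I \<inter> Z = {}" "(J - {j}) \<inter> Z = {}" using I dis by auto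
      then show ?thesis
        using elt sets mul_left_comm[of "P (insert j (I \<union> S))"]
        by (simp add: pluecker_term_def restr_def mul_assoc sg_sg)
    qed
    ultimately show "pluecker_term F (restr F Z S P) I J j =
        mul F (sg (minor_sign S I + minor_sign S J)) (pluecker_term F P (I \<union> S) (J \<union> S) j)"
      using elt by (simp add: pluecker_term_def sg_sg)
  qed simp_all
  moreover have "pluecker_relation F P (I \<union> S) (J \<union> S)"
    if I: "I \<subseteq> E - Z" "J \<subseteq> E - Z" "card I + 1 = r - card S" "card J = r - card S + 1"
      "k = Weak \<longrightarrow> card (J - I) = 3" for I J
  proof -
    have fins: "finite I" "finite J" using I fin finite_subset by (metis finite_Diff)+
    have dis: "I \<inter> S = {}" "J \<inter> S = {}" using I SZ by auto
    have "(J \<union> S) - (I \<union> S) = J - I" using I SZ by blast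
    moreover have "card (I \<union> S) = card I + card S" "card (J \<union> S) = card J + card S"
      using card_Un_disjoint fins finS dis by auto
    ultimately have "I \<union> S \<subseteq> E \<and> J \<union> S \<subseteq> E \<and> card (I \<union> S) + 1 = r \<and> card (J \<union> S) = r + 1 \<and>
        (k = Weak \<longrightarrow> card ((J \<union> S) - (I \<union> S)) = 3)"
      using I SE rS by auto
    then show ?thesis using P unfolding pluecker_iff by blast
  qed
  ultimately show ?thesis using pv' P unfolding pluecker_iff by auto
qed

lemma pluecker_coext:
  fixes E :: "'e::linorder set"
  assumes fin: "finite E" "finite Z" and EZ: "E \<inter> Z = {}" and P: "pluecker k F E r P"
  shows "pluecker k F (E \<union> Z) (r + card Z) (coext F Z P)"
proof -
  have pv: "pv_function F E r P" using P by (rule pluecker_imp_pv)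
  have elt: "elt F (P I)" for I using pv_elt[OF pv] .
  have basis: "coext F Z P I \<noteq> None \<longleftrightarrow> Z \<subseteq> I \<and> P (I - Z) \<noteq> None" for I
    by (simp add: coext_def)
  have "\<exists>I. coext F Z P I \<noteq> None"
  proof -
    obtain B where B: "P B \<noteq> None" using pv by (auto simp: pv_function_def)
    have "B \<union> Z - Z = B" using pv_basis[OF pv B] EZ by blast
    then show ?thesis using B by (auto simp: basis intro!: exI[of _ "B \<union> Z"])
  qed
  moreover have "I \<subseteq> E \<union> Z \<and> card I = r + card Z" if "coext F Z P I \<noteq> None" for I
  proof -
    have I: "Z \<subseteq> I" "I - Z \<subseteq> E" "card (I - Z) = r" using that basis pv_basis[OF pv] by auto
    have "finite I" using I(2) fin by (metis finite_Diff2 finite_subset)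
    then have "card I = card (I - Z) + card Z" using I(1) fin by (metis card_Diff_subset card_mono le_add_diff_inverse2)
    then show ?thesis using I by auto
  qed
  moreover have "elt F (coext F Z P I)" for I by (simp add: coext_def elt)
  ultimately have pv': "pv_function F (E \<union> Z) (r + card Z) (coext F Z P)"
    unfolding pv_function_def by (metis elt_Some option.distinct(1))
  have "matroid_bases (E \<union> Z) {B. coext F Z P B \<noteq> None}" if "matroid_bases E {B. P B \<noteq> None}"
    unfolding matroid_bases_def
  proof (intro conjI ballI)
    show "{B. coext F Z P B \<noteq> None} \<noteq> {}" using pv' by (auto simp: pv_function_def)
    fix A assume A: "A \<in> {B. coext F Z P B \<noteq> None}"
    then show "A \<subseteq> E \<union> Z" using pv_basis[OF pv'] by auto
    fix B x assume B: "B \<in> {B. coext F Z P B \<noteq> None}" and x: "x \<in> A - B"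
    have AB: "P (A - Z) \<noteq> None" "P (B - Z) \<noteq> None" "Z \<subseteq> A" "Z \<subseteq> B"
      using A B basis by auto
    then have x': "x \<in> (A - Z) - (B - Z)" "x \<notin> Z" using x by auto
    then obtain y where y: "y \<in> (B - Z) - (A - Z)" "P (insert y (A - Z - {x})) \<noteq> None"
      using \<open>matroid_bases E _\<close> AB unfolding matroid_bases_def by blast
    have "insert y (A - Z - {x}) = insert y (A - {x}) - Z" "Z \<subseteq> insert y (A - {x})"
      using x' y AB by auto
    then show "\<exists>y\<in>B - A. insert y (A - {x}) \<in> {B. coext F Z P B \<noteq> None}"
      using y by (intro bexI[of _ y]) (auto simp: basis)
  qed
  moreover have "pluecker_relation F (coext F Z P) I J"
    if I: "I \<subseteq> E \<union> Z" "J \<subseteq> E \<union> Z" "card I + 1 = r + card Z" "card J = r + card Z + 1"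
      "k = Weak \<longrightarrow> card (J - I) = 3" for I J
  proof (cases "Z \<subseteq> I \<and> Z \<subseteq> J")
    case False
    have "pluecker_term F (coext F Z P) I J j = None" if "j \<in> J - I" for j
    proof (rule ccontr)
      assume "\<not> ?thesis"
      \<comment> \<open>A nonzero term needs Z \<subseteq> J - j, hence j \<notin> Z, and Z
        \<subseteq> I + j, hence Z \<subseteq> I.\<close>
      then have "Z \<subseteq> insert j I" "Z \<subseteq> J - {j}" unfolding pluecker_term_eq_None using basis by auto
      then show False using False by blast
    qed
    then have "formal_sum (pluecker_term F (coext F Z P) I J) (J - I) = {#}" by (rule formal_sum_None)
    then show ?thesis using zero_null by (simp add: pluecker_relation_iff)
  next
    case True
    let ?I = "I - Z" and ?J = "J - Z"
    have fins: "finite ?I" "finite ?J" "finite I" "finite J" using I fin finite_subset by auto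
    have un: "?I \<union> Z = I" "?J \<union> Z = J" "?I \<inter> Z = {}" "?J \<inter> Z = {}" using True by auto
    have diff: "?J - ?I = J - I" using True by blast
    have "card I = card ?I + card Z" "card J = card ?J + card Z"
      using card_Un_disjoint[OF fins(1) fin(2) un(3)] card_Un_disjoint[OF fins(2) fin(2) un(4)] un by auto
    then have "?I \<subseteq> E \<and> ?J \<subseteq> E \<and> card ?I + 1 = r \<and> card ?J = r + 1 \<and> (k = Weak \<longrightarrow> card (?J - ?I) = 3)"
      using I unfolding diff by auto
    then have rel: "pluecker_relation F P ?I ?J" using P unfolding pluecker_iff by blast
    show ?thesis
      unfolding pluecker_relation_iff
    proof (rule null_formal_sum_mul)
      show "formal_sum (pluecker_term F P ?I ?J) (J - I) \<in> nullset F"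
        using rel by (simp add: pluecker_relation_iff diff)
      fix j assume j: "j \<in> J - I"
      then have j': "j \<in> ?J - ?I" "j \<notin> Z" using True by auto
      have sets: "insert j I - Z = insert j ?I" "(J - {j}) - Z = ?J - {j}" "Z \<subseteq> insert j I" "Z \<subseteq> J - {j}"
        using j' True by auto
      have "sg (card {j' \<in> J. j < j'} + card {i \<in> I. j < i} +
          (minor_sign Z (insert j ?I) + minor_sign Z (?J - {j}))) =
        sg (minor_sign Z ?I + minor_sign Z ?J + (card {j' \<in> ?J. j < j'} + card {i \<in> ?I. j < i}))"
        using card_greater_Un[OF fins(1) fin(2) un(3), of j] card_greater_Un[OF fins(2) fin(2) un(4), of j]
          minor_sign_insert_remove[OF fins(1,2) j'(1), of Z]
        unfolding un by (intro sg_parity) (auto simp del: Diff_iff)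
      moreover have "pluecker_term F (coext F Z P) I J j =
        mul F (sg (card {j' \<in> J. j < j'} + card {i \<in> I. j < i} +
          (minor_sign Z (insert j ?I) + minor_sign Z (?J - {j}))))
          (mul F (P (insert j ?I)) (P (?J - {j})))"
        using elt sets mul_left_comm[of "P (insert j ?I)"]
        by (simp add: pluecker_term_def coext_def mul_assoc sg_sg)
      ultimately show "pluecker_term F (coext F Z P) I J j =
          mul F (sg (minor_sign Z ?I + minor_sign Z ?J)) (pluecker_term F P ?I ?J j)"
        using elt by (simp add: pluecker_term_def sg_sg)
    qed simp_all
  qed
  ultimately show ?thesis using pv' P unfolding pluecker_iff by auto
qed

end

section \<open>Duality\<close>

text \<open>\<open>listing_perm\<close> for an arbitrary listing, so that its sign can be computed
  by moving entries one place at a time.\<close>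

definition list_perm :: "'e::linorder set \<Rightarrow> 'e list \<Rightarrow> 'e \<Rightarrow> 'e" where
  "list_perm E xs = (\<lambda>x. if x \<in> E then xs ! card {y \<in> E. y < x} else x)"

lemma bij_betw_card_below:
  assumes "finite (E :: 'e::linorder set)"
  shows "bij_betw (\<lambda>x. card {y \<in> E. y < x}) E {..<card E}"
proof -
  have mono: "card {y \<in> E. y < a} < card {y \<in> E. y < b}" if "a \<in> E" "a < b" for a b
    using assms that by (intro psubset_card_mono) auto
  have inj: "inj_on (\<lambda>x. card {y \<in> E. y < x}) E"
    by (rule linorder_inj_onI) (use mono in fastforce)+
  moreover have sub: "(\<lambda>x. card {y \<in> E. y < x}) ` E \<subseteq> {..<card E}"
    using assms by (auto intro!: psubset_card_mono)
  ultimately have "(\<lambda>x. card {y \<in> E. y < x}) ` E = {..<card E}"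
    by (intro card_subset_eq) (auto simp: card_image)
  then show ?thesis using inj by (simp add: bij_betw_def)
qed

lemma list_perm_permutes:
  assumes "finite E" "distinct xs" "set xs = E"
  shows "list_perm E xs permutes E"
proof (rule bij_imp_permutes)
  have len: "length xs = card E" using distinct_card[OF assms(2)] assms(3) by simp
  have "bij_betw ((!) xs) {..<card E} E"
    using assms(3) len by (intro bij_betw_nth[OF assms(2)]) auto
  from bij_betw_trans[OF bij_betw_card_below[OF assms(1)] this]
  show "bij_betw (list_perm E xs) E E"
    by (rule bij_betw_cong[THEN iffD1, rotated]) (simp add: list_perm_def)
qed (simp add: list_perm_def)

text \<open>Interchanging two neighbouring entries composes the permutation with their
  transposition.\<close>

lemma sign_list_perm_swap:
  assumes "finite E" "distinct (us @ a # b # vs)" "set (us @ a # b # vs) = E"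
  shows "sign (list_perm E (us @ b # a # vs)) = - sign (list_perm E (us @ a # b # vs))"
proof -
  let ?xs = "us @ a # b # vs" and ?ys = "us @ b # a # vs"
  have nth: "?ys ! k = transpose a b (?xs ! k)" if k: "k < length ?xs" for k
  proof -
    consider "k < length us" | "k = length us" | "k = Suc (length us)"
      | m where "k = length us + Suc (Suc m)" "m < length vs"
    proof (cases "k < length us + 2")
      case False
      assume *: "\<And>m. k = length us + Suc (Suc m) \<Longrightarrow> m < length vs \<Longrightarrow> thesis"
      show thesis by (rule *[of "k - length us - 2"]) (use False k in auto)
    qed linarith
    then show ?thesis
    proof cases
      case 1
      then have "us ! k \<noteq> a" "us ! k \<noteq> b" using assms(2) by (auto dest: nth_mem)
      then show ?thesis using 1 by (simp add: nth_append transpose_def)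
    next
      case 4
      then have "vs ! m \<noteq> a" "vs ! m \<noteq> b" using assms(2) by (auto dest: nth_mem)
      then show ?thesis using 4 by (simp add: nth_append transpose_def)
    qed (simp_all add: nth_append transpose_def)
  qed
  have ab: "a \<in> E" "b \<in> E" "a \<noteq> b" using assms by auto
  have len: "card {y \<in> E. y < x} < length ?xs" if "x \<in> E" for x
  proof -
    have "card {y \<in> E. y < x} < card E" using that assms(1) by (intro psubset_card_mono) auto
    then show ?thesis using distinct_card[OF assms(2)] assms(3) by simp
  qed
  have "list_perm E ?ys = transpose a b \<circ> list_perm E ?xs"
  proof
    fix x show "list_perm E ?ys x = (transpose a b \<circ> list_perm E ?xs) x"
      using nth[OF len] ab by (cases "x \<in> E") (auto simp: list_perm_def transpose_def)
  qed
  moreover have "permutation (list_perm E ?xs)"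
    using list_perm_permutes[OF assms] assms(1) by (rule permutes_imp_permutation[rotated])
  ultimately show ?thesis
    using ab by (simp add: sign_compose permutation_swap_id sign_swap_id)
qed

lemma sign_list_perm_move:
  assumes "finite E" "distinct (us @ ws @ x # vs)" "set (us @ ws @ x # vs) = E"
  shows "sign (list_perm E (us @ x # ws @ vs)) = (- 1) ^ length ws * sign (list_perm E (us @ ws @ x # vs))"
  using assms(2,3)
proof (induction ws arbitrary: us)
  case (Cons a ws)
  have "sign (list_perm E (us @ x # a # ws @ vs)) = - sign (list_perm E (us @ a # x # ws @ vs))"
    using Cons.prems by (intro sign_list_perm_swap[OF assms(1)]) auto
  moreover have "sign (list_perm E ((us @ [a]) @ x # ws @ vs)) =
      (- 1) ^ length ws * sign (list_perm E ((us @ [a]) @ ws @ x # vs))"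
    using Cons.prems by (intro Cons.IH) auto
  ultimately show ?case by simp
qed simp

lemma list_perm_sorted:
  assumes "finite (E :: 'e::linorder set)"
  shows "list_perm E (sorted_list_of_set E) = id"
proof
  fix x :: 'e
  let ?l = "sorted_list_of_set E"
  show "list_perm E ?l x = id x"
  proof (cases "x \<in> E")
    case True
    then obtain k where k: "k < length ?l" "?l ! k = x" using assms by (metis in_set_conv_nth set_sorted_list_of_set)
    have less: "?l ! i < ?l ! j \<longleftrightarrow> i < j" if "i < length ?l" "j < length ?l" for i j
      using that strict_sorted_list_of_set[of E] sorted_wrt_nth_less[of "(<)" ?l]
      by (metis linorder_neqE_nat order_less_asym order_less_irrefl)
    have "{y \<in> E. y < x} = (!) ?l ` {..<k}"
    proof (intro equalityI subsetI)
      fix y assume "y \<in> {y \<in> E. y < x}"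
      then have y: "y \<in> set ?l" "y < x" using assms by auto
      then obtain i where "i < length ?l" "?l ! i = y" by (auto simp: in_set_conv_nth)
      then show "y \<in> (!) ?l ` {..<k}" using less k y by auto
    next
      fix y assume "y \<in> (!) ?l ` {..<k}"
      then obtain i where i: "i < k" "y = ?l ! i" by auto
      then have "y \<in> set ?l" using k(1) by (simp add: nth_mem)
      then show "y \<in> {y \<in> E. y < x}" using i k less[of i k] assms by auto
    qed
    moreover have "inj_on ((!) ?l) {..<k}"
      using k by (intro inj_on_nth) auto
    ultimately have "card {y \<in> E. y < x} = k" by (simp add: card_image)
    then show ?thesis using True k by (simp add: list_perm_def)
  qed (simp add: list_perm_def)
qed

text \<open>Listing \<open>I\<close> before its complement creates one inversion for each a \<in> I
  and y \<notin> I with y < a. Counting all y \<in> E below a also counts the pairs inside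
  \<open>I\<close>, as many as the binomial; adding the binomial once more has the same parity as
  subtracting it.\<close>

definition dual_exp :: "'e::linorder set \<Rightarrow> 'e set \<Rightarrow> nat" where
  "dual_exp E I = minor_sign E I + (card I choose 2)"

text \<open>Appending a new maximum \<open>b\<close> to \<open>I\<close> moves \<open>b\<close> to the left across the elements of the
  complement of \<open>I\<close> below \<open>b\<close>.\<close>

lemma sign_listing_perm:
  assumes fin: "finite (E :: 'e::linorder set)" and sub: "I \<subseteq> E"
  shows "sign (listing_perm E I) = (- 1) ^ dual_exp E I"
proof -
  have listing: "listing_perm E I = list_perm E (sorted_list_of_set I @ sorted_list_of_set (E - I))" for I
    by (simp add: listing_perm_def list_perm_def)
  have "finite I" using fin sub finite_subset by blast
  then show ?thesis using sub
  proof (induction I rule: finite_linorder_max_induct)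
    case empty
    then show ?case using fin by (simp add: listing list_perm_sorted dual_exp_def minor_sign_def numeral_2_eq_2)
  next
    case (insert b A)
    let ?us = "sorted_list_of_set {y \<in> E - A. y < b}" and ?vs = "sorted_list_of_set {y \<in> E - A. b < y}"
    have b: "b \<in> E" "b \<notin> A" using insert by auto
    have finA: "finite A" by fact
    have sorted: "sorted_list_of_set B = xs" if "sorted xs" "distinct xs" "set xs = B" for B and xs :: "'e list"
      using that sorted_list_of_set.idem_if_sorted_distinct by blast
    have s1: "sorted_list_of_set (insert b A) = sorted_list_of_set A @ [b]"
      using insert finA by (intro sorted) (auto simp: sorted_append less_imp_le)
    have s2: "sorted_list_of_set (E - A) = ?us @ b # ?vs"
      using fin b by (intro sorted) (auto simp: sorted_append less_imp_le)
    have s3: "sorted_list_of_set (E - insert b A) = ?us @ ?vs"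
      using fin b by (intro sorted) (auto simp: sorted_append)
    have "sign (listing_perm E (insert b A)) = sign (list_perm E (sorted_list_of_set A @ b # ?us @ ?vs))"
      by (simp add: listing s1 s3)
    also have "\<dots> = (- 1) ^ length ?us * sign (list_perm E (sorted_list_of_set A @ ?us @ b # ?vs))"
      using fin finA insert b by (intro sign_list_perm_move) auto
    also have "sign (list_perm E (sorted_list_of_set A @ ?us @ b # ?vs)) = (- 1) ^ dual_exp E A"
      using insert unfolding s2[symmetric] listing[symmetric] by simp
    also have "(- 1) ^ length ?us * (- 1) ^ dual_exp E A = ((- 1) ^ dual_exp E (insert b A) :: int)"
    proof -
      have "{y \<in> E. y < b} = A \<union> {y \<in> E - A. y < b}" using insert by auto
      moreover have "card (A \<union> {y \<in> E - A. y < b}) = card A + card {y \<in> E - A. y < b}"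
        using fin finA by (intro card_Un_disjoint) auto
      ultimately have "card {y \<in> E. y < b} = card A + length ?us" by simp
      moreover have "minor_sign E (insert b A) = minor_sign E A + card {y \<in> E. y < b}"
        using finA b by (simp add: minor_sign_def)
      \<comment> \<open>All of \<open>A\<close> lies below the new maximum \<open>b\<close>, so
        \<open>minor_sign\<close> and the binomial each grow by a further \<open>card A\<close>, an
        even amount together.\<close>
      ultimately have "dual_exp E (insert b A) = length ?us + dual_exp E A + 2 * card A"
        using finA b by (simp add: dual_exp_def numeral_2_eq_2)
      then show ?thesis by (simp add: power_add power_mult)
    qed
    finally show ?case .
  qed
qed

lemma minor_sign_Un_right:
  "finite I \<Longrightarrow> finite J \<Longrightarrow> I \<inter> J = {} \<Longrightarrow> minor_sign S (I \<union> J) = minor_sign S I + minor_sign S J"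
  by (simp add: minor_sign_def sum.union_disjoint)

lemma minor_sign_Un_left:
  "finite S \<Longrightarrow> finite T \<Longrightarrow> S \<inter> T = {} \<Longrightarrow> minor_sign (S \<union> T) I = minor_sign S I + minor_sign T I"
  unfolding minor_sign_def by (simp only: card_less_Un sum.distrib)

section \<open>Pluecker vectors of dual matroids\<close>

context tract
begin

lemma dual_pv_eq:
  fixes E :: "'e::linorder set"
  assumes "finite E"
  shows "dual_pv F E P I =
    (if I \<subseteq> E then mul F (sg (dual_exp E I)) (map_option (invol F) (P (E - I))) else None)"
proof -
  have "sg (if sign (listing_perm E I) = 1 then 0 else 1) = sg (dual_exp E I)" if "I \<subseteq> E"
    by (rule sg_parity) (use sign_listing_perm[OF assms that] in \<open>auto simp: minus_one_power_iff\<close>)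
  then show ?thesis by (simp add: dual_pv_def)
qed

lemma dual_pv_eq_None:
  "finite E \<Longrightarrow> dual_pv F E P I \<noteq> None \<longleftrightarrow> I \<subseteq> E \<and> P (E - I) \<noteq> None"
  by (simp add: dual_pv_eq)

lemma dual_pv_scale:
  assumes "finite E" "\<And>I. elt F (P I)" "c \<in> carrier F"
  shows "dual_pv F E (scale F c P) = scale F (invol F c) (dual_pv F E P)"
  using assms by (simp add: fun_eq_iff dual_pv_eq scale_def map_option_invol_mul mul_left_comm)

text \<open>The dual relation for I, J is the involution of the relation for E - J, E - I, times a
  sign free of j: the elements above j in a set and in its complement are together all elements
  above j in \<open>E\<close>, which occurs twice, and I + j and J - j have equal size, so their
  binomials cancel.\<close>

lemma pluecker_dual:
  fixes E :: "'e::linorder set"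
  assumes fin: "finite E" and P: "pluecker k F E r P"
  shows "pluecker k F E (card E - r) (dual_pv F E P)"
proof -
  have pv: "pv_function F E r P" using P by (rule pluecker_imp_pv)
  have elt: "elt F (P I)" for I using pv_elt[OF pv] .
  have basis: "dual_pv F E P I \<noteq> None \<longleftrightarrow> I \<subseteq> E \<and> P (E - I) \<noteq> None" for I
    by (rule dual_pv_eq_None[OF fin])
  obtain B0 where B0: "P B0 \<noteq> None" using pv by (auto simp: pv_function_def)
  then have B0E: "B0 \<subseteq> E" "card B0 = r" using pv_basis[OF pv] by auto
  then have rE: "r \<le> card E" using card_mono[OF fin] by blast
  have card_compl: "card (E - I) = card E - card I" "card I \<le> card E" if "I \<subseteq> E" for I
    using that fin by (auto simp: card_Diff_subset finite_subset card_mono)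
  have "E - (E - B0) = B0" using B0E by blast
  then have "dual_pv F E P (E - B0) \<noteq> None" using B0 by (simp add: basis)
  moreover have "I \<subseteq> E \<and> card I = card E - r" if "dual_pv F E P I \<noteq> None" for I
    using that pv_basis[OF pv, of "E - I"] card_compl[of I] unfolding basis by auto
  moreover have "elt F (dual_pv F E P I)" for I using elt by (simp add: dual_pv_eq[OF fin])
  ultimately have pv': "pv_function F E (card E - r) (dual_pv F E P)"
    unfolding pv_function_def by (metis elt_Some option.distinct(1))
  interpret V: valuated F E r P "\<lambda>_. 0::int" by (rule valuated_of_pluecker[OF fin P])
  have "matroid_bases E {B. dual_pv F E P B \<noteq> None}"
    unfolding matroid_bases_def
  proof (intro conjI ballI)
    show "{B. dual_pv F E P B \<noteq> None} \<noteq> {}" using pv' by (auto simp: pv_function_def)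
    fix A assume A: "A \<in> {B. dual_pv F E P B \<noteq> None}"
    then show AE: "A \<subseteq> E" by (auto simp: basis)
    fix B x assume B: "B \<in> {B. dual_pv F E P B \<noteq> None}" and x: "x \<in> A - B"
    have "P (E - B) \<noteq> None" "P (E - A) \<noteq> None" "x \<in> (E - B) - (E - A)" using A B x basis by auto
    from V.exchange[OF this] obtain y where y: "y \<in> (E - A) - (E - B)"
      "P (insert x (E - A - {y})) \<noteq> None" by blast
    have "insert x (E - A - {y}) = E - insert y (A - {x})" using x y AE by auto
    then show "\<exists>y\<in>B - A. insert y (A - {x}) \<in> {B. dual_pv F E P B \<noteq> None}"
      using y AE by (intro bexI[of _ y]) (auto simp: basis)
  qed
  moreover have "pluecker_relation F (dual_pv F E P) I J"
    if I: "I \<subseteq> E" "J \<subseteq> E" "card I + 1 = card E - r" "card J = card E - r + 1"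
      "k = Weak \<longrightarrow> card (J - I) = 3" for I J
  proof -
    let ?q = "card E - r"
    have fins: "finite I" "finite J" using I fin finite_subset by auto
    have diff: "(E - I) - (E - J) = J - I" using I by blast
    have "E - J \<subseteq> E \<and> E - I \<subseteq> E \<and> card (E - J) + 1 = r \<and> card (E - I) = r + 1 \<and>
        (k = Weak \<longrightarrow> card ((E - I) - (E - J)) = 3)"
      unfolding diff using I rE card_compl[of I] card_compl[of J] by auto
    then have "pluecker_relation F P (E - J) (E - I)" using P unfolding pluecker_iff by blast
    then have null: "formal_sum (\<lambda>j. map_option (invol F) (pluecker_term F P (E - J) (E - I) j)) (J - I)
        \<in> nullset F"
      unfolding pluecker_relation_iff diff formal_sum_map by (rule invol_null)
    show ?thesis
      unfolding pluecker_relation_iff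
    proof (rule null_formal_sum_mul[OF _ _ null])
      fix j assume j: "j \<in> J - I"
      have sets: "E - insert j I = E - I - {j}" "E - (J - {j}) = insert j (E - J)"
        "insert j I \<subseteq> E" "J - {j} \<subseteq> E" using I j by auto
      have cards: "card (insert j I) = ?q" "card (J - {j}) = ?q" using I j fins by auto
      have above: "card {x \<in> A. j < x} + card {x \<in> E - A. j < x} = card {x \<in> E. j < x}"
        if "A \<subseteq> E" for A
        using card_greater_Un[of A "E - A" j] that fin finite_subset[OF that fin]
        by (metis Diff_disjoint Un_Diff_cancel finite_Diff sup.absorb2)
      let ?e = "minor_sign E I + minor_sign E J"
      have "dual_exp E (insert j I) + dual_exp E (J - {j}) = ?e + 2 * (?q choose 2)"
        unfolding dual_exp_def cards using minor_sign_insert_remove[OF fins j, of E] by simp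
      then have par: "even (card {j' \<in> J. j < j'} + card {i \<in> I. j < i} +
          (dual_exp E (insert j I) + dual_exp E (J - {j})) +
          (?e + (card {j' \<in> E - I. j < j'} + card {i \<in> E - J. j < i})))"
        using above[OF I(1)] above[OF I(2)] by presburger
      let ?p = "map_option (invol F) (P (E - I - {j}))" and ?q = "map_option (invol F) (P (insert j (E - J)))"
      have pq: "elt F ?p" "elt F ?q" using elt by auto
      have "pluecker_term F (dual_pv F E P) I J j =
          mul F (sg (card {j' \<in> J. j < j'} + card {i \<in> I. j < i})) (mul F (mul F (sg (dual_exp E (insert j I))) ?p)
            (mul F (sg (dual_exp E (J - {j}))) ?q))"
        using sets by (simp add: pluecker_term_def dual_pv_eq[OF fin])
      also have "\<dots> = mul F (sg (card {j' \<in> J. j < j'} + card {i \<in> I. j < i} +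
          (dual_exp E (insert j I) + dual_exp E (J - {j})))) (mul F ?q ?p)"
        using pq mul_left_comm[of ?p] mul_comm[of ?p ?q] by (simp add: mul_assoc sg_sg)
      also have "\<dots> = mul F (sg (?e + (card {j' \<in> E - I. j < j'} + card {i \<in> E - J. j < i}))) (mul F ?q ?p)"
        using sg_parity[OF par] by simp
      also have "\<dots> = mul F (sg ?e) (map_option (invol F) (pluecker_term F P (E - J) (E - I) j))"
        using elt pq by (simp add: pluecker_term_def map_option_invol_mul invol_sg sg_sg)
      finally show "pluecker_term F (dual_pv F E P) I J j =
        mul F (sg ?e) (map_option (invol F) (pluecker_term F P (E - J) (E - I) j))" .
    qed simp_all
  qed
  ultimately show ?thesis using pv' unfolding pluecker_iff by auto
qed

text \<open>Coloops become loops: the dual vector is unchanged on the larger ground set, up to a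
  sign. The sign is constant because the part of \<open>dual_exp\<close> at I due to
  \<open>Z\<close> and the sign of \<open>coext\<close> at the complement add up to
  \<open>minor_sign Z E\<close>.\<close>

lemma dual_pv_coext:
  fixes E :: "'e::linorder set"
  assumes fin: "finite E" "finite Z" and EZ: "E \<inter> Z = {}" and R: "\<And>I. elt F (R I)"
  shows "dual_pv F (E \<union> Z) (coext F Z R) = scale F (neg_one F [^] minor_sign Z E) (dual_pv F E R)"
proof
  fix I
  have finU: "finite (E \<union> Z)" using fin by simp
  show "dual_pv F (E \<union> Z) (coext F Z R) I = scale F (neg_one F [^] minor_sign Z E) (dual_pv F E R) I"
  proof (cases "I \<subseteq> E")
    case False
    then show ?thesis
      using EZ by (auto simp: dual_pv_eq[OF finU] dual_pv_eq[OF fin(1)] scale_neg_one_pow coext_def)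
  next
    case True
    have finI: "finite I" using True fin finite_subset by blast
    have sets: "E \<union> Z - I - Z = E - I" "Z \<subseteq> E \<union> Z - I" "I \<subseteq> E \<union> Z" using True EZ by auto
    have "minor_sign Z E = minor_sign Z I + minor_sign Z (E - I)"
      using minor_sign_Un_right[of I "E - I" Z] True finI fin by (simp add: Un_absorb1)
    then have par: "even (dual_exp (E \<union> Z) I + minor_sign Z (E - I) + (minor_sign Z E + dual_exp E I))"
      using minor_sign_Un_left[OF fin EZ, of I] by (auto simp: dual_exp_def)
    have "dual_pv F (E \<union> Z) (coext F Z R) I =
        mul F (sg (dual_exp (E \<union> Z) I + minor_sign Z (E - I))) (map_option (invol F) (R (E - I)))"
      using sets R by (simp add: dual_pv_eq[OF finU] coext_def map_option_invol_mul invol_sg sg_sg)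
    also have "\<dots> = scale F (neg_one F [^] minor_sign Z E) (dual_pv F E R) I"
      using True R sg_parity[OF par] by (simp add: dual_pv_eq[OF fin(1)] scale_neg_one_pow sg_sg)
    finally show ?thesis .
  qed
qed

text \<open>Contraction becomes deletion: the complement of a basis that meets \<open>Z\<close> in
  \<open>S\<close> meets it in Z - S. Both sides vanish unless I has the right size, which is why
  the binomials in the exponent are constants.\<close>

lemma dual_pv_restr:
  fixes E :: "'e::linorder set"
  assumes fin: "finite E" and pv: "pv_function F E r P" and SZ: "S \<subseteq> Z" "Z \<subseteq> E"
  shows "\<exists>e. dual_pv F (E - Z) (restr F Z S P) =
    scale F (neg_one F [^] (e::nat)) (restr F Z (Z - S) (dual_pv F E P))"
proof -
  have elt: "elt F (P I)" for I using pv_elt[OF pv] .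
  have finE: "finite (E - Z)" "finite Z" "finite S" "finite (Z - S)"
    using fin finite_subset[OF SZ(2) fin] finite_subset[OF SZ(1)] by auto
  let ?q = "card E - r - card (Z - S)"
  let ?e = "minor_sign S (E - Z) + minor_sign E (Z - S) + (?q choose 2) + ((?q + card (Z - S)) choose 2)"
  have "dual_pv F (E - Z) (restr F Z S P) I =
    scale F (neg_one F [^] ?e) (restr F Z (Z - S) (dual_pv F E P)) I" for I
  proof (cases "I \<subseteq> E - Z \<and> P (E - Z - I \<union> S) \<noteq> None")
    case False
    have "dual_pv F (E - Z) (restr F Z S P) I = None"
      using False by (auto simp: dual_pv_eq[OF finE(1)] restr_def)
    moreover have "restr F Z (Z - S) (dual_pv F E P) I = None"
    proof (cases "I \<subseteq> E - Z")
      case True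
      have "E - (I \<union> (Z - S)) = E - Z - I \<union> S" using SZ True by auto
      then show ?thesis using False True by (auto simp: dual_pv_eq[OF fin] restr_def)
    qed (use SZ in \<open>auto simp: dual_pv_eq[OF fin] restr_def\<close>)
    ultimately show ?thesis by (simp add: scale_def)
  next
    case True
    have I: "I \<subseteq> E" "I \<inter> Z = {}" "finite I" using True fin finite_subset by auto
    have sets: "E - (I \<union> (Z - S)) = E - Z - I \<union> S" "(E - Z - I) \<inter> Z = {}" "I \<union> (Z - S) \<subseteq> E"
      using I SZ by auto
    have disj: "I \<inter> (Z - S) = {}" using I by auto
    have card_un: "card (I \<union> (Z - S)) = card I + card (Z - S)"
      using card_Un_disjoint[OF I(3) finE(4) disj] .
    have "card (E - (I \<union> (Z - S))) = r" using pv_basis[OF pv] True sets by simp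
    then have "card (I \<union> (Z - S)) = card E - r"
      using sets(3) fin by (metis card_Diff_subset card_mono diff_diff_cancel finite_subset)
    then have q: "card I = ?q" using card_un by simp
    have "minor_sign S (E - Z) = minor_sign S I + minor_sign S (E - Z - I)"
      using minor_sign_Un_right[of I "E - Z - I" S] True I finE by (simp add: Un_absorb1)
    moreover have "minor_sign E (I \<union> (Z - S)) = minor_sign E I + minor_sign E (Z - S)"
      using minor_sign_Un_right[OF I(3) finE(4) disj] .
    moreover have "minor_sign E I = minor_sign (E - Z) I + minor_sign (Z - S) I + minor_sign S I"
    proof -
      have "E = (E - Z) \<union> ((Z - S) \<union> S)" using SZ by auto
      then have "minor_sign E I = minor_sign ((E - Z) \<union> ((Z - S) \<union> S)) I" by simp
      also have "\<dots> = minor_sign (E - Z) I + minor_sign ((Z - S) \<union> S) I"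
        using finE SZ by (intro minor_sign_Un_left) auto
      also have "minor_sign ((Z - S) \<union> S) I = minor_sign (Z - S) I + minor_sign S I"
        using finE by (intro minor_sign_Un_left) auto
      finally show ?thesis by simp
    qed
    ultimately have "even (dual_exp (E - Z) I + minor_sign S (E - Z - I) +
        (?e + (minor_sign (Z - S) I + dual_exp E (I \<union> (Z - S)))))"
      unfolding dual_exp_def card_un q by (simp only: even_add) blast
    note par = sg_parity[OF this]
    have "dual_pv F (E - Z) (restr F Z S P) I =
        mul F (sg (dual_exp (E - Z) I + minor_sign S (E - Z - I))) (map_option (invol F) (P (E - Z - I \<union> S)))"
      using True sets elt by (simp add: dual_pv_eq[OF finE(1)] restr_def map_option_invol_mul invol_sg sg_sg)
    also have "\<dots> = scale F (neg_one F [^] ?e) (restr F Z (Z - S) (dual_pv F E P)) I"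
      using I sets elt par by (simp add: dual_pv_eq[OF fin] restr_def scale_neg_one_pow sg_sg)
    finally show ?thesis .
  qed
  then show ?thesis by blast
qed

text \<open>The dual weight of a set for -v is the weight of its complement for v plus the sum of v
  over \<open>E\<close>, so complementation matches the lightest bases.\<close>

lemma dual_pv_initial:
  fixes E :: "'e::linorder set" and P :: "'e set \<Rightarrow> ('f \<times> 'g::linordered_ab_group_add) option"
  assumes fin: "finite E" and P: "pluecker k (trop_ext F) E r P"
  shows "dual_pv F E (initial_pv E r v P) =
    initial_pv E (card E - r) (\<lambda>i. - v i) (dual_pv (trop_ext F) E P)"
proof
  fix B
  interpret T: tract "trop_ext F :: ('f \<times> 'g) tract" by (rule tract_trop_ext)
  have pv: "pv_function (trop_ext F) E r P" using P by (rule T.pluecker_imp_pv)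
  let ?D = "dual_pv (trop_ext F) E P"
  have pvD: "pv_function (trop_ext F) E (card E - r) ?D"
    using T.pluecker_dual[OF fin P] by (rule T.pluecker_imp_pv)
  define w where "w A = snd (the (P A)) + sum (\<lambda>i. - v i) A" for A
  define w' where "w' A = snd (the (?D A)) + sum (\<lambda>i. - (- v i)) A" for A
  have D: "?D A \<noteq> None \<longleftrightarrow> A \<subseteq> E \<and> P (E - A) \<noteq> None" for A
    by (rule T.dual_pv_eq_None[OF fin])
  have snd_D: "snd (the (?D A)) = snd (the (P (E - A)))" if "?D A \<noteq> None" for A
    using that unfolding D
    by (cases "P (E - A)") (auto simp: T.dual_pv_eq[OF fin] neg_one_pow_trop)
  have w': "w' A = w (E - A) + sum v E" if A: "?D A \<noteq> None" for A
  proof -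
    have "sum v E = sum v A + sum v (E - A)"
      using A fin unfolding D by (metis sum.subset_diff add.commute)
    then show ?thesis using snd_D[OF A] by (simp add: w_def w'_def sum_negf)
  qed
  have theta_D: "theta (?D B) = mul F (sg (dual_exp E B)) (map_option (invol F) (theta (P (E - B))))"
    if "B \<subseteq> E"
    using that
    by (cases "P (E - B)") (auto simp: T.dual_pv_eq[OF fin] theta_def
        theta_mul[unfolded theta_def] theta_neg_one_pow[unfolded theta_def])
  have in1: "initial_pv E r v P A =
      (if P A \<noteq> None \<and> (\<forall>C. P C \<noteq> None \<longrightarrow> w A \<le> w C) then theta (P A) else None)" for A
    unfolding w_def by (rule initial_pv_eq[OF pv])
  have in2: "initial_pv E (card E - r) (\<lambda>i. - v i) ?D B =
      (if ?D B \<noteq> None \<and> (\<forall>C. ?D C \<noteq> None \<longrightarrow> w' B \<le> w' C) then theta (?D B) else None)"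
    unfolding w'_def by (rule initial_pv_eq[OF pvD])
  show "dual_pv F E (initial_pv E r v P) B = initial_pv E (card E - r) (\<lambda>i. - v i) ?D B"
  proof (cases "?D B = None")
    case True
    then have "\<not> (B \<subseteq> E \<and> P (E - B) \<noteq> None)" using D by blast
    then show ?thesis using True unfolding in2 by (auto simp: dual_pv_eq[OF fin] in1)
  next
    case False
    then have B: "B \<subseteq> E" "P (E - B) \<noteq> None" using D by auto
    have "(\<forall>C. ?D C \<noteq> None \<longrightarrow> w' B \<le> w' C) \<longleftrightarrow> (\<forall>C. P C \<noteq> None \<longrightarrow> w (E - B) \<le> w C)"
    proof (intro iffI allI impI)
      fix C assume *: "\<forall>C. ?D C \<noteq> None \<longrightarrow> w' B \<le> w' C" and C: "P C \<noteq> None"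
      then have "E - (E - C) = C" using T.pv_basis[OF pv C] by blast
      then have "?D (E - C) \<noteq> None" "w (E - (E - C)) = w C" using C D by auto
      then show "w (E - B) \<le> w C" using * w'[OF False] w'[of "E - C"] by fastforce
    next
      fix C assume *: "\<forall>C. P C \<noteq> None \<longrightarrow> w (E - B) \<le> w C" and C: "?D C \<noteq> None"
      then show "w' B \<le> w' C" using w'[OF False] w'[OF C] D by auto
    qed
    then show ?thesis
      using False B theta_D unfolding in2 by (auto simp: dual_pv_eq[OF fin] in1)
  qed
qed

end

section \<open>Contraction and coloops\<close>

text \<open>A vector whose support is contained in one avoiding \<open>Z\<close> avoids
  \<open>Z\<close> as well, so minimality in \<open>A\<close> and minimality in \<open>D\<close>
  coincide for such vectors.\<close>

lemma min_supp_avoiding: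
  assumes "\<And>X. \<lbrakk>supp X \<noteq> {}; supp X \<inter> Z = {}\<rbrakk> \<Longrightarrow> X \<in> A \<longleftrightarrow> X \<in> D"
    and "\<And>X. X \<in> D \<Longrightarrow> supp X \<inter> Z = {}"
  shows "{X \<in> min_supp A. supp X \<inter> Z = {}} = min_supp D"
proof (intro equalityI subsetI)
  fix X assume "X \<in> {X \<in> min_supp A. supp X \<inter> Z = {}}"
  then have X: "X \<in> A" "supp X \<noteq> {}" "supp X \<inter> Z = {}"
    and min: "\<And>Y. Y \<in> A \<Longrightarrow> supp Y \<noteq> {} \<Longrightarrow> \<not> supp Y \<subset> supp X" by (auto simp: min_supp_def)
  have "\<not> supp Y \<subset> supp X" if "Y \<in> D" "supp Y \<noteq> {}" for Y
    using min[of Y] assms(1)[of Y] assms(2)[of Y] that by blast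
  then show "X \<in> min_supp D" using X assms(1) by (auto simp: min_supp_def)
next
  fix X assume "X \<in> min_supp D"
  then have X: "X \<in> D" "supp X \<noteq> {}"
    and min: "\<And>Y. Y \<in> D \<Longrightarrow> supp Y \<noteq> {} \<Longrightarrow> \<not> supp Y \<subset> supp X" by (auto simp: min_supp_def)
  have XZ: "supp X \<inter> Z = {}" using assms(2) X by blast
  have "\<not> supp Y \<subset> supp X" if Y: "Y \<in> A" "supp Y \<noteq> {}" for Y
  proof
    assume sub: "supp Y \<subset> supp X"
    then have "supp Y \<inter> Z = {}" using XZ by blast
    then show False using min[of Y] assms(1)[of Y] Y sub by blast
  qed
  then show "X \<in> {X \<in> min_supp A. supp X \<inter> Z = {}}"
    using X XZ assms(1) by (auto simp: min_supp_def)
qed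

text \<open>The sum of v over \<tau> - i falls short of the sum over \<tau> by v i. For v = -u this
  is the comparison of the |C_i| + u_i.\<close>

lemma (in valuated) initial_coords_shift:
  fixes v :: "'e \<Rightarrow> 'g"
  assumes "finite \<tau>"
  shows "valuated.initial_coords P (\<lambda>S. w S + sum v S) \<tau> = {i \<in> \<tau>. P (\<tau> - {i}) \<noteq> None \<and>
    (\<forall>k\<in>\<tau>. P (\<tau> - {k}) \<noteq> None \<longrightarrow> w (\<tau> - {i}) - v i \<le> w (\<tau> - {k}) - v k)}"
proof -
  interpret V: valuated F E r P "\<lambda>S. w S + sum v S" by (rule valuated_shift)
  have "w (\<tau> - {i}) + sum v (\<tau> - {i}) \<le> w (\<tau> - {k}) + sum v (\<tau> - {k}) \<longleftrightarrow>
      w (\<tau> - {i}) - v i \<le> w (\<tau> - {k}) - v k" if "i \<in> \<tau>" "k \<in> \<tau>" for i k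
  proof -
    have "w (\<tau> - {j}) + sum v (\<tau> - {j}) = sum v \<tau> + (w (\<tau> - {j}) - v j)" if "j \<in> \<tau>" for j
      using assms that by (simp add: sum_diff1)
    then show ?thesis using that by simp
  qed
  then show ?thesis unfolding V.initial_coords_def by auto
qed

context tract
begin

lemma circuits_eq:
  assumes "pvs M = scaling_class F P" "\<And>I. elt F (P I)"
  shows "circuits F M = circ F (ground M) (rk M) P"
proof (intro equalityI subsetI)
  fix X assume "X \<in> circuits F M"
  then obtain c d \<tau> where X: "X = scale F c (circuit_vector F (scale F d P) \<tau>)" "c \<in> carrier F"
    "d \<in> carrier F" "\<tau> \<subseteq> ground M" "card \<tau> = rk M + 1" "supp (circuit_vector F (scale F d P) \<tau>) \<noteq> {}"
    unfolding circuits_def assms(1) scaling_class_def by blast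
  then have "X \<in> circ F (ground M) (rk M) (scale F d P)" by (intro circI)
  then show "X \<in> circ F (ground M) (rk M) P" using circ_scale[of P, OF assms(2) X(3)] by simp
next
  fix X assume "X \<in> circ F (ground M) (rk M) P"
  moreover have "P \<in> pvs M"
    unfolding assms(1) scaling_class_def using assms(2) by (intro CollectI exI[of _ \<one>]) simp
  ultimately show "X \<in> circuits F M" unfolding circuits_def circ_def by blast
qed

lemma scaling_class_scale:
  assumes "\<And>I. elt F (P I)" "c \<in> carrier F"
  shows "scaling_class F (scale F c P) = scaling_class F P"
proof (intro equalityI subsetI)
  fix Q assume "Q \<in> scaling_class F (scale F c P)"
  then obtain d where "d \<in> carrier F" "Q = scale F d (scale F c P)" by (auto simp: scaling_class_def)
  then have "Q = scale F (d \<otimes> c) P" "d \<otimes> c \<in> carrier F" using assms scale_scale[of P d c] by auto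
  then show "Q \<in> scaling_class F P" by (auto simp: scaling_class_def)
next
  fix Q assume "Q \<in> scaling_class F P"
  then obtain d where "d \<in> carrier F" "Q = scale F d P" by (auto simp: scaling_class_def)
  then have "Q = scale F (d \<otimes> inv c) (scale F c P)" "d \<otimes> inv c \<in> carrier F"
    using assms scale_scale[of P "d \<otimes> inv c" c] by (auto simp: m_assoc)
  then show "Q \<in> scaling_class F (scale F c P)" by (auto simp: scaling_class_def)
qed

lemma is_fmatroidD:
  assumes "is_fmatroid k F M"
  obtains P where "M = \<lparr>ground = ground M, rk = rk M, pvs = scaling_class F P\<rparr>"
    "pluecker k F (ground M) (rk M) P" "finite (ground M)" "rk M \<le> card (ground M)"
  using assms unfolding is_fmatroid_def by (metis fmatroid.surjective old.unit.exhaust)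

lemma is_fmatroidI:
  assumes "finite E" "pluecker k F E r P"
  shows "is_fmatroid k F \<lparr>ground = E, rk = r, pvs = scaling_class F P\<rparr>"
proof -
  have pv: "pv_function F E r P" using assms(2) by (rule pluecker_imp_pv)
  then obtain B where "P B \<noteq> None" by (auto simp: pv_function_def)
  then have "r \<le> card E" using pv_basis[OF pv] card_mono[OF assms(1)] by metis
  then show ?thesis using assms by (auto simp: is_fmatroid_def)
qed

lemma circuits_mk:
  assumes "pluecker k F E r P"
  shows "circuits F \<lparr>ground = E, rk = r, pvs = scaling_class F P\<rparr> = circ F E r P"
  using circuits_eq[of "\<lparr>ground = E, rk = r, pvs = scaling_class F P\<rparr>" P]
    pv_elt[OF pluecker_imp_pv[OF assms]] by simp

text \<open>The uniqueness half of the definite descriptions in \<open>contract\<close> and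
  \<open>add_coloops\<close>.\<close>

lemma fmatroid_eqI:
  fixes M N :: "('e::linorder, 'f) fmatroid"
  assumes "is_fmatroid k F M" "is_fmatroid k F N" "ground M = ground N" "circuits F M = circuits F N"
  shows "M = N"
proof -
  obtain P where P: "M = \<lparr>ground = ground M, rk = rk M, pvs = scaling_class F P\<rparr>"
    "pluecker k F (ground M) (rk M) P" "finite (ground M)" using assms(1) by (rule is_fmatroidD)
  obtain Q where Q: "N = \<lparr>ground = ground N, rk = rk N, pvs = scaling_class F Q\<rparr>"
    "pluecker k F (ground N) (rk N) Q" "finite (ground N)" using assms(2) by (rule is_fmatroidD)
  have "circ F (ground N) (rk M) P = circ F (ground N) (rk N) Q"
    using circuits_mk[OF P(2)] circuits_mk[OF Q(2)] P(1) Q(1) assms(3,4) by metis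
  from circ_determines_pv[OF _ valuated_of_pluecker[OF Q(3,2)] this]
  have "rk M = rk N" "\<exists>c\<in>carrier F. P = scale F c Q"
    using valuated_of_pluecker[OF P(3,2)] assms(3) by auto
  then have "scaling_class F P = scaling_class F Q"
    using scaling_class_scale pv_elt[OF pluecker_imp_pv[OF Q(2)]] by metis
  then show ?thesis using P(1) Q(1) assms(3) \<open>rk M = rk N\<close> by simp
qed

text \<open>\<open>dual\<close> and \<open>initial_fin\<close> unite scaling classes over all
  representatives; when scaling a representative only scales the result, one representative is
  enough.\<close>

lemma union_scaling_classes:
  fixes F' :: "'h tract"
  assumes "tract F'" "\<And>I. elt F' (P I)" "\<And>I. elt F (f P I)"
    and "\<And>c. c \<in> carrier F' \<Longrightarrow> \<exists>d\<in>carrier F. f (scale F' c P) = scale F d (f P)"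
  shows "(\<Union>Q\<in>scaling_class F' P. scaling_class F (f Q)) = scaling_class F (f P)"
proof -
  interpret F': tract F' by fact
  have "P = scale F' \<one>\<^bsub>F'\<^esub> P" using assms(2) by simp
  then have "P \<in> scaling_class F' P" unfolding scaling_class_def using F'.one_closed by blast
  moreover have "scaling_class F (f Q) = scaling_class F (f P)" if Q: "Q \<in> scaling_class F' P" for Q
  proof -
    obtain c where "c \<in> carrier F'" "Q = scale F' c P" using Q by (auto simp: scaling_class_def)
    then obtain d where "d \<in> carrier F" "f Q = scale F d (f P)" using assms(4) by blast
    then show ?thesis using scaling_class_scale[of "f P" d] assms(3) by simp
  qed
  ultimately show ?thesis by blast
qed

lemma dual_mk:
  fixes E :: "'e::linorder set"
  assumes "finite E" "pluecker k F E r P"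
  shows "dual F \<lparr>ground = E, rk = r, pvs = scaling_class F P\<rparr> =
    \<lparr>ground = E, rk = card E - r, pvs = scaling_class F (dual_pv F E P)\<rparr>"
proof -
  have elt: "elt F (P I)" "elt F (dual_pv F E P I)" for I
    using pv_elt[OF pluecker_imp_pv] assms(2) pluecker_dual[OF assms] by blast+
  have "(\<Union>Q\<in>scaling_class F P. scaling_class F (dual_pv F E Q)) = scaling_class F (dual_pv F E P)"
  proof (rule union_scaling_classes[where P = P and f = "dual_pv F E", OF tract_axioms elt])
    fix c assume "c \<in> carrier F"
    then show "\<exists>d\<in>carrier F. dual_pv F E (scale F c P) = scale F d (dual_pv F E P)"
      by (intro bexI[of _ "invol F c"] dual_pv_scale[OF assms(1) elt(1)]) simp_all
  qed
  then show ?thesis by (simp add: dual_def)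
qed

lemma elt_initial_pv:
  fixes E :: "'e::linorder set" and P :: "'e set \<Rightarrow> ('f \<times> 'g::linordered_ab_group_add) option"
  assumes "finite E" "pluecker k (trop_ext F) E r P"
  shows "elt F (initial_pv E r v P I)"
  using pv_elt[OF pluecker_imp_pv[OF pluecker_initial[OF assms]]] .

lemma initial_fin_mk:
  fixes E :: "'e::linorder set" and P :: "'e set \<Rightarrow> ('f \<times> 'g::linordered_ab_group_add) option"
  assumes fin: "finite E" and P: "pluecker k (trop_ext F) E r P"
  shows "initial_fin F \<lparr>ground = E, rk = r, pvs = scaling_class (trop_ext F) P\<rparr> v =
    \<lparr>ground = E, rk = r, pvs = scaling_class F (initial_pv E r v P)\<rparr>"
proof -
  interpret T: tract "trop_ext F :: ('f \<times> 'g) tract" by (rule tract_trop_ext)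
  have pv: "pv_function (trop_ext F) E r P" using P by (rule T.pluecker_imp_pv)
  have elt: "elt (trop_ext F) (P I)" for I using T.pv_elt[OF pv] .
  have "(\<Union>Q\<in>scaling_class (trop_ext F) P. scaling_class F (initial_pv E r v Q)) =
      scaling_class F (initial_pv E r v P)"
  proof (rule union_scaling_classes[where P = P and f = "initial_pv E r v",
        OF tract_trop_ext elt elt_initial_pv[OF fin P]])
    fix c :: "'f \<times> 'g" assume c: "c \<in> carrier (trop_ext F)"
    let ?Q = "scale (trop_ext F) c P"
    have Q: "?Q I = None \<longleftrightarrow> P I = None" for I by (simp add: scale_def)
    have "elt (trop_ext F) (?Q I)" for I using elt c by simp
    then have pvQ: "pv_function (trop_ext F) E r ?Q"
      using pv Q T.pv_basis[OF pv] unfolding pv_function_def by (metis elt_Some option.distinct(1))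
    have sndQ: "snd (the (?Q I)) = snd c + snd (the (P I))" if "P I \<noteq> None" for I
      using that by (cases "P I") (auto simp: scale_def)
    have thetaQ: "theta (?Q I) = mul F (Some (fst c)) (theta (P I))" for I
      unfolding scale_def theta_mul by (simp add: theta_def)
    have "initial_pv E r v ?Q = scale F (fst c) (initial_pv E r v P)"
      unfolding fun_eq_iff initial_pv_eq[OF pvQ] initial_pv_eq[OF pv] Q
      using sndQ thetaQ by (auto simp: scale_def add.assoc)
    then show "\<exists>d\<in>carrier F. initial_pv E r v ?Q = scale F d (initial_pv E r v P)"
      using c by auto
  qed
  then show ?thesis by (simp add: initial_fin_def)
qed

text \<open>Contraction as an initial matroid. With weight -1 on \<open>Z\<close> the lightest bases
  are those largest on \<open>Z\<close>, and initial forms of circuits lose their entries in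
  \<open>Z\<close> unless they lie inside \<open>Z\<close>. As all lightest bases meet
  \<open>Z\<close> in \<open>card S\<close> elements, \<open>circ_restr\<close> applies to the
  initial matroid.\<close>

lemma circ_contract:
  fixes E :: "'e::linorder set"
  assumes fin: "finite E" and P: "pluecker k F E r P" and B0: "P B0 \<noteq> None" and S: "S = B0 \<inter> Z"
    and max: "\<And>B. P B \<noteq> None \<Longrightarrow> card (B \<inter> Z) \<le> card S"
  shows "circ F (E - Z) (r - card S) (restr F Z S P) = min_supp {delete C Z | C. C \<in> circ F E r P}"
proof -
  define v :: "'e \<Rightarrow> int" where "v = (\<lambda>i. if i \<in> Z then - 1 else 0)"
  define w :: "'e set \<Rightarrow> int" where "w = (\<lambda>B. 0 + sum v B)"
  interpret P: valuated F E r P "\<lambda>_. 0::int" by (rule valuated_of_pluecker[OF fin P])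
  interpret V: valuated F E r P w unfolding w_def by (rule P.valuated_shift)
  interpret I: valuated F E r V.initial_P "\<lambda>_. 0::int" by (rule V.valuated_initial)
  have w: "w B = - int (card (B \<inter> Z))" if "P B \<noteq> None" for B
    using P.finite_basis[OF that] by (simp add: w_def v_def sum.If_cases)
  have min_basis: "V.min_basis B \<longleftrightarrow> P B \<noteq> None \<and> card (B \<inter> Z) = card S" for B
  proof -
    have "(\<forall>A. P A \<noteq> None \<longrightarrow> w B \<le> w A) \<longleftrightarrow> card (B \<inter> Z) = card S" if "P B \<noteq> None"
      using w max[OF that] max B0 that S by (auto intro!: antisym)
    then show ?thesis by (auto simp: V.min_basis_def)
  qed
  have restr: "restr F Z S V.initial_P = restr F Z S P"
  proof
    fix I
    have "(I \<union> S) \<inter> Z = S" if "I \<inter> Z = {}" using that S by blast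
    then show "restr F Z S V.initial_P I = restr F Z S P I"
      by (auto simp: restr_def V.initial_P_def min_basis)
  qed
  have "V.initial_P B0 \<noteq> None" using B0 S by (simp add: V.initial_P_def min_basis)
  moreover have "card S \<le> card (B \<inter> Z)" if "V.initial_P B \<noteq> None" for B
    using that by (simp add: V.initial_P_def min_basis split: if_splits)
  ultimately have "circ F (E - Z) (r - card S) (restr F Z S P) =
      {X \<in> circ F E r V.initial_P. supp X \<inter> Z = {}}"
    using I.circ_restr[OF _ S] unfolding restr by blast
  also have "\<dots> = min_supp {delete C Z | C. C \<in> circ F E r P}"
    unfolding V.circ_initial
  proof (rule min_supp_avoiding)
    \<comment> \<open>In the entry at i the weight enters as -v i, so entries in \<open>Z\<close>
      are heavier by 1 and disappear as soon as there is an entry outside \<open>Z\<close>.\<close>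
    have coords: "V.initial_coords \<tau> = supp (P.cv \<tau>) - Z"
      if "\<tau> \<subseteq> E" "\<not> supp (P.cv \<tau>) \<subseteq> Z" for \<tau>
    proof -
      have "finite \<tau>" using that fin finite_subset by blast
      from P.initial_coords_shift[OF this, of v, folded w_def] that(2)
      show ?thesis by (auto simp: v_def supp_circuit_vector split: if_splits)
    qed
    have sub: "V.initial_coords \<tau> \<subseteq> supp (P.cv \<tau>)" for \<tau>
      by (auto simp: V.initial_coords_def supp_circuit_vector)
    have delete: "delete (scale F c (P.cv \<tau>)) Z = scale F c (V.initial_cv \<tau>)"
      if "\<tau> \<subseteq> E" "\<not> supp (P.cv \<tau>) \<subseteq> Z" for c \<tau>
      using coords[OF that] by (auto simp: fun_eq_iff delete_def scale_def V.initial_cv_def supp_def)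
    fix X :: "'e \<Rightarrow> 'f option" assume X: "supp X \<noteq> {}" "supp X \<inter> Z = {}"
    show "X \<in> {scale F c (V.initial_cv \<tau>) |c \<tau>. c \<in> carrier F \<and> \<tau> \<subseteq> E \<and> card \<tau> = r + 1} \<longleftrightarrow>
      X \<in> {delete C Z |C. C \<in> circ F E r P}"
    proof
      assume "X \<in> {scale F c (V.initial_cv \<tau>) |c \<tau>. c \<in> carrier F \<and> \<tau> \<subseteq> E \<and> card \<tau> = r + 1}"
      then obtain c \<tau> where c: "X = scale F c (V.initial_cv \<tau>)" "c \<in> carrier F" "\<tau> \<subseteq> E" "card \<tau> = r + 1"
        by blast
      have "supp X \<subseteq> supp (P.cv \<tau>)" using c sub[of \<tau>] by (auto simp: supp_def V.initial_cv_def scale_def split: if_splits)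
      then have nZ: "\<not> supp (P.cv \<tau>) \<subseteq> Z" using X by blast
      then have "X = delete (scale F c (P.cv \<tau>)) Z" using delete[OF c(3)] c by simp
      moreover have "scale F c (P.cv \<tau>) \<in> circ F E r P" using c nZ by (intro circI) auto
      ultimately show "X \<in> {delete C Z |C. C \<in> circ F E r P}" by blast
    next
      assume "X \<in> {delete C Z |C. C \<in> circ F E r P}"
      then obtain C where C: "X = delete C Z" "C \<in> circ F E r P" by blast
      from C(2) obtain c \<tau> where c: "c \<in> carrier F" "\<tau> \<subseteq> E" "card \<tau> = r + 1"
        "C = scale F c (P.cv \<tau>)" by (rule circE)
      have "supp X = supp (P.cv \<tau>) - Z"
        unfolding C(1) c(4) by (auto simp: supp_def delete_def scale_def)
      then have "\<not> supp (P.cv \<tau>) \<subseteq> Z" using X(1) by blast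
      then have "X = scale F c (V.initial_cv \<tau>)" using delete[OF c(2)] C c by simp
      then show "X \<in> {scale F c (V.initial_cv \<tau>) |c \<tau>. c \<in> carrier F \<and> \<tau> \<subseteq> E \<and> card \<tau> = r + 1}"
        using c by blast
    qed
  qed (auto simp: supp_def delete_def)
  finally show ?thesis .
qed

lemma contract_mk:
  fixes E :: "'e::linorder set"
  assumes fin: "finite E" and P: "pluecker k F E r P" and B0: "P B0 \<noteq> None" and S: "S = B0 \<inter> Z"
    and max: "\<And>B. P B \<noteq> None \<Longrightarrow> card (B \<inter> Z) \<le> card S"
  shows "contract k F \<lparr>ground = E, rk = r, pvs = scaling_class F P\<rparr> Z =
    \<lparr>ground = E - Z, rk = r - card S, pvs = scaling_class F (restr F Z S P)\<rparr>" (is "_ = ?N")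
proof -
  have P': "pluecker k F (E - Z) (r - card S) (restr F Z S P)" by (rule pluecker_restr[OF fin P B0 S])
  have N: "is_fmatroid k F ?N" using is_fmatroidI[OF _ P'] fin by simp
  have circ: "circuits F ?N = min_supp {delete C Z | C. C \<in> circ F E r P}"
    using circuits_mk[OF P'] circ_contract[OF fin P B0 S max] by simp
  show ?thesis
    unfolding contract_def circuits_mk[OF P]
  proof (rule the_equality)
    fix N' :: "('e, 'f) fmatroid"
    assume "is_fmatroid k F N' \<and> ground N' = ground \<lparr>ground = E, rk = r, pvs = scaling_class F P\<rparr> - Z \<and>
      circuits F N' = min_supp {delete C Z | C. C \<in> circ F E r P}"
    then show "N' = ?N" using N circ by (intro fmatroid_eqI) auto
  qed (use N circ in simp)
qed

text \<open>A nonzero vector needs Z \<subseteq> \<tau> - i for some i. Its entries on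
  \<open>Z\<close> are zero, so up to sign it is the vector of \<tau> - Z.\<close>

lemma circ_coext:
  fixes E :: "'e::linorder set"
  assumes fin: "finite E" "finite Z" and EZ: "E \<inter> Z = {}" and R: "\<And>I. elt F (R I)"
  shows "circ F (E \<union> Z) (r + card Z) (coext F Z R) = circ F E r R"
proof -
  have elt: "elt F (coext F Z R I)" for I using R by (simp add: coext_def)
  have cv: "circuit_vector F (coext F Z R) \<tau> =
      scale F (neg_one F [^] minor_sign Z (\<tau> - Z)) (circuit_vector F R (\<tau> - Z))"
    if Z: "Z \<subseteq> \<tau>" and "finite \<tau>" for \<tau>
  proof
    fix i
    show "circuit_vector F (coext F Z R) \<tau> i =
      scale F (neg_one F [^] minor_sign Z (\<tau> - Z)) (circuit_vector F R (\<tau> - Z)) i"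
    proof (cases "i \<in> \<tau> - Z")
      case True
      have sets: "Z \<subseteq> \<tau> - {i}" "\<tau> - {i} - Z = \<tau> - Z - {i}" "\<tau> - Z \<union> Z = \<tau>" using Z True by auto
      have "card {j \<in> \<tau>. j < i} = card {j \<in> \<tau> - Z. j < i} + card {j \<in> Z. j < i}"
        using card_less_Un[of "\<tau> - Z" Z i] \<open>finite \<tau>\<close> fin unfolding sets by auto
      moreover have "minor_sign Z (\<tau> - Z) = minor_sign Z (\<tau> - Z - {i}) + card {j \<in> Z. j < i}"
        using True \<open>finite \<tau>\<close> by (intro minor_sign_remove) auto
      ultimately have par: "even (card {j \<in> \<tau>. j < i} + minor_sign Z (\<tau> - Z - {i}) +
          (minor_sign Z (\<tau> - Z) + card {j \<in> \<tau> - Z. j < i}))" by presburger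
      then show ?thesis
        using True DiffD1[OF True] sets R sg_parity[OF par]
        by (simp add: circuit_vector_def coext_def scale_neg_one_pow sg_sg del: Diff_iff)
    qed (auto simp: circuit_vector_def coext_def scale_def)
  qed
  show ?thesis
  proof
    show "circ F (E \<union> Z) (r + card Z) (coext F Z R) \<subseteq> circ F E r R"
    proof (rule circ_subset[of R, OF R])
      fix \<tau> assume \<tau>: "\<tau> \<subseteq> E \<union> Z" "card \<tau> = r + card Z + 1" "supp (circuit_vector F (coext F Z R) \<tau>) \<noteq> {}"
      then have fin\<tau>: "finite \<tau>" using fin finite_subset by blast
      obtain i where "coext F Z R (\<tau> - {i}) \<noteq> None" using \<tau>(3) by (auto simp: supp_circuit_vector)
      then have Z: "Z \<subseteq> \<tau>" by (auto simp: coext_def split: if_splits)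
      have "card (\<tau> - Z) = r + 1" using \<tau> Z fin by (simp add: card_Diff_subset)
      then show "circuit_vector F (coext F Z R) \<tau> \<in> circ F E r R"
        using \<tau> cv[OF Z fin\<tau>] by (intro circI[of _ "\<tau> - Z"]) auto
    qed
    show "circ F E r R \<subseteq> circ F (E \<union> Z) (r + card Z) (coext F Z R)"
    proof (rule circ_subset[of "coext F Z R", OF elt])
      fix \<tau> assume \<tau>: "\<tau> \<subseteq> E" "card \<tau> = r + 1" "supp (circuit_vector F R \<tau>) \<noteq> {}"
      then have fin\<tau>: "finite \<tau>" using fin finite_subset by blast
      have sets: "\<tau> \<union> Z - Z = \<tau>" "\<tau> \<inter> Z = {}" using \<tau> EZ by auto
      let ?s = "neg_one F [^] minor_sign Z \<tau>"
      have eq: "circuit_vector F (coext F Z R) (\<tau> \<union> Z) = scale F ?s (circuit_vector F R \<tau>)"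
        using cv[of "\<tau> \<union> Z"] fin\<tau> fin sets by simp
      show "circuit_vector F R \<tau> \<in> circ F (E \<union> Z) (r + card Z) (coext F Z R)"
      proof (rule circI)
        show "card (\<tau> \<union> Z) = r + card Z + 1" using \<tau> fin\<tau> fin sets by (simp add: card_Un_disjoint)
        show "circuit_vector F R \<tau> = scale F (inv ?s) (circuit_vector F (coext F Z R) (\<tau> \<union> Z))"
          unfolding eq using R by (simp add: scale_scale)
      qed (use \<tau> eq in auto)
    qed
  qed
qed

lemma add_coloops_mk:
  fixes E :: "'e::linorder set"
  assumes fin: "finite E" "finite Z" and EZ: "E \<inter> Z = {}" and R: "pluecker k F E r R"
  shows "add_coloops k F \<lparr>ground = E, rk = r, pvs = scaling_class F R\<rparr> Z =
    \<lparr>ground = E \<union> Z, rk = r + card Z, pvs = scaling_class F (coext F Z R)\<rparr>" (is "_ = ?N")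
proof -
  have R': "pluecker k F (E \<union> Z) (r + card Z) (coext F Z R)" by (rule pluecker_coext[OF fin EZ R])
  have N: "is_fmatroid k F ?N" using is_fmatroidI[OF _ R'] fin by simp
  have circ: "circuits F ?N = circ F E r R"
    using circuits_mk[OF R'] circ_coext[OF fin EZ pv_elt[OF pluecker_imp_pv[OF R]]] by simp
  show ?thesis
    unfolding add_coloops_def circuits_mk[OF R]
  proof (rule the_equality)
    fix N' :: "('e, 'f) fmatroid"
    assume "is_fmatroid k F N' \<and> ground N' = ground \<lparr>ground = E, rk = r, pvs = scaling_class F R\<rparr> \<union> Z \<and>
      circuits F N' = circ F E r R"
    then show "N' = ?N" using N circ by (intro fmatroid_eqI) auto
  qed (use N circ in simp)
qed

end

section \<open>Infinite weights\<close>

lemma initial_vec_eq: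
  fixes C :: "'e \<Rightarrow> ('f \<times> 'g::linordered_ab_group_add) option"
  shows "initial_vec E u C i =
    (if i \<in> E \<and> C i \<noteq> None \<and> u i \<noteq> Infty \<and>
       (\<forall>j\<in>E. C j \<noteq> None \<longrightarrow> u j \<noteq> Infty \<longrightarrow>
          snd (the (C i)) + fin (u i) \<le> snd (the (C j)) + fin (u j))
     then theta (C i) else None)"
proof -
  have val: "val (C j) + u j =
      (if C j = None \<or> u j = Infty then Infty else Fin (snd (the (C j)) + fin (u j)))" for j
    by (cases "C j"; cases "u j") (auto simp: val_def)
  have le: "x \<le> Infty" for x :: "'g ext" by (cases x) auto
  show ?thesis using le unfolding initial_vec_def val by auto
qed

text \<open>The tropical weight \<open>u = \<infinity>\<close> on \<open>Z\<close> is the first component \<open>-1\<close> in the lexicographic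
  product \<open>\<int> \<times> \<Gamma>\<close>; the first component decides which bases are as large as possible on \<open>Z\<close>.\<close>

definition lex_weight :: "('e \<Rightarrow> 'g::linordered_ab_group_add ext) \<Rightarrow> 'e \<Rightarrow> int \<times> 'g" where
  "lex_weight u i = (if u i = Infty then (- 1, 0) else (0, - fin (u i)))"

definition lex_pv_weight ::
    "('e \<Rightarrow> 'g::linordered_ab_group_add ext) \<Rightarrow> ('e set \<Rightarrow> ('f \<times> 'g) option) \<Rightarrow> 'e set \<Rightarrow> int \<times> 'g" where
  "lex_pv_weight u P B = (0, snd (the (P B))) + sum (lex_weight u) B"

lemma fst_lex_pv_weight:
  "finite B \<Longrightarrow> fst (lex_pv_weight u P B) = - int (card {i \<in> B. u i = Infty})"
  by (induction B rule: finite_induct)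
    (auto simp: lex_pv_weight_def lex_weight_def fst_sum sum.If_cases Int_def)

lemma snd_lex_pv_weight:
  "snd (lex_pv_weight u P B) = snd (the (P B)) + (\<Sum>i\<in>B. if u i = Infty then 0 else - fin (u i))"
  by (auto simp: lex_pv_weight_def lex_weight_def snd_sum intro!: sum.cong)

context tract
begin

lemma valuated_lex:
  fixes E :: "'e::linorder set" and P :: "'e set \<Rightarrow> ('f \<times> 'g::linordered_ab_group_add) option"
  assumes "finite E" "pluecker k (trop_ext F) E r P"
  shows "valuated F E r (\<lambda>B. theta (P B)) (lex_pv_weight u P)"
  unfolding lex_pv_weight_def[abs_def]
  by (rule valuated.valuated_shift[OF valuated.valuated_embed[OF valuated_of_trop_pluecker[OF assms]]])

text \<open>If C_\<tau> has an entry at some k with finite u k, the entries of infinite u are too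
  heavy in the first component, and the initial form is C^u. Otherwise the initial form lies inside
  the infinite part while C^u is zero. So both families have the same nonzero members avoiding that
  part.\<close>

lemma circ_lex_initial:
  fixes E :: "'e::linorder set" and P :: "'e set \<Rightarrow> ('f \<times> 'g::linordered_ab_group_add) option"
  assumes fin: "finite E" and P: "pluecker k (trop_ext F) E r P"
  shows "{X \<in> circ F E r (valuated.initial_P (\<lambda>B. theta (P B)) (lex_pv_weight u P)).
      supp X \<inter> infty_set E u = {}} =
    min_supp {initial_vec E u C | C. C \<in> circ (trop_ext F) E r P}"
proof -
  interpret T: tract "trop_ext F :: ('f \<times> 'g) tract" by (rule tract_trop_ext)
  have pv: "pv_function (trop_ext F) E r P" using P by (rule T.pluecker_imp_pv)
  let ?P = "\<lambda>B. theta (P B)" and ?Z = "infty_set E u"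
  interpret P: valuated F E r ?P "\<lambda>B. (0::int, snd (the (P B)))"
    by (rule valuated.valuated_embed[OF valuated_of_trop_pluecker[OF fin P]])
  interpret V: valuated F E r ?P "lex_pv_weight u P" by (rule valuated_lex[OF fin P])
  let ?cv = "circuit_vector (trop_ext F) P"
  have lex: "lex_pv_weight u P = (\<lambda>B. (0, snd (the (P B))) + sum (lex_weight u) B)"
    by (simp add: fun_eq_iff lex_pv_weight_def)
  have theta_cv: "theta (?cv \<tau> i) = V.cv \<tau> i" for \<tau> i
    unfolding circuit_vector_def by (simp add: theta_mul theta_neg_one_pow)
  have cv_None: "?cv \<tau> i = None \<longleftrightarrow> i \<notin> \<tau> \<or> P (\<tau> - {i}) = None" for \<tau> i
    by (simp add: circuit_vector_def)
  have snd_cv: "snd (the (?cv \<tau> i)) = snd (the (P (\<tau> - {i})))" if "i \<in> \<tau>" "P (\<tau> - {i}) \<noteq> None" for \<tau> i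
    using that by (cases "P (\<tau> - {i})") (auto simp: circuit_vector_def neg_one_pow_trop)
  have initial: "initial_vec E u (scale (trop_ext F) c (?cv \<tau>)) i =
      (if i \<in> \<tau> \<and> P (\<tau> - {i}) \<noteq> None \<and> u i \<noteq> Infty \<and>
         (\<forall>k\<in>\<tau>. P (\<tau> - {k}) \<noteq> None \<longrightarrow> u k \<noteq> Infty \<longrightarrow>
           snd (the (P (\<tau> - {i}))) + fin (u i) \<le> snd (the (P (\<tau> - {k}))) + fin (u k))
       then scale F (fst c) (V.cv \<tau>) i else None)" if "\<tau> \<subseteq> E" for c \<tau> i
  proof -
    let ?C = "scale (trop_ext F) c (?cv \<tau>)"
    have C: "?C i = None \<longleftrightarrow> i \<notin> \<tau> \<or> P (\<tau> - {i}) = None" for i by (simp add: scale_def cv_None)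
    have snd_C: "snd (the (?C i)) = snd c + snd (the (P (\<tau> - {i})))" if "i \<in> \<tau>" "P (\<tau> - {i}) \<noteq> None" for i
      using snd_cv[OF that] cv_None[of \<tau> i] that
      by (cases "?cv \<tau> i") (auto simp: scale_def)
    have theta_C: "theta (?C i) = scale F (fst c) (V.cv \<tau>) i" for i
      unfolding scale_def theta_mul theta_cv by (simp add: theta_def)
    show ?thesis
      unfolding initial_vec_eq C theta_C using that snd_C by (auto simp: add.assoc)
  qed
  have coords: "V.initial_coords \<tau> = {i \<in> \<tau>. P (\<tau> - {i}) \<noteq> None \<and> u i \<noteq> Infty \<and>
         (\<forall>k\<in>\<tau>. P (\<tau> - {k}) \<noteq> None \<longrightarrow> u k \<noteq> Infty \<longrightarrow>
           snd (the (P (\<tau> - {i}))) + fin (u i) \<le> snd (the (P (\<tau> - {k}))) + fin (u k))}"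
    if \<tau>: "\<tau> \<subseteq> E" and k: "k \<in> \<tau>" "P (\<tau> - {k}) \<noteq> None" "u k \<noteq> Infty" for \<tau> k
  proof -
    have "finite \<tau>" using \<tau> fin finite_subset by blast
    note shift = P.initial_coords_shift[OF this, of "lex_weight u", folded lex]
    have le: "(0, snd (the (P (\<tau> - {i})))) - lex_weight u i \<le> (0, snd (the (P (\<tau> - {j})))) - lex_weight u j \<longleftrightarrow>
      (if u i = Infty then u j = Infty \<and> snd (the (P (\<tau> - {i}))) \<le> snd (the (P (\<tau> - {j})))
       else u j = Infty \<or> snd (the (P (\<tau> - {i}))) + fin (u i) \<le> snd (the (P (\<tau> - {j}))) + fin (u j))" for i j
      by (auto simp: lex_weight_def less_eq_prod_def)
    show ?thesis unfolding shift le using k by auto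
  qed
  have coords_infty: "V.initial_coords \<tau> \<subseteq> ?Z"
    if \<tau>: "\<tau> \<subseteq> E" and k: "\<And>k. k \<in> \<tau> \<Longrightarrow> P (\<tau> - {k}) \<noteq> None \<Longrightarrow> u k = Infty" for \<tau>
    using that by (auto simp: V.initial_coords_def infty_set_def)
  have initial': "initial_vec E u (scale (trop_ext F) c (?cv \<tau>)) = scale F (fst c) (V.initial_cv \<tau>)"
    if "\<tau> \<subseteq> E" "k \<in> \<tau>" "P (\<tau> - {k}) \<noteq> None" "u k \<noteq> Infty" for c \<tau> k
    unfolding fun_eq_iff initial[OF that(1)] V.initial_cv_def coords[OF that] by (auto simp: scale_def)
  show ?thesis
    unfolding V.circ_initial
  proof (rule min_supp_avoiding)
    fix X :: "'e \<Rightarrow> 'f option" assume X: "supp X \<noteq> {}" "supp X \<inter> ?Z = {}"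
    show "X \<in> {scale F c (V.initial_cv \<tau>) |c \<tau>. c \<in> carrier F \<and> \<tau> \<subseteq> E \<and> card \<tau> = r + 1} \<longleftrightarrow>
      X \<in> {initial_vec E u C |C. C \<in> circ (trop_ext F) E r P}"
    proof
      assume "X \<in> {scale F c (V.initial_cv \<tau>) |c \<tau>. c \<in> carrier F \<and> \<tau> \<subseteq> E \<and> card \<tau> = r + 1}"
      then obtain c \<tau> where c: "X = scale F c (V.initial_cv \<tau>)" "c \<in> carrier F" "\<tau> \<subseteq> E" "card \<tau> = r + 1"
        by blast
      have "supp X \<subseteq> V.initial_coords \<tau>"
        unfolding c(1) supp_scale by (auto simp: supp_def V.initial_cv_def)
      then have "\<not> V.initial_coords \<tau> \<subseteq> ?Z" using X by blast
      then obtain k where k: "k \<in> \<tau>" "P (\<tau> - {k}) \<noteq> None" "u k \<noteq> Infty"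
        using coords_infty[OF c(3)] by blast
      \<comment> \<open>A scalar of \<open>F\<close> is lifted with valuation 0; the valuation of a
        scalar does not influence the initial form.\<close>
      have "X = initial_vec E u (scale (trop_ext F) (c, 0) (?cv \<tau>))"
        using initial'[OF c(3) k, of "(c, 0)"] c(1) by simp
      moreover have "k \<in> supp (?cv \<tau>)" using k by (simp add: supp_circuit_vector)
      then have "scale (trop_ext F) (c, 0) (?cv \<tau>) \<in> circ (trop_ext F) E r P"
        using c by (intro T.circI[of "(c, 0)" \<tau>]) auto
      ultimately show "X \<in> {initial_vec E u C |C. C \<in> circ (trop_ext F) E r P}" by blast
    next
      assume "X \<in> {initial_vec E u C |C. C \<in> circ (trop_ext F) E r P}"
      then obtain C where C: "X = initial_vec E u C" "C \<in> circ (trop_ext F) E r P" by blast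
      from C(2) obtain c \<tau> where c: "c \<in> carrier (trop_ext F)" "\<tau> \<subseteq> E" "card \<tau> = r + 1"
        "C = scale (trop_ext F) c (?cv \<tau>)" by (rule T.circE)
      obtain k where "X k \<noteq> None" using X(1) by (auto simp: supp_def)
      then have "k \<in> \<tau>" "P (\<tau> - {k}) \<noteq> None" "u k \<noteq> Infty"
        unfolding C(1) c(4) initial[OF c(2)] by (auto split: if_splits)
      then have "X = scale F (fst c) (V.initial_cv \<tau>)" using initial'[OF c(2)] C(1) c(4) by simp
      then show "X \<in> {scale F c (V.initial_cv \<tau>) |c \<tau>. c \<in> carrier F \<and> \<tau> \<subseteq> E \<and> card \<tau> = r + 1}"
        using c(1-3) by (intro CollectI exI[of _ "fst c"] exI[of _ \<tau>]) auto
    qed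
  next
    fix X assume "X \<in> {initial_vec E u C |C. C \<in> circ (trop_ext F) E r P}"
    then show "supp X \<inter> ?Z = {}"
      by (auto simp: supp_def initial_vec_eq infty_set_def)
  qed
qed

text \<open>With all weights finite the first component is 0 throughout, so the lexicographic
  initial vector is \<open>initial_pv\<close>, and there is nothing to avoid.\<close>

lemma circ_initial_pv:
  fixes E :: "'e::linorder set" and P :: "'e set \<Rightarrow> ('f \<times> 'g::linordered_ab_group_add) option"
  assumes fin: "finite E" and P: "pluecker k (trop_ext F) E r P"
  shows "circ F E r (initial_pv E r v P) =
    min_supp {initial_vec E (\<lambda>i. Fin (v i)) C | C. C \<in> circ (trop_ext F) E r P}"
proof -
  interpret T: tract "trop_ext F :: ('f \<times> 'g) tract" by (rule tract_trop_ext)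
  let ?u = "\<lambda>i. Fin (v i)"
  interpret V: valuated F E r "\<lambda>B. theta (P B)" "lex_pv_weight ?u P" by (rule valuated_lex[OF fin P])
  have "lex_pv_weight ?u P B = (0, snd (the (P B)) + sum (\<lambda>i. - v i) B)" for B
    by (simp add: prod_eq_iff snd_lex_pv_weight) (simp add: lex_pv_weight_def lex_weight_def fst_sum)
  then have "V.initial_P = initial_pv E r v P"
    by (auto simp: fun_eq_iff initial_pv_eq[OF T.pluecker_imp_pv[OF P]] V.initial_P_def
        V.min_basis_def less_eq_prod_def)
  then show ?thesis
    using circ_lex_initial[OF fin P, of ?u] by (simp add: infty_set_def)
qed

lemma circ_dual_initial_pv:
  fixes E :: "'e::linorder set" and P :: "'e set \<Rightarrow> ('f \<times> 'g::linordered_ab_group_add) option"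
  assumes fin: "finite E" and P: "pluecker k (trop_ext F) E r P"
  shows "circ F E (card E - r) (dual_pv F E (initial_pv E r v P)) =
    min_supp {initial_vec E (\<lambda>i. Fin (- v i)) D | D.
      D \<in> circ (trop_ext F) E (card E - r) (dual_pv (trop_ext F) E P)}"
  unfolding dual_pv_initial[OF fin P]
  by (rule circ_initial_pv[OF fin tract.pluecker_dual[OF tract_trop_ext fin P]])

text \<open>On the bases I \<union> S the first component is constant and \<open>S\<close>
  contributes nothing to the second, so the lexicographic weight reduces to the finite weight of I
  in the contraction. \<open>S\<close> is taken from a lexicographically lightest basis: for another
  choice of the same size the restriction of the initial vector may vanish.\<close>

lemma initial_restr:
  fixes E :: "'e::linorder set" and P :: "'e set \<Rightarrow> ('f \<times> 'g::linordered_ab_group_add) option"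
  assumes fin: "finite E" and P: "pluecker k (trop_ext F) E r P" and Z: "Z = infty_set E u"
    and B0: "valuated.min_basis (\<lambda>B. theta (P B)) (lex_pv_weight u P) B0" and S: "S = B0 \<inter> Z"
  shows "initial_pv (E - Z) (r - card S) (\<lambda>i. fin (u i)) (restr (trop_ext F) Z S P) =
    restr F Z S (valuated.initial_P (\<lambda>B. theta (P B)) (lex_pv_weight u P))"
    and "\<And>B. P B \<noteq> None \<Longrightarrow> card (B \<inter> Z) \<le> card S"
    and "\<And>B. valuated.min_basis (\<lambda>B. theta (P B)) (lex_pv_weight u P) B \<Longrightarrow> card (B \<inter> Z) = card S"
proof -
  interpret T: tract "trop_ext F :: ('f \<times> 'g) tract" by (rule tract_trop_ext)
  have pv: "pv_function (trop_ext F) E r P" using P by (rule T.pluecker_imp_pv)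
  interpret V: valuated F E r "\<lambda>B. theta (P B)" "lex_pv_weight u P" by (rule valuated_lex[OF fin P])
  let ?w = "lex_pv_weight u P"
  have basis: "B \<subseteq> E" "finite B" if "P B \<noteq> None" for B
    using T.pv_basis[OF pv that] fin finite_subset by auto
  have fst_w: "fst (?w B) = - int (card (B \<inter> Z))" if "P B \<noteq> None" for B
  proof -
    have "{i \<in> B. u i = Infty} = B \<inter> Z" using basis[OF that] Z by (auto simp: infty_set_def)
    then show ?thesis using fst_lex_pv_weight[OF basis(2)[OF that], of u P] by simp
  qed
  have B0': "P B0 \<noteq> None" "\<And>B. P B \<noteq> None \<Longrightarrow> ?w B0 \<le> ?w B"
    using B0 by (auto simp: V.min_basis_def)
  show max: "card (B \<inter> Z) \<le> card S" if "P B \<noteq> None" for B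
    using B0'(2)[OF that] fst_w[OF that] fst_w[OF B0'(1)] S by (auto simp: less_eq_prod_def)
  show "card (B \<inter> Z) = card S" if "V.min_basis B" for B
  proof -
    have "?w B = ?w B0" using that B0 by (auto simp: V.min_basis_def intro!: antisym)
    then show ?thesis using fst_w[of B] fst_w[OF B0'(1)] that S by (simp add: V.min_basis_def)
  qed
  have pvR: "pv_function (trop_ext F) (E - Z) (r - card S) (restr (trop_ext F) Z S P)"
    by (rule T.pluecker_imp_pv[OF T.pluecker_restr[OF fin P B0'(1) S]])
  let ?R = "restr (trop_ext F) Z S P"
  have R: "?R I \<noteq> None \<longleftrightarrow> I \<inter> Z = {} \<and> P (I \<union> S) \<noteq> None" for I by (simp add: restr_def)
  define w1 where "w1 I = snd (the (?R I)) + sum (\<lambda>i. - fin (u i)) I" for I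
  have w1: "?w (I \<union> S) = (- int (card S), w1 I)" if I: "?R I \<noteq> None" for I
  proof (rule prod_eqI)
    have b: "P (I \<union> S) \<noteq> None" and IZ: "I \<inter> Z = {}" using I R by auto
    have "(I \<union> S) \<inter> Z = S" using IZ S by blast
    then show "fst (?w (I \<union> S)) = fst (- int (card S), w1 I)" using fst_w[OF b] by simp
    have "finite I" "finite S" "I \<inter> S = {}" using basis(2)[OF b] IZ S by auto
    then have "(\<Sum>i\<in>I \<union> S. if u i = Infty then 0 else - fin (u i)) =
        (\<Sum>i\<in>I. if u i = Infty then 0 else - fin (u i)) + (\<Sum>i\<in>S. if u i = Infty then 0 else - fin (u i))"
      by (rule sum.union_disjoint)
    also have "(\<Sum>i\<in>I. if u i = Infty then 0 else - fin (u i)) = sum (\<lambda>i. - fin (u i)) I"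
      using basis(1)[OF b] IZ Z by (intro sum.cong) (auto simp: infty_set_def)
    also have "(\<Sum>i\<in>S. if u i = Infty then 0 else - fin (u i)) = 0"
      using S Z by (intro sum.neutral) (auto simp: infty_set_def)
    finally have sum: "(\<Sum>i\<in>I \<union> S. if u i = Infty then 0 else - fin (u i)) = sum (\<lambda>i. - fin (u i)) I"
      by simp
    have "snd (the (?R I)) = snd (the (P (I \<union> S)))"
      using b IZ by (cases "P (I \<union> S)") (auto simp: restr_def neg_one_pow_trop)
    then show "snd (?w (I \<union> S)) = snd (- int (card S), w1 I)"
      by (simp add: snd_lex_pv_weight sum w1_def)
  qed
  have B0R: "?R (B0 - Z) \<noteq> None" "(B0 - Z) \<union> S = B0"
  proof -
    show "(B0 - Z) \<union> S = B0" using S by blast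
    then show "?R (B0 - Z) \<noteq> None" using B0'(1) by (auto simp: R)
  qed
  have min: "(\<forall>A. ?R A \<noteq> None \<longrightarrow> w1 I \<le> w1 A) \<longleftrightarrow> V.min_basis (I \<union> S)" if I: "?R I \<noteq> None" for I
  proof
    assume "\<forall>A. ?R A \<noteq> None \<longrightarrow> w1 I \<le> w1 A"
    then have "w1 I \<le> w1 (B0 - Z)" using B0R(1) by blast
    then have "?w (I \<union> S) \<le> ?w B0"
      using w1[OF I] w1[OF B0R(1)] unfolding B0R(2) by (simp add: less_eq_prod_def)
    then show "V.min_basis (I \<union> S)"
      using B0'(2) I R by (auto simp: V.min_basis_def intro: order_trans)
  next
    assume m: "V.min_basis (I \<union> S)"
    show "\<forall>A. ?R A \<noteq> None \<longrightarrow> w1 I \<le> w1 A"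
    proof (intro allI impI)
      fix A assume A: "?R A \<noteq> None"
      then have "?w (I \<union> S) \<le> ?w (A \<union> S)" using m R by (auto simp: V.min_basis_def)
      then show "w1 I \<le> w1 A" using w1[OF I] w1[OF A] by (simp add: less_eq_prod_def)
    qed
  qed
  have theta_R: "theta (?R I) = mul F (sg (minor_sign S I)) (theta (P (I \<union> S)))" if "I \<inter> Z = {}" for I
    using that by (simp add: restr_def theta_mul theta_neg_one_pow)
  have ip: "initial_pv (E - Z) (r - card S) (\<lambda>i. fin (u i)) ?R I =
      (if ?R I \<noteq> None \<and> (\<forall>A. ?R A \<noteq> None \<longrightarrow> w1 I \<le> w1 A) then theta (?R I) else None)" for I
    unfolding w1_def by (rule initial_pv_eq[OF pvR])
  show "initial_pv (E - Z) (r - card S) (\<lambda>i. fin (u i)) ?R = restr F Z S V.initial_P"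
  proof
    fix I
    show "initial_pv (E - Z) (r - card S) (\<lambda>i. fin (u i)) ?R I = restr F Z S V.initial_P I"
    proof (cases "?R I = None")
      case True
      then have "I \<inter> Z \<noteq> {} \<or> P (I \<union> S) = None" using R by blast
      then have "restr F Z S V.initial_P I = None" by (auto simp: restr_def V.initial_P_def)
      then show ?thesis unfolding ip using True by simp
    next
      case False
      then have IZ: "I \<inter> Z = {}" using R by blast
      show ?thesis
        unfolding ip min[OF False] theta_R[OF IZ]
        using False IZ by (simp add: restr_def V.initial_P_def)
    qed
  qed
qed

end

theorem proposition3p12:
  fixes F :: "'f tract"
    and E :: "'e::linorder set"
    and M :: "('e, 'f \<times> 'g::linordered_ab_group_add) fmatroid"
    and k :: kind
  assumes "tract F"
    and "finite E"
    and "is_fmatroid k (trop_ext F) M"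
    and "ground M = E"
  shows "(\<forall>u :: 'e \<Rightarrow> 'g ext. let Z = infty_set E u in
            circuits F (initial k F M u) =
              min_supp {initial_vec E u C | C. C \<in> circuits (trop_ext F) M} \<and>
            cocircuits F (initial k F M u) =
              min_supp {initial_vec (E - Z) (\<lambda>i. Fin (- fin (u i))) (delete D Z) | D.
                          D \<in> cocircuits (trop_ext F) M \<and> supp D \<inter> Z = {}}
              \<union> {scale F \<alpha> (chi F i) | \<alpha> i. \<alpha> \<in> carrier F \<and> i \<in> Z})
       \<and> (\<forall>v :: 'e \<Rightarrow> 'g.
            cocircuits F (initial_fin F M v) =
              min_supp {initial_vec E (\<lambda>i. Fin (- v i)) D | D. D \<in> cocircuits (trop_ext F) M} \<and>
            circuits F (initial_fin F M v) =
              min_supp {initial_vec E (\<lambda>i. Fin (v i)) C | C. C \<in> circuits (trop_ext F) M})"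
proof -
  interpret tract F by fact
  interpret T: tract "trop_ext F :: ('f \<times> 'g) tract" by (rule tract_trop_ext)
  note fin = \<open>finite E\<close>
  define r where "r = rk M"
  obtain P where M: "M = \<lparr>ground = E, rk = r, pvs = scaling_class (trop_ext F) P\<rparr>"
    and P: "pluecker k (trop_ext F) E r P"
    using T.is_fmatroidD[OF assms(3)] unfolding assms(4) r_def by blast
  have pv: "pv_function (trop_ext F) E r P" using P by (rule T.pluecker_imp_pv)
  have P_dual: "pluecker k (trop_ext F) E (card E - r) (dual_pv (trop_ext F) E P)"
    by (rule T.pluecker_dual[OF fin P])
  have circ_M: "circuits (trop_ext F) M = circ (trop_ext F) E r P"
    unfolding M by (rule T.circuits_mk[OF P])
  have cocirc_M: "cocircuits (trop_ext F) M = circ (trop_ext F) E (card E - r) (dual_pv (trop_ext F) E P)"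
    unfolding cocircuits_def M T.dual_mk[OF fin P] by (rule T.circuits_mk[OF P_dual])
  show ?thesis
  proof (intro conjI allI)
    fix v :: "'e \<Rightarrow> 'g"
    have Q: "pluecker k F E r (initial_pv E r v P)" by (rule pluecker_initial[OF fin P])
    show "circuits F (initial_fin F M v) =
        min_supp {initial_vec E (\<lambda>i. Fin (v i)) C | C. C \<in> circuits (trop_ext F) M}"
      unfolding circ_M unfolding M initial_fin_mk[OF fin P] circuits_mk[OF Q]
      by (rule circ_initial_pv[OF fin P])
    show "cocircuits F (initial_fin F M v) =
        min_supp {initial_vec E (\<lambda>i. Fin (- v i)) D | D. D \<in> cocircuits (trop_ext F) M}"
      unfolding cocirc_M unfolding cocircuits_def M initial_fin_mk[OF fin P] dual_mk[OF fin Q]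
        circuits_mk[OF pluecker_dual[OF fin Q]]
      by (rule circ_dual_initial_pv[OF fin P])
  next
    fix u :: "'e \<Rightarrow> 'g ext"
    define Z where "Z = infty_set E u"
    have ZE: "Z \<subseteq> E" by (auto simp: Z_def infty_set_def)
    then have finZ: "finite Z" "finite (E - Z)" and EZ: "(E - Z) \<inter> Z = {}" "E - Z \<union> Z = E"
      using fin finite_subset by auto
    interpret V: valuated F E r "\<lambda>B. theta (P B)" "lex_pv_weight u P" by (rule valuated_lex[OF fin P])
    interpret I: valuated F E r V.initial_P "\<lambda>_. 0::int" by (rule V.valuated_initial)
    obtain B0 where B0: "V.min_basis B0" using V.min_basis_exists by blast
    then have PB0: "P B0 \<noteq> None" using V.min_basisD by auto
    define S where "S = B0 \<inter> Z"
    note init = initial_restr[OF fin P Z_def B0 S_def]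
    let ?R = "restr (trop_ext F) Z S P"
    let ?Q = "initial_pv (E - Z) (r - card S) (\<lambda>i. fin (u i)) ?R"
    have R: "pluecker k (trop_ext F) (E - Z) (r - card S) ?R"
      by (rule T.pluecker_restr[OF fin P PB0 S_def])
    have Q: "pluecker k F (E - Z) (r - card S) ?Q" by (rule pluecker_initial[OF finZ(2) R])
    have elt_Q: "elt F (?Q I)" for I by (rule pv_elt[OF pluecker_imp_pv[OF Q]])
    let ?C = "coext F Z ?Q"
    have C: "pluecker k F E (r - card S + card Z) ?C"
      using pluecker_coext[OF finZ(2,1) EZ(1) Q] unfolding EZ(2) .
    have "contract k (trop_ext F) M Z =
        \<lparr>ground = E - Z, rk = r - card S, pvs = scaling_class (trop_ext F) ?R\<rparr>"
      unfolding M by (rule T.contract_mk[OF fin P PB0 S_def init(2)])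
    then have "initial k F M u = add_coloops k F
        \<lparr>ground = E - Z, rk = r - card S, pvs = scaling_class F ?Q\<rparr> Z"
      by (simp only: initial_def Let_def assms(4) Z_def[symmetric] initial_fin_mk[OF finZ(2) R])
    then have initial: "initial k F M u =
        \<lparr>ground = E, rk = r - card S + card Z, pvs = scaling_class F ?C\<rparr>"
      unfolding add_coloops_mk[OF finZ(2,1) EZ(1) Q] EZ(2) .
    have circuits: "circuits F (initial k F M u) = min_supp {initial_vec E u C | C. C \<in> circuits (trop_ext F) M}"
    proof -
      have "circuits F (initial k F M u) = circ F E (r - card S + card Z) ?C"
        unfolding initial by (rule circuits_mk[OF C])
      also have "\<dots> = circ F (E - Z) (r - card S) ?Q"
        using circ_coext[OF finZ(2,1) EZ(1), of ?Q "r - card S", OF elt_Q] unfolding EZ(2) .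
      \<comment> \<open>All lightest bases meet \<open>Z\<close> in \<open>card S\<close> elements,
        so \<open>S\<close> is also smallest possible for the initial matroid: there contraction and
        deletion of \<open>Z\<close> coincide.\<close>
      also have "\<dots> = {X \<in> circ F E r V.initial_P. supp X \<inter> Z = {}}"
        unfolding init(1)
      proof (rule I.circ_restr[OF _ S_def])
        show "V.initial_P B0 \<noteq> None" using B0 V.min_basisD by (simp add: V.initial_P_def)
        show "card S \<le> card (B \<inter> Z)" if "V.initial_P B \<noteq> None" for B
          using init(3)[of B] that by (simp add: V.initial_P_def split: if_splits)
      qed
      also have "\<dots> = min_supp {initial_vec E u C | C. C \<in> circ (trop_ext F) E r P}"
        unfolding Z_def by (rule circ_lex_initial[OF fin P])
      finally show ?thesis unfolding circ_M .
    qed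
    let ?q = "card (E - Z) - (r - card S)"
    let ?D = "\<lambda>D. initial_vec (E - Z) (\<lambda>i. Fin (- fin (u i))) D"
    have S: "S \<subseteq> Z" "S \<subseteq> B0" by (auto simp: S_def)
    have B0E: "B0 \<subseteq> E" "card B0 = r" using T.pv_basis[OF pv PB0] by auto
    have finS: "finite S" "finite B0" using S(1) B0E(1) finZ(1) fin finite_subset by auto
    have cards: "card (E - Z) = card E - card Z" "card (Z - S) = card Z - card S" "card Z \<le> card E"
        "card S \<le> card Z" "card S \<le> r"
      using ZE finZ fin S finS B0E by (auto simp: card_Diff_subset card_mono)
    \<comment> \<open>B0 - S is a basis of the contraction; the bound keeps the truncated
      subtractions in the dual ranks from cutting off.\<close>
    have "card (B0 - S) \<le> card (E - Z)"
      using B0E finZ(2) by (intro card_mono) (auto simp: S_def)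
    moreover have "card (B0 - S) = r - card S" using S finS B0E by (simp add: card_Diff_subset)
    ultimately have rS: "r - card S \<le> card E - card Z" using cards by simp
    have q: "?q = card E - (r - card S + card Z)" "?q = card E - r - card (Z - S)"
      unfolding cards(1,2) using cards(3-5) rS by auto
    \<comment> \<open>Dually \<open>Z\<close> is deleted: the complement of \<open>B0\<close> meets
      it in Z - S, which is smallest possible because \<open>S\<close> is largest possible.\<close>
    have codim: "circ (trop_ext F) (E - Z) ?q (dual_pv (trop_ext F) (E - Z) ?R) =
        {D \<in> cocircuits (trop_ext F) M. supp D \<inter> Z = {}}"
    proof -
      obtain e :: nat where e: "dual_pv (trop_ext F) (E - Z) ?R =
          scale (trop_ext F) (neg_one (trop_ext F) [^]\<^bsub>trop_ext F\<^esub> e)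
            (restr (trop_ext F) Z (Z - S) (dual_pv (trop_ext F) E P))"
        using T.dual_pv_restr[OF fin pv S(1) ZE] by blast
      interpret D: valuated "trop_ext F" E "card E - r" "dual_pv (trop_ext F) E P" "\<lambda>_. 0::int"
        by (rule T.valuated_of_pluecker[OF fin P_dual])
      have elt: "elt (trop_ext F) (restr (trop_ext F) Z (Z - S) (dual_pv (trop_ext F) E P) I)" for I
        by (simp add: restr_def)
      have "circ (trop_ext F) (E - Z) ?q (dual_pv (trop_ext F) (E - Z) ?R) =
          circ (trop_ext F) (E - Z) ?q (restr (trop_ext F) Z (Z - S) (dual_pv (trop_ext F) E P))"
        unfolding e by (rule T.circ_scale[OF elt]) (rule T.neg_one_pow_closed)
      also have "\<dots> = {D \<in> circ (trop_ext F) E (card E - r) (dual_pv (trop_ext F) E P). supp D \<inter> Z = {}}"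
        unfolding q(2)
      proof (rule D.circ_restr)
        have "E - (E - B0) = B0" using B0E by blast
        then show "dual_pv (trop_ext F) E P (E - B0) \<noteq> None"
          using PB0 by (simp add: T.dual_pv_eq_None[OF fin])
        show "Z - S = (E - B0) \<inter> Z" using ZE by (auto simp: S_def)
        fix B assume "dual_pv (trop_ext F) E P B \<noteq> None"
        then have B: "B \<subseteq> E" "P (E - B) \<noteq> None" using T.dual_pv_eq_None[OF fin] by auto
        have "card ((E - B) \<inter> Z) \<le> card S" by (rule init(2)[OF B(2)])
        moreover have "(E - B) \<inter> Z = Z - (B \<inter> Z)" using ZE by auto
        moreover have "card (Z - (B \<inter> Z)) = card Z - card (B \<inter> Z)"
          using finZ by (intro card_Diff_subset) auto
        moreover have "card (B \<inter> Z) \<le> card Z" using finZ by (intro card_mono) auto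
        ultimately show "card (Z - S) \<le> card (B \<inter> Z)" using cards by simp
      qed
      finally show ?thesis unfolding cocirc_M .
    qed
    have cocircuits: "cocircuits F (initial k F M u) =
        min_supp {?D (delete D Z) | D. D \<in> cocircuits (trop_ext F) M \<and> supp D \<inter> Z = {}}
        \<union> {scale F \<alpha> (chi F i) | \<alpha> i. \<alpha> \<in> carrier F \<and> i \<in> Z}"
    proof -
      have dual_Q: "pluecker k F (E - Z) ?q (dual_pv F (E - Z) ?Q)" by (rule pluecker_dual[OF finZ(2) Q])
      have elt_dual: "elt F (dual_pv F (E - Z) ?Q I)" for I
        by (rule pv_elt[OF pluecker_imp_pv[OF dual_Q]])
      have dual_C: "dual_pv F E ?C =
          scale F (neg_one F [^]\<^bsub>F\<^esub> minor_sign Z (E - Z)) (dual_pv F (E - Z) ?Q)"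
        using dual_pv_coext[OF finZ(2,1) EZ(1), of ?Q, OF elt_Q] unfolding EZ(2) .
      have "cocircuits F (initial k F M u) = circ F E ?q (dual_pv F E ?C)"
        unfolding cocircuits_def initial dual_mk[OF fin C] q(1)
        by (rule circuits_mk[OF pluecker_dual[OF fin C]])
      also have "\<dots> = circ F (E - Z \<union> Z) ?q (dual_pv F (E - Z) ?Q)"
        unfolding dual_C EZ(2) by (rule circ_scale[OF elt_dual]) simp
      \<comment> \<open>The coloops of the initial matroid are loops of its dual and contribute the
        multiples of unit vectors.\<close>
      also have "\<dots> = circ F (E - Z) ?q (dual_pv F (E - Z) ?Q)
          \<union> {scale F \<alpha> (chi F i) | \<alpha> i. \<alpha> \<in> carrier F \<and> i \<in> Z}"
        by (rule circ_loops[OF pluecker_imp_pv[OF dual_Q] EZ(1) finZ(2)])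
      also have "circ F (E - Z) ?q (dual_pv F (E - Z) ?Q) =
          min_supp {?D D | D. D \<in> {D \<in> cocircuits (trop_ext F) M. supp D \<inter> Z = {}}}"
        unfolding codim[symmetric] by (rule circ_dual_initial_pv[OF finZ(2) R])
      also have "{?D D | D. D \<in> {D \<in> cocircuits (trop_ext F) M. supp D \<inter> Z = {}}} =
          {?D (delete D Z) | D. D \<in> cocircuits (trop_ext F) M \<and> supp D \<inter> Z = {}}"
      proof -
        have "delete D Z = D" if "supp D \<inter> Z = {}" for D :: "'e \<Rightarrow> ('f \<times> 'g) option"
        proof
          fix i show "delete D Z i = D i"
            using that by (cases "D i = None") (auto simp: delete_def supp_def)
        qed
        then show ?thesis by (intro Collect_cong ex_cong1) auto
      qed
      finally show ?thesis .
    qed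
    show "let Z = infty_set E u in
        circuits F (initial k F M u) =
          min_supp {initial_vec E u C | C. C \<in> circuits (trop_ext F) M} \<and>
        cocircuits F (initial k F M u) =
          min_supp {initial_vec (E - Z) (\<lambda>i. Fin (- fin (u i))) (delete D Z) | D.
                      D \<in> cocircuits (trop_ext F) M \<and> supp D \<inter> Z = {}}
          \<union> {scale F \<alpha> (chi F i) | \<alpha> i. \<alpha> \<in> carrier F \<and> i \<in> Z}"
      using circuits cocircuits unfolding Let_def Z_def[symmetric] by blast
  qed
qed

end
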